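(* Let $(X,\infty)$ be a Weierstrass curve, with the notation $R_X$, $R_X^{\mathfrak c}$, $h_X$, $\hat{\mathfrak y}_{\mathfrak e_1},\dots,\hat{\mathfrak y}_{\mathfrak e_{r-1}}$ of the context. The complementary module $R_X^{\mathfrak c}$ is given as a fractional ideal of $R_X$ by $$R_X^{\mathfrak c}=\frac{\langle \hat{\mathfrak y}_{\mathfrak e_1},\dots,\hat{\mathfrak y}_{\mathfrak e_{r-1}}\rangle_{R_X}}{h_X(x,y_\bullet)},$$ where $\langle\,\cdot\,\rangle_{R_X}$ denotes the $R_X$-submodule generated by the listed elements.
   Context: Weierstrass curve. $(X,\infty)$ is a pointed compact Riemann surface (smooth complex projective curve) of genus $g$; $R_X=H^0(X,\mathcal O_X( *\infty))$ is the ring of meromorphic functions on $X$ holomorphic on $X\setminus\{\infty\}$, $\mathcal Q(R_X)$ its quotient field; $H_X=\{n\ge 0: \exists f \text{ meromorphic on } X \text{ with polar divisor } n\infty\}$ is the Weierstrass semigroup and $r$ its smallest positive element. The standard basis $\mathfrak e_0=0<\mathfrak e_1<\dots<\mathfrak e_{r-1}$ consists of the elements $\min\{h\in H_X: h\equiv i \bmod r\}$, $i=0,\dots,r-1$, in increasing order. It is assumed that $H_X$ has a minimal generating set $\{r_1=r,r_2=s,r_3,\dots,r_{m_X}\}$ with $s=\min\{\mathfrak e_i: i\geq 1,\gcd(\mathfrak e_i,r)=1\}$, and $X$ is the normalization of the plane curve given by an irreducible $f_X(x,y)=y^r+A_1(x)y^{r-1}+\dots+A_r(x)$ with $A_i\in\mathbb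 C[x]$, $\deg A_i\le is/r$, $A_r$ having $x^s$-coefficient $-1$; then $R_X=\mathbb C[x,y_{r_2},\dots,y_{r_{m_X}}]$ (a quotient of the polynomial ring), where $x$ and $y_{r_i}$ have their only pole at $\infty$, of order $r$ and $r_i$, $y_s=y_{r_2}=y$. Choosing positive integers with $i_s s-i_r r=1$, $t=x^{i_r}/y_s^{i_s}$ is a local parameter at $\infty$, and $y_{r_i}=t^{-r_i}(1+\text{higher order in }t)$. Write $y_\bullet=(y_{r_2},\dots,y_{r_{m_X}})$. The weight $\mathrm{wt}(f)$ is the order of vanishing of $f$ at $\infty$ ($\mathrm{wt}(x)=-r$, $\mathrm{wt}(y_{r_i})=-r_i$). $R_{\mathbb P}=\mathbb C[x]$ and $\varpi_r:X\to\mathbb P$ is the projection given by $x$. $R_X$ is a free $R_{\mathbb P}$-module with basis $\mathfrak y_{\mathfrak e_0}=1,\mathfrak y_{\mathfrak e_1},\dots,\mathfrak y_{\mathfrak e_{r-1}}$, $\mathfrak y_{\mathfrak e_i}$ a monic monomial of weight $-\mathfrak e_i$ in the $y_{r_j}$. Complementary module. $\tau_{R_X/R_{\mathbb P}}$ is the standard trace of $R_X$ over $R_{\mathbb P}$ (trace of multiplication, extended to $\mathcal Q(R_X)\to\mathcal Q(R_{\mathbb P})$), and $R_X^{\mathfrak c}=\{z\in\mathcal Q(R_X): \tau_{R_X/R_{\mathbb P}}(za)\in R_{\mathbb P}\ \forall a\in R_X\}$. The elements $\tilde h_{R_X}$ and $h_X$. For $j=2,\dots,m_X$ let $f_X^{(j)}(x,y)\in\mathbb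 C[x,y]$ be the irreducible polynomial, monic in $y$, with $f_X^{(j)}(x,y_{r_j})=0$ in $R_X$. View elements of $R_X\otimes_{R_{\mathbb P}}R_X$ as functions of pairs $(x,y_\bullet),(x,y_\bullet')$ of points of $X\times_{\mathbb P}X$. In its total quotient ring put $p_X^{(j)}(x,y,y')=\frac{(f_X^{(j)}(x,y)-f_X^{(j)}(x,y'))/(y-y')}{\partial_yf_X^{(j)}(x,y)}$ (the divided difference being taken as a polynomial) and $p_{R_X}=\prod_{j=2}^{m_X}p_X^{(j)}(x,y_{r_j},y_{r_j}')$. Then $\tilde h_{R_X}(x,y_\bullet,y'_\bullet)\in R_X\otimes_{R_{\mathbb P}}R_X$ denotes an element such that: $\tilde h_{R_X}(x,y_\bullet,y_\bullet)$ (identified with $\tilde h_{R_X}(x,y_\bullet,y_\bullet)\otimes1$) and $\tilde h_{R_X}(x,y_\bullet,y'_\bullet)$ are coprime; $\tilde h_{R_X}(x,y_\bullet,y_\bullet')/\tilde h_{R_X}(x,y_\bullet,y_\bullet)=p_{R_X}$ (this ratio is invariant under the finite group acting on the fiber $\varpi_r^{-1}(x)$); and, for some integer $d_h$ with $d_h-\mathfrak e_i\in H_X$ for all $i$, the leading homogeneous part of $\tilde h_{R_X}$ for $-\mathrm{wt}$ (both $y_\bullet$ and $y'_\bullet$ being weighted) is $\sum_{i=0}^{r-1}z^{d_h-\mathfrak e_i}z'^{\,\mathfrak e_i}$ under $x\mapsto z^r=z'^r$, $y_{r_j}\mapsto z^{r_j}$, $y_{r_j}'\mapsto z'^{\,r_j}$.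 Put $h_X(x,y_\bullet)=\tilde h_{R_X}(x,y_\bullet,y_\bullet)\in R_X$, so $d_h=-\mathrm{wt}(h_X)$. Let $\ell$ be determined by $d_h\equiv\mathfrak e_\ell\bmod r$, $\mathfrak e_{\ell,i}^*$ the standard basis element congruent to $\mathfrak e_\ell-\mathfrak e_i$ mod $r$, and $\delta_i=(d_h-\mathfrak e_i-\mathfrak e^*_{\ell,i})/r\ge0$. The elements $\hat\Upsilon_i$ and $\hat{\mathfrak y}_{\mathfrak e_i}$. $\hat\Upsilon_i\in R_X$ are determined by $\tilde h_{R_X}=\sum_{i=0}^{r-1}\hat\Upsilon_i\otimes\mathfrak y_{\mathfrak e_i}$; they have the form $\hat\Upsilon_i=\mathring{\mathfrak y}_{\mathfrak e_i}+(\text{terms of smaller }-\mathrm{wt})$ with $\mathring{\mathfrak y}_{\mathfrak e_i}=\tilde\delta_i(x)\,\mathfrak y_{\mathfrak e_{\ell,i}^*}$, $\tilde\delta_i\in\mathbb C[x]$ monic of degree $\delta_i$. The trace $\tau_{\tilde h}$ is the form determined by $\tau_{R_X/R_{\mathbb P}}(u)=\tau_{\tilde h}(h_Xu)$. For $i=0,\dots,r-1$, $\hat{\mathfrak y}_{\mathfrak e_i}$ is a truncation of $\hat\Upsilon_i$ (i.e. $\hat{\mathfrak y}_{\mathfrak e_i}=\mathring{\mathfrak y}_{\mathfrak e_i}+$ certain terms, and $\hat\Upsilon_i-\hat{\mathfrak y}_{\mathfrak e_i}$ has $-\mathrm{wt}$ less than $-\mathrm{wt}(\mathring{\mathfrak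 y}_{\mathfrak e_i})$) with the minimal number of terms such that $\langle\hat\Upsilon_1,\dots,\hat\Upsilon_{r-1}\rangle_{R_X}=\langle\hat{\mathfrak y}_{\mathfrak e_1},\dots,\hat{\mathfrak y}_{\mathfrak e_{r-1}}\rangle_{R_X}=\langle\hat{\mathfrak y}_{\mathfrak e_0},\dots,\hat{\mathfrak y}_{\mathfrak e_{r-1}}\rangle_{R_{\mathbb P}}$, and $\tau_{\tilde h}(\hat{\mathfrak y}_{\mathfrak e_0})=1$, $\tau_{\tilde h}(\hat{\mathfrak y}_{\mathfrak e_i})=0$ for $i\ne0$. *)

theory Defs
  imports
    "HOL-Algebra.Ring"
    "HOL-Algebra.Divisibility"
    "HOL-Library.Poly_Mapping"
    "HOL-Number_Theory.Cong"
    "HOL-Complex_Analysis.Complex_Analysis"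
begin

section \<open>Rings of fractions and spans\<close>

text \<open>Fractions are taken with regular (non-zero-divisor) denominators. This gives the total
  quotient ring of a commutative ring and, for a domain, its quotient field.\<close>

definition regular_elements :: "('a, 'b) ring_scheme \<Rightarrow> 'a set" where
  "regular_elements R =
     {b \<in> carrier R. \<forall>a\<in>carrier R. a \<otimes>\<^bsub>R\<^esub> b = \<zero>\<^bsub>R\<^esub> \<longrightarrow> a = \<zero>\<^bsub>R\<^esub>}"

text \<open>The fraction \<open>a / b\<close> is the class of all pairs \<open>(c, d)\<close> with \<open>a d = c b\<close>.\<close>

definition fraction :: "('a, 'b) ring_scheme \<Rightarrow> 'a \<Rightarrow> 'a \<Rightarrow> ('a \<times> 'a) set" where
  "fraction R a b =
     {(c, d). c \<in> carrier R \<and> d \<in> regular_elements R \<and> a \<otimes>\<^bsub>R\<^esub> d = c \<otimes>\<^bsub>R\<^esub> b}"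

definition total_quotient_ring :: "('a, 'b) ring_scheme \<Rightarrow> ('a \<times> 'a) set ring" where
  "total_quotient_ring R =
     \<lparr>carrier = {fraction R a b | a b. a \<in> carrier R \<and> b \<in> regular_elements R},
      monoid.mult = (\<lambda>u v. \<Union>(a, b)\<in>u. \<Union>(c, d)\<in>v. fraction R (a \<otimes>\<^bsub>R\<^esub> c) (b \<otimes>\<^bsub>R\<^esub> d)),
      one = fraction R \<one>\<^bsub>R\<^esub> \<one>\<^bsub>R\<^esub>,
      zero = fraction R \<zero>\<^bsub>R\<^esub> \<one>\<^bsub>R\<^esub>,
      add = (\<lambda>u v. \<Union>(a, b)\<in>u. \<Union>(c, d)\<in>v.
               fraction R ((a \<otimes>\<^bsub>R\<^esub> d) \<oplus>\<^bsub>R\<^esub> (c \<otimes>\<^bsub>R\<^esub> b)) (b \<otimes>\<^bsub>R\<^esub> d))\<rparr>"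

definition lin_span ::
  "('a, 'b) ring_scheme \<Rightarrow> 'a set \<Rightarrow> ('i \<Rightarrow> 'a) \<Rightarrow> 'i set \<Rightarrow> 'a set" where
  "lin_span R A g I = {(\<Oplus>\<^bsub>R\<^esub>i\<in>I. a i \<otimes>\<^bsub>R\<^esub> g i) | a. a \<in> I \<rightarrow> A}"


section \<open>Compact Riemann surfaces\<close>

type_synonym 'a atlas = "('a set \<times> ('a \<Rightarrow> complex)) set"

definition compact_riemann_surface :: "'a::t2_space atlas \<Rightarrow> bool" where
  "compact_riemann_surface \<A> \<longleftrightarrow>
     compact (UNIV :: 'a set) \<and> connected (UNIV :: 'a set) \<and>
     (\<Union>(U, \<phi>)\<in>\<A>. U) = UNIV \<and>
     (\<forall>(U, \<phi>)\<in>\<A>. open U \<and> open (\<phi> ` U) \<and> homeomorphism U (\<phi> ` U) \<phi> (inv_into U \<phi>)) \<and>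
     (\<forall>(U, \<phi>)\<in>\<A>. \<forall>(V, \<psi>)\<in>\<A>. (\<psi> \<circ> inv_into U \<phi>) holomorphic_on \<phi> ` (U \<inter> V))"

definition rs_holomorphic_on :: "'a::t2_space atlas \<Rightarrow> ('a \<Rightarrow> complex) \<Rightarrow> 'a set \<Rightarrow> bool" where
  "rs_holomorphic_on \<A> f W \<longleftrightarrow>
     (\<forall>(U, \<phi>)\<in>\<A>. (f \<circ> inv_into U \<phi>) holomorphic_on \<phi> ` (U \<inter> W))"

definition rs_meromorphic_at :: "'a::t2_space atlas \<Rightarrow> ('a \<Rightarrow> complex) \<Rightarrow> 'a \<Rightarrow> bool" where
  "rs_meromorphic_at \<A> f p \<longleftrightarrow>
     (\<forall>(U, \<phi>)\<in>\<A>. p \<in> U \<longrightarrow> (f \<circ> inv_into U \<phi>) meromorphic_on {\<phi> p})"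

text \<open>Order of vanishing at \<open>p\<close> (negative at a pole), read off in an arbitrary chart around \<open>p\<close>.
  It is only meaningful for functions that do not vanish identically near \<open>p\<close>.\<close>

definition rs_order :: "'a::t2_space atlas \<Rightarrow> ('a \<Rightarrow> complex) \<Rightarrow> 'a \<Rightarrow> int" where
  "rs_order \<A> f p =
     (case (SOME c. c \<in> \<A> \<and> p \<in> fst c) of
        (U, \<phi>) \<Rightarrow> zorder (f \<circ> inv_into U \<phi>) (\<phi> p))"


section \<open>The data of a Weierstrass curve\<close>

text \<open>
  \<open>w_gen C 1, \<dots>, w_gen C (w_num C)\<close> are the generators \<open>r\<^sub>1 = r, r\<^sub>2 = s, r\<^sub>3, \<dots>\<close> of the
  semigroup, \<open>w_x C\<close> is the function \<open>x\<close>, \<open>w_y C j\<close> is the function of pole order \<open>r\<^sub>j\<close>,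
  \<open>w_is C\<close> and \<open>w_ir C\<close> are the integers defining the local parameter \<open>t\<close>, \<open>w_f C\<close> is the
  polynomial of the plane curve (a polynomial in \<open>y\<close> over \<open>\<complex>[x]\<close>), and \<open>w_exp C i j\<close> is the
  exponent of \<open>w_y C j\<close> in the \<open>i\<close>-th monomial of the basis of \<open>R\<^sub>X\<close> over \<open>\<complex>[x]\<close>.\<close>

record 'a weierstrass_data =
  w_atlas :: "'a atlas"
  w_inf :: 'a
  w_num :: nat
  w_gen :: "nat \<Rightarrow> nat"
  w_x :: "'a \<Rightarrow> complex"
  w_y :: "nat \<Rightarrow> 'a \<Rightarrow> complex"
  w_is :: nat
  w_ir :: nat
  w_f :: "complex poly poly"
  w_exp :: "nat \<Rightarrow> nat \<Rightarrow> nat"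

abbreviation w_r :: "'a::t2_space weierstrass_data \<Rightarrow> nat" where
  "w_r C \<equiv> w_gen C 1"

abbreviation w_s :: "'a::t2_space weierstrass_data \<Rightarrow> nat" where
  "w_s C \<equiv> w_gen C 2"

text \<open>Elements of \<open>R\<^sub>X\<close> are functions on \<open>X - {\<infinity>}\<close>; the irrelevant value at \<open>\<infinity>\<close> is
  normalised to \<open>0\<close>.\<close>

definition RX :: "'a::t2_space weierstrass_data \<Rightarrow> ('a \<Rightarrow> complex) ring" where
  "RX C =
     \<lparr>carrier = {f. f (w_inf C) = 0 \<and> rs_holomorphic_on (w_atlas C) f (- {w_inf C}) \<and>
                    rs_meromorphic_at (w_atlas C) f (w_inf C)},
      monoid.mult = (\<lambda>f g P. f P * g P),
      one = (\<lambda>P. if P = w_inf C then 0 else 1),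
      zero = (\<lambda>P. 0),
      add = (\<lambda>f g P. f P + g P)\<rparr>"

abbreviation QX :: "'a::t2_space weierstrass_data \<Rightarrow> (('a \<Rightarrow> complex) \<times> ('a \<Rightarrow> complex)) set ring" where
  "QX C \<equiv> total_quotient_ring (RX C)"

definition to_QX ::
  "'a::t2_space weierstrass_data \<Rightarrow> ('a \<Rightarrow> complex) \<Rightarrow> (('a \<Rightarrow> complex) \<times> ('a \<Rightarrow> complex)) set" where
  "to_QX C a = fraction (RX C) a \<one>\<^bsub>RX C\<^esub>"

definition wt :: "'a::t2_space weierstrass_data \<Rightarrow> ('a \<Rightarrow> complex) \<Rightarrow> int" where
  "wt C f = rs_order (w_atlas C) f (w_inf C)"

definition has_pole_order :: "'a::t2_space weierstrass_data \<Rightarrow> ('a \<Rightarrow> complex) \<Rightarrow> nat \<Rightarrow> bool" where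
  "has_pole_order C f n \<longleftrightarrow> f \<in> carrier (RX C) \<and> f \<noteq> \<zero>\<^bsub>RX C\<^esub> \<and> - wt C f = int n"

text \<open>\<open>-wt u < -wt v\<close>, where \<open>-wt 0\<close> is minus infinity.\<close>

definition smaller_weight ::
  "'a::t2_space weierstrass_data \<Rightarrow> ('a \<Rightarrow> complex) \<Rightarrow> ('a \<Rightarrow> complex) \<Rightarrow> bool" where
  "smaller_weight C u v \<longleftrightarrow> u = \<zero>\<^bsub>RX C\<^esub> \<or> - wt C u < - wt C v"

definition HX :: "'a::t2_space weierstrass_data \<Rightarrow> nat set" where
  "HX C = {n. \<exists>f. has_pole_order C f n}"

definition generated_semigroup :: "nat set \<Rightarrow> nat set" where
  "generated_semigroup G = (\<lambda>M. 0 \<in> M \<and> (\<forall>a\<in>M. \<forall>b\<in>M. a + b \<in> M)) hull G"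

definition std_basis :: "'a::t2_space weierstrass_data \<Rightarrow> nat \<Rightarrow> nat" where
  "std_basis C i =
     sorted_list_of_set {(LEAST h. h \<in> HX C \<and> [h = k] (mod w_r C)) | k. k < w_r C} ! i"

text \<open>\<open>R\<^sub>P = \<complex>[x]\<close> is viewed inside \<open>R\<^sub>X\<close>, and its quotient field inside that of \<open>R\<^sub>X\<close>.\<close>

definition xpoly :: "'a::t2_space weierstrass_data \<Rightarrow> complex poly \<Rightarrow> 'a \<Rightarrow> complex" where
  "xpoly C p = (\<lambda>P. if P = w_inf C then 0 else poly p (w_x C P))"

definition RP :: "'a::t2_space weierstrass_data \<Rightarrow> ('a \<Rightarrow> complex) set" where
  "RP C = range (xpoly C)"

definition QP ::
  "'a::t2_space weierstrass_data \<Rightarrow> (('a \<Rightarrow> complex) \<times> ('a \<Rightarrow> complex)) set set" where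
  "QP C = {fraction (RX C) a b | a b. a \<in> RP C \<and> b \<in> RP C - {\<zero>\<^bsub>RX C\<^esub>}}"

text \<open>\<open>at_x f c\<close> is the polynomial \<open>f(c, y)\<close> in \<open>y\<close>.\<close>

definition at_x :: "complex poly poly \<Rightarrow> complex \<Rightarrow> complex poly" where
  "at_x f c = map_poly (\<lambda>a. poly a c) f"

definition xypoly :: "'a::t2_space weierstrass_data \<Rightarrow> complex poly poly \<Rightarrow> 'a \<Rightarrow> complex" where
  "xypoly C g = (\<lambda>P. if P = w_inf C then 0 else poly (at_x g (w_x C P)) (w_y C 2 P))"

text \<open>\<open>X - {\<infinity>}\<close> is the normalization of the affine plane curve \<open>f = 0\<close> via \<open>(x, y)\<close>: the
  coordinate ring of that curve is \<open>\<complex>[x, y] \<subseteq> R\<^sub>X\<close>, and \<open>R\<^sub>X\<close> is its integral closure in its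
  own quotient field.\<close>

definition is_normalization_of :: "'a::t2_space weierstrass_data \<Rightarrow> complex poly poly \<Rightarrow> bool" where
  "is_normalization_of C f \<longleftrightarrow>
     xypoly C f = \<zero>\<^bsub>RX C\<^esub> \<and>
     to_QX C ` carrier (RX C) =
       {u \<in> carrier (QX C).
          (\<exists>a\<in>range (xypoly C). \<exists>b\<in>range (xypoly C) - {\<zero>\<^bsub>RX C\<^esub>}. u = fraction (RX C) a b) \<and>
          (\<exists>n::nat. \<exists>c\<in>{..<n} \<rightarrow> range (xypoly C).
             (u [^]\<^bsub>QX C\<^esub> n) \<oplus>\<^bsub>QX C\<^esub>
             (\<Oplus>\<^bsub>QX C\<^esub>k\<in>{..<n}. to_QX C (c k) \<otimes>\<^bsub>QX C\<^esub> (u [^]\<^bsub>QX C\<^esub> k)) = \<zero>\<^bsub>QX C\<^esub>)}"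

text \<open>The last but one conjunct says \<open>y\<^sub>j = t\<^sup>-\<^sup>r\<^sup>j (1 + higher order)\<close> for the local parameter
  \<open>t = x\<^sup>i\<^sup>r / y\<^sub>s\<^sup>i\<^sup>s\<close>.\<close>

definition weierstrass_curve :: "'a::t2_space weierstrass_data \<Rightarrow> bool" where
  "weierstrass_curve C \<longleftrightarrow>
     compact_riemann_surface (w_atlas C) \<and>
     w_r C \<in> HX C \<and> 0 < w_r C \<and> (\<forall>n\<in>HX C. 0 < n \<longrightarrow> w_r C \<le> n) \<and>
     2 \<le> w_num C \<and> inj_on (w_gen C) {1..w_num C} \<and>
     generated_semigroup (w_gen C ` {1..w_num C}) = HX C \<and>
     (\<forall>G. G \<subset> w_gen C ` {1..w_num C} \<longrightarrow> generated_semigroup G \<noteq> HX C) \<and>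
     (\<exists>i\<in>{1..<w_r C}. w_s C = std_basis C i) \<and> gcd (w_s C) (w_r C) = 1 \<and>
     (\<forall>i\<in>{1..<w_r C}. gcd (std_basis C i) (w_r C) = 1 \<longrightarrow> w_s C \<le> std_basis C i) \<and>
     has_pole_order C (w_x C) (w_r C) \<and>
     (\<forall>j\<in>{2..w_num C}. has_pole_order C (w_y C j) (w_gen C j)) \<and>
     Factorial_Ring.irreducible (w_f C) \<and> degree (w_f C) = w_r C \<and> lead_coeff (w_f C) = 1 \<and>
     (\<forall>i\<in>{1..w_r C}. w_r C * degree (coeff (w_f C) (w_r C - i)) \<le> i * w_s C) \<and>
     coeff (coeff (w_f C) 0) (w_s C) = - 1 \<and>
     is_normalization_of C (w_f C) \<and>
     0 < w_is C \<and> 0 < w_ir C \<and> w_is C * w_s C = w_ir C * w_r C + 1 \<and>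
     (\<forall>j\<in>{2..w_num C}.
        ((\<lambda>P. w_y C j P * (w_x C P ^ w_ir C / w_y C 2 P ^ w_is C) ^ w_gen C j) \<longlongrightarrow> 1)
          (at (w_inf C))) \<and>
     (\<forall>i<w_r C. (\<Sum>j=2..w_num C. w_exp C i j * w_gen C j) = std_basis C i)"

text \<open>The basis of \<open>R\<^sub>X\<close> over \<open>\<complex>[x]\<close> by monic monomials in the \<open>y\<^sub>j\<close>.\<close>

definition ybasis :: "'a::t2_space weierstrass_data \<Rightarrow> nat \<Rightarrow> 'a \<Rightarrow> complex" where
  "ybasis C i = (\<lambda>P. if P = w_inf C then 0 else (\<Prod>j=2..w_num C. w_y C j P ^ w_exp C i j))"


section \<open>The trace and the complementary module\<close>

text \<open>The trace of the matrix, over the quotient field of \<open>\<complex>[x]\<close>, of multiplication by \<open>u\<close>.\<close>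

definition trace_X ::
  "'a::t2_space weierstrass_data \<Rightarrow> (('a \<Rightarrow> complex) \<times> ('a \<Rightarrow> complex)) set \<Rightarrow>
     (('a \<Rightarrow> complex) \<times> ('a \<Rightarrow> complex)) set" where
  "trace_X C u = (THE \<tau>. \<exists>c.
     (\<forall>i<w_r C. \<forall>j<w_r C. c i j \<in> QP C) \<and>
     (\<forall>j<w_r C. u \<otimes>\<^bsub>QX C\<^esub> to_QX C (ybasis C j) =
        (\<Oplus>\<^bsub>QX C\<^esub>i\<in>{..<w_r C}. c i j \<otimes>\<^bsub>QX C\<^esub> to_QX C (ybasis C i))) \<and>
     \<tau> = (\<Oplus>\<^bsub>QX C\<^esub>i\<in>{..<w_r C}. c i i))"

definition complementary_module ::
  "'a::t2_space weierstrass_data \<Rightarrow> (('a \<Rightarrow> complex) \<times> ('a \<Rightarrow> complex)) set set" where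
  "complementary_module C =
     {z \<in> carrier (QX C). \<forall>a\<in>carrier (RX C). trace_X C (z \<otimes>\<^bsub>QX C\<^esub> to_QX C a) \<in> to_QX C ` RP C}"


section \<open>The tensor square of the affine ring over the ring of polynomials in x\<close>

definition fibre_product :: "'a::t2_space weierstrass_data \<Rightarrow> ('a \<times> 'a) set" where
  "fibre_product C = {(P, Q). P \<noteq> w_inf C \<and> Q \<noteq> w_inf C \<and> w_x C P = w_x C Q}"

definition tens ::
  "'a::t2_space weierstrass_data \<Rightarrow> ('a \<Rightarrow> complex) \<Rightarrow> ('a \<Rightarrow> complex) \<Rightarrow> 'a \<times> 'a \<Rightarrow> complex" where
  "tens C a b = (\<lambda>w. if w \<in> fibre_product C then a (fst w) * b (snd w) else 0)"

text \<open>\<open>R\<^sub>X \<otimes> R\<^sub>X\<close> (over \<open>\<complex>[x]\<close>) as the ring of functions \<open>(P, Q) \<mapsto> \<Sum> a\<^sub>k(P) b\<^sub>k(Q)\<close> on the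
  affine part of the fibre product, extended by \<open>0\<close>. No information is lost: \<open>R\<^sub>X \<otimes> R\<^sub>X\<close> is
  free over \<open>\<complex>[x]\<close> on the tensors of basis elements, and these are independent as functions on a
  general fibre, which consists of \<open>r\<close> points.\<close>

definition TX :: "'a::t2_space weierstrass_data \<Rightarrow> ('a \<times> 'a \<Rightarrow> complex) ring" where
  "TX C =
     \<lparr>carrier = {F. \<exists>(n::nat) a b.
        (\<forall>k<n. a k \<in> carrier (RX C) \<and> b k \<in> carrier (RX C)) \<and>
        F = (\<lambda>w. \<Sum>k<n. tens C (a k) (b k) w)},
      monoid.mult = (\<lambda>F G w. F w * G w),
      one = (\<lambda>w. if w \<in> fibre_product C then 1 else 0),
      zero = (\<lambda>w. 0),
      add = (\<lambda>F G w. F w + G w)\<rparr>"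

definition is_min_poly :: "'a::t2_space weierstrass_data \<Rightarrow> nat \<Rightarrow> complex poly poly \<Rightarrow> bool" where
  "is_min_poly C j f \<longleftrightarrow>
     Factorial_Ring.irreducible f \<and> lead_coeff f = 1 \<and>
     (\<forall>P. P \<noteq> w_inf C \<longrightarrow> poly (at_x f (w_x C P)) (w_y C j P) = 0)"

text \<open>\<open>synthetic_div p b\<close> is the quotient of \<open>p(y) - p(b)\<close> by \<open>y - b\<close>, so this is the divided
  difference of \<open>f(x, y)\<close> with respect to \<open>y\<close>, as a polynomial, at \<open>y = y\<^sub>j\<close>, \<open>y' = y\<^sub>j'\<close>.\<close>

definition divided_difference ::
  "'a::t2_space weierstrass_data \<Rightarrow> complex poly poly \<Rightarrow> nat \<Rightarrow> 'a \<times> 'a \<Rightarrow> complex" where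
  "divided_difference C f j = (\<lambda>(P, Q).
     if (P, Q) \<in> fibre_product C
     then poly (synthetic_div (at_x f (w_x C P)) (w_y C j Q)) (w_y C j P) else 0)"

definition partial_y ::
  "'a::t2_space weierstrass_data \<Rightarrow> complex poly poly \<Rightarrow> nat \<Rightarrow> 'a \<times> 'a \<Rightarrow> complex" where
  "partial_y C f j = (\<lambda>(P, Q).
     if (P, Q) \<in> fibre_product C
     then poly (at_x (pderiv f) (w_x C P)) (w_y C j P) else 0)"

definition p_RX ::
  "'a::t2_space weierstrass_data \<Rightarrow> (nat \<Rightarrow> complex poly poly) \<Rightarrow>
     (('a \<times> 'a \<Rightarrow> complex) \<times> ('a \<times> 'a \<Rightarrow> complex)) set" where
  "p_RX C f = (\<Otimes>\<^bsub>total_quotient_ring (TX C)\<^esub>j\<in>{2..w_num C}.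
     fraction (TX C) (divided_difference C (f j) j) (partial_y C (f j) j))"


section \<open>Weighted polynomials in x, y, y'\<close>

datatype cvar = VX | VY nat | VY' nat

type_synonym cpoly = "(cvar \<Rightarrow>\<^sub>0 nat) \<Rightarrow>\<^sub>0 complex"

definition cmonom_eval :: "(cvar \<Rightarrow> complex) \<Rightarrow> (cvar \<Rightarrow>\<^sub>0 nat) \<Rightarrow> complex" where
  "cmonom_eval \<nu> m = (\<Prod>v\<in>Poly_Mapping.keys m. \<nu> v ^ Poly_Mapping.lookup m v)"

definition cpoly_eval :: "(cvar \<Rightarrow> complex) \<Rightarrow> cpoly \<Rightarrow> complex" where
  "cpoly_eval \<nu> q = (\<Sum>m\<in>Poly_Mapping.keys q. Poly_Mapping.lookup q m * cmonom_eval \<nu> m)"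

definition cpoly_vars :: "cpoly \<Rightarrow> cvar set" where
  "cpoly_vars q = (\<Union>m\<in>Poly_Mapping.keys q. Poly_Mapping.keys m)"

text \<open>The value of \<open>-wt\<close> on monomials.\<close>

definition cmonom_weight :: "'a::t2_space weierstrass_data \<Rightarrow> (cvar \<Rightarrow>\<^sub>0 nat) \<Rightarrow> nat" where
  "cmonom_weight C m = (\<Sum>v\<in>Poly_Mapping.keys m. Poly_Mapping.lookup m v *
     (case v of VX \<Rightarrow> w_r C | VY j \<Rightarrow> w_gen C j | VY' j \<Rightarrow> w_gen C j))"

definition homogeneous_part :: "'a::t2_space weierstrass_data \<Rightarrow> nat \<Rightarrow> cpoly \<Rightarrow> cpoly" where
  "homogeneous_part C d q =
     (\<Sum>m\<in>{m \<in> Poly_Mapping.keys q. cmonom_weight C m = d}.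
        Poly_Mapping.single m (Poly_Mapping.lookup q m))"

text \<open>\<open>h\<close> is represented by a polynomial in \<open>x, y, y'\<close> of weight at most \<open>d\<close> whose part of weight
  \<open>d\<close> becomes \<open>\<Sum> z\<^sup>d\<^sup>-\<^sup>e z'\<^sup>e\<close> (\<open>e\<close> in the standard basis) in \<open>\<complex>[z, z'] / (z\<^sup>r - z'\<^sup>r)\<close>. This
  ring is reduced, so the identity may be tested on all \<open>z, z' \<in> \<complex>\<close> with \<open>z\<^sup>r = z'\<^sup>r\<close>.\<close>

definition has_leading_part ::
  "'a::t2_space weierstrass_data \<Rightarrow> ('a \<times> 'a \<Rightarrow> complex) \<Rightarrow> nat \<Rightarrow> bool" where
  "has_leading_part C h d \<longleftrightarrow> (\<exists>q.
     cpoly_vars q \<subseteq> {VX} \<union> VY ` {2..w_num C} \<union> VY' ` {2..w_num C} \<and>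
     h = (\<lambda>(P, Q). if (P, Q) \<in> fibre_product C
            then cpoly_eval (\<lambda>v. case v of VX \<Rightarrow> w_x C P | VY j \<Rightarrow> w_y C j P | VY' j \<Rightarrow> w_y C j Q) q
            else 0) \<and>
     (\<forall>m\<in>Poly_Mapping.keys q. cmonom_weight C m \<le> d) \<and>
     (\<forall>z z'. z ^ w_r C = z' ^ w_r C \<longrightarrow>
        cpoly_eval (\<lambda>v. case v of VX \<Rightarrow> z ^ w_r C | VY j \<Rightarrow> z ^ w_gen C j | VY' j \<Rightarrow> z' ^ w_gen C j)
            (homogeneous_part C d q) =
          (\<Sum>i<w_r C. z ^ (d - std_basis C i) * z' ^ std_basis C i)))"


section \<open>The elements attached to h\<close>

definition diag :: "('a \<times> 'a \<Rightarrow> complex) \<Rightarrow> 'a \<Rightarrow> complex" where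
  "diag h = (\<lambda>P. h (P, P))"

text \<open>The equality of ratios is taken in the total quotient ring of \<open>R\<^sub>X \<otimes> R\<^sub>X\<close>.\<close>

definition is_htilde ::
  "'a::t2_space weierstrass_data \<Rightarrow> (nat \<Rightarrow> complex poly poly) \<Rightarrow>
     ('a \<times> 'a \<Rightarrow> complex) \<Rightarrow> nat \<Rightarrow> bool" where
  "is_htilde C f h d \<longleftrightarrow>
     h \<in> carrier (TX C) \<and>
     \<one>\<^bsub>TX C\<^esub> gcdof\<^bsub>TX C\<^esub> (tens C (diag h) \<one>\<^bsub>RX C\<^esub>) h \<and>
     tens C (diag h) \<one>\<^bsub>RX C\<^esub> \<in> regular_elements (TX C) \<and>
     fraction (TX C) h (tens C (diag h) \<one>\<^bsub>RX C\<^esub>) = p_RX C f \<and>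
     (\<forall>i<w_r C. std_basis C i \<le> d \<and> d - std_basis C i \<in> HX C) \<and>
     has_leading_part C h d"

text \<open>The form \<open>\<tau>\<^sub>h\<close> determined by \<open>\<tau>(u) = \<tau>\<^sub>h(h\<^sub>X u)\<close>.\<close>

definition trace_h ::
  "'a::t2_space weierstrass_data \<Rightarrow> ('a \<times> 'a \<Rightarrow> complex) \<Rightarrow>
     (('a \<Rightarrow> complex) \<times> ('a \<Rightarrow> complex)) set \<Rightarrow> (('a \<Rightarrow> complex) \<times> ('a \<Rightarrow> complex)) set" where
  "trace_h C h v = trace_X C (v \<otimes>\<^bsub>QX C\<^esub> fraction (RX C) \<one>\<^bsub>RX C\<^esub> (diag h))"

definition is_Upsilon ::
  "'a::t2_space weierstrass_data \<Rightarrow> ('a \<times> 'a \<Rightarrow> complex) \<Rightarrow> (nat \<Rightarrow> 'a \<Rightarrow> complex) \<Rightarrow> bool" where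
  "is_Upsilon C h Ups \<longleftrightarrow>
     (\<forall>i<w_r C. Ups i \<in> carrier (RX C)) \<and>
     h = (\<lambda>w. \<Sum>i<w_r C. tens C (Ups i) (ybasis C i) w)"

text \<open>The index \<open>k\<close> of the standard basis element congruent to \<open>e\<^sub>l - e\<^sub>i\<close> modulo \<open>r\<close>.\<close>

definition star_index :: "'a::t2_space weierstrass_data \<Rightarrow> nat \<Rightarrow> nat \<Rightarrow> nat" where
  "star_index C l i = (THE k. k < w_r C \<and>
     [int (std_basis C k) = int (std_basis C l) - int (std_basis C i)] (mod int (w_r C)))"

definition delta :: "'a::t2_space weierstrass_data \<Rightarrow> nat \<Rightarrow> nat \<Rightarrow> nat \<Rightarrow> nat" where
  "delta C d l i = (d - std_basis C i - std_basis C (star_index C l i)) div w_r C"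

text \<open>The leading terms \<open>\<delta>\<^sub>i(x) y\<close> of \<open>Ups i\<close>, where \<open>dt i\<close> is the monic polynomial \<open>\<delta>\<^sub>i\<close>.\<close>

definition y_ring ::
  "'a::t2_space weierstrass_data \<Rightarrow> nat \<Rightarrow> (nat \<Rightarrow> complex poly) \<Rightarrow> nat \<Rightarrow> 'a \<Rightarrow> complex" where
  "y_ring C l dt i = xpoly C (dt i) \<otimes>\<^bsub>RX C\<^esub> ybasis C (star_index C l i)"

definition is_leading_coeffs ::
  "'a::t2_space weierstrass_data \<Rightarrow> nat \<Rightarrow> nat \<Rightarrow> (nat \<Rightarrow> 'a \<Rightarrow> complex) \<Rightarrow>
     (nat \<Rightarrow> complex poly) \<Rightarrow> bool" where
  "is_leading_coeffs C d l Ups dt \<longleftrightarrow>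
     (\<forall>i<w_r C. lead_coeff (dt i) = 1 \<and> degree (dt i) = delta C d l i \<and>
        smaller_weight C (Ups i \<ominus>\<^bsub>RX C\<^esub> y_ring C l dt i) (y_ring C l dt i))"

text \<open>The coefficients of an element of \<open>R\<^sub>X\<close> in the basis \<open>x\<^sup>a ybasis k\<close> over \<open>\<complex>\<close>. The terms of
  an element are those with nonzero coefficient.\<close>

definition expansion ::
  "'a::t2_space weierstrass_data \<Rightarrow> ('a \<Rightarrow> complex) \<Rightarrow> nat \<Rightarrow> nat \<Rightarrow> complex" where
  "expansion C u k a = coeff ((THE p. (\<forall>k\<ge>w_r C. p k = 0) \<and>
     u = (\<Oplus>\<^bsub>RX C\<^esub>k\<in>{..<w_r C}. xpoly C (p k) \<otimes>\<^bsub>RX C\<^esub> ybasis C k)) k) a"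

definition terms_of :: "'a::t2_space weierstrass_data \<Rightarrow> ('a \<Rightarrow> complex) \<Rightarrow> (nat \<times> nat) set" where
  "terms_of C u = {(k, a). k < w_r C \<and> expansion C u k a \<noteq> 0}"

text \<open>\<open>v\<close> is the leading part \<open>v0\<close> of \<open>u\<close> plus some of the remaining terms of \<open>u\<close>.\<close>

definition is_truncation ::
  "'a::t2_space weierstrass_data \<Rightarrow> ('a \<Rightarrow> complex) \<Rightarrow> ('a \<Rightarrow> complex) \<Rightarrow> ('a \<Rightarrow> complex) \<Rightarrow> bool" where
  "is_truncation C u v0 v \<longleftrightarrow>
     v \<in> carrier (RX C) \<and>
     (\<forall>k<w_r C. \<forall>a. expansion C (v \<ominus>\<^bsub>RX C\<^esub> v0) k a \<in> {0, expansion C (u \<ominus>\<^bsub>RX C\<^esub> v0) k a}) \<and>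
     smaller_weight C (u \<ominus>\<^bsub>RX C\<^esub> v) v0"

definition is_admissible ::
  "'a::t2_space weierstrass_data \<Rightarrow> ('a \<times> 'a \<Rightarrow> complex) \<Rightarrow> nat \<Rightarrow> (nat \<Rightarrow> 'a \<Rightarrow> complex) \<Rightarrow>
     (nat \<Rightarrow> complex poly) \<Rightarrow> (nat \<Rightarrow> 'a \<Rightarrow> complex) \<Rightarrow> bool" where
  "is_admissible C h l Ups dt yh \<longleftrightarrow>
     (\<forall>i<w_r C. is_truncation C (Ups i) (y_ring C l dt i) (yh i)) \<and>
     lin_span (RX C) (carrier (RX C)) Ups {1..<w_r C} =
       lin_span (RX C) (carrier (RX C)) yh {1..<w_r C} \<and>
     lin_span (RX C) (carrier (RX C)) yh {1..<w_r C} =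
       lin_span (RX C) (RP C) yh {..<w_r C} \<and>
     trace_h C h (to_QX C (yh 0)) = \<one>\<^bsub>QX C\<^esub> \<and>
     (\<forall>i\<in>{1..<w_r C}. trace_h C h (to_QX C (yh i)) = \<zero>\<^bsub>QX C\<^esub>)"

definition is_yhat ::
  "'a::t2_space weierstrass_data \<Rightarrow> ('a \<times> 'a \<Rightarrow> complex) \<Rightarrow> nat \<Rightarrow> (nat \<Rightarrow> 'a \<Rightarrow> complex) \<Rightarrow>
     (nat \<Rightarrow> complex poly) \<Rightarrow> (nat \<Rightarrow> 'a \<Rightarrow> complex) \<Rightarrow> bool" where
  "is_yhat C h l Ups dt yh \<longleftrightarrow>
     is_admissible C h l Ups dt yh \<and>
     (\<forall>yh'. is_admissible C h l Ups dt yh' \<longrightarrow>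
        (\<Sum>i<w_r C. card (terms_of C (yh i))) \<le> (\<Sum>i<w_r C. card (terms_of C (yh' i))))"

end

theory Submission
  imports
    Defs
    "HOL-Computational_Algebra.Field_as_Ring"
    "HOL-Computational_Algebra.Polynomial_Factorial"
begin

text \<open>
  Write \<open>A = \<complex>[x]\<close>, \<open>R = R\<^sub>X\<close>, \<open>y\<^sub>0, \<dots>, y\<^sub>r\<^sub>-\<^sub>1\<close> for the \<open>A\<close>-basis of \<open>R\<close> and
  \<open>h = \<Sum> U\<^sub>i \<otimes> y\<^sub>i\<close> for the given element of \<open>R \<otimes> R\<close>, with diagonal \<open>H\<close>. The quotient \<open>h / (H \<otimes> 1)\<close>
  is the separability idempotent of \<open>Q(R)\<close> over \<open>Q(A)\<close>. Indeed it is a product of normalised divided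
  differences of the minimal polynomials of the \<open>y\<^sub>j\<close>, and the \<open>j\<close>-th factor is annihilated by
  \<open>y\<^sub>j \<otimes> 1 - 1 \<otimes> y\<^sub>j\<close>. As the \<open>y\<^sub>j\<close> generate \<open>R\<close> over \<open>A\<close>, it follows that
  \<open>(a \<otimes> 1) h = (1 \<otimes> a) h\<close> for all \<open>a\<close> (\<open>h_diagonal\<close>). Comparing the coefficients of
  \<open>1 \<otimes> y\<^sub>j\<close> shows that multiplication by \<open>a\<close> acts on the \<open>U\<^sub>j\<close> by the transpose of its matrix in the
  basis \<open>y\<^sub>i\<close> (\<open>mult_Ups\<close>), and a rearrangement of sums then yields
  \<open>\<Sum> \<tau>(a y\<^sub>i) U\<^sub>i = a H = \<Sum> \<tau>(a U\<^sub>i) y\<^sub>i\<close> (\<open>dual_basis_expansion\<close>, \<open>dual_basis_expansion'\<close>).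
  In other words, the \<open>U\<^sub>i / H\<close> form the basis dual to the \<open>y\<^sub>i\<close> for the trace form, and the
  complementary module is \<open>(A U\<^sub>0 + \<dots> + A U\<^sub>r\<^sub>-\<^sub>1) / H\<close> (\<open>complementary_module_eq\<close>).

  It remains to replace the \<open>U\<^sub>i\<close> by their truncations. The module \<open>M = A U\<^sub>0 + \<dots> + A U\<^sub>r\<^sub>-\<^sub>1\<close> is stable
  under \<open>R\<close>, so it contains \<open>L = R U\<^sub>1 + \<dots> + R U\<^sub>r\<^sub>-\<^sub>1\<close>, and \<open>L\<close> is both the \<open>R\<close>-span and the \<open>A\<close>-span
  of the truncations. A truncation has the same pole order at \<open>\<infinity>\<close> as \<open>U\<^sub>i\<close>, and these \<open>r\<close> orders are
  pairwise incongruent modulo \<open>r\<close>. Hence the leading term of any element of \<open>M\<close> can be cancelled by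
  an \<open>A\<close>-multiple of a truncation, and descent on the pole order gives \<open>M \<subseteq> L\<close>
  (\<open>span_P_sub_of_equal_poles\<close>).

  Two structural facts support this: \<open>R\<close> is free over \<open>A\<close> on the \<open>y\<^sub>i\<close> (\<open>expansion_exists\<close>,
  \<open>ybasis_independent\<close>), and elements of \<open>R \<otimes> R\<close> are determined by their values on the fibre product
  (\<open>tensor_independent\<close>). Both are read off from leading terms at \<open>\<infinity>\<close>, along a local parametrisation
  \<open>pt\<close> of \<open>X\<close> with \<open>x(pt(u)) = u\<^sup>-\<^sup>r\<close> (\<open>uniformizer\<close>). For the second fact one compares the \<open>r\<close> points
  \<open>pt(\<zeta>\<^sup>k u)\<close>, \<open>\<zeta> = exp(2\<pi>\<i>/r)\<close>, of the same fibre and uses the orthogonality of the characters of the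
  cyclic group of order \<open>r\<close>. The only global inputs from the Riemann surface are the identity
  theorem and the absence of nonconstant holomorphic functions (\<open>identity_theorem\<close>, \<open>liouville\<close>).
\<close>


section \<open>The total quotient ring\<close>

context cring
begin

lemma regular_cancel_zero:
  "s \<in> regular_elements R \<Longrightarrow> a \<in> carrier R \<Longrightarrow> a \<otimes> s = \<zero> \<Longrightarrow> a = \<zero>"
  by (simp add: regular_elements_def)

lemma regularD:
  assumes "s \<in> regular_elements R" "a \<in> carrier R" "b \<in> carrier R" "a \<otimes> s = b \<otimes> s"
  shows "a = b"
proof -
  have s: "s \<in> carrier R" using assms by (simp add: regular_elements_def)
  have "(a \<ominus> b) \<otimes> s = \<zero>"
    using assms s by (simp add: minus_eq l_distr l_minus r_neg)
  hence "a \<ominus> b = \<zero>" using assms by (simp add: regular_elements_def)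
  thus ?thesis using assms minus_equality[of a "\<ominus> b"] s by (simp add: minus_eq)
qed

lemma regular_closed: "s \<in> regular_elements R \<Longrightarrow> s \<in> carrier R"
  by (simp add: regular_elements_def)

lemma regular_one: "\<one> \<in> regular_elements R"
  by (simp add: regular_elements_def)

lemma regular_mult:
  assumes "s \<in> regular_elements R" "t \<in> regular_elements R"
  shows "s \<otimes> t \<in> regular_elements R"
  unfolding regular_elements_def
proof safe
  show "s \<otimes> t \<in> carrier R" using assms by (simp add: regular_closed)
  fix a assume a: "a \<in> carrier R" "a \<otimes> (s \<otimes> t) = \<zero>"
  have st: "s \<in> carrier R" "t \<in> carrier R" using assms by (simp_all add: regular_closed)
  have "a \<otimes> s = \<zero>"
    using a st by - (rule regular_cancel_zero[OF assms(2)], simp_all add: m_assoc)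
  thus "a = \<zero>" by (rule regular_cancel_zero[OF assms(1) a(1)])
qed

text \<open>Regular denominators can be cancelled, which is exactly what makes cross multiplication
  transitive and hence the classes well defined.\<close>
lemma fraction_eq_iff:
  assumes "a \<in> carrier R" "c \<in> carrier R" "b \<in> regular_elements R" "d \<in> regular_elements R"
  shows "fraction R a b = fraction R c d \<longleftrightarrow> a \<otimes> d = c \<otimes> b"
proof
  have bd: "b \<in> carrier R" "d \<in> carrier R" using assms by (auto simp: regular_closed)
  assume "fraction R a b = fraction R c d"
  moreover have "(a, b) \<in> fraction R a b" using assms by (simp add: fraction_def)
  ultimately have "(a, b) \<in> fraction R c d" by simp
  thus "a \<otimes> d = c \<otimes> b" by (simp add: fraction_def)
next
  have bd: "b \<in> carrier R" "d \<in> carrier R" using assms by (auto simp: regular_closed)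
  assume e: "a \<otimes> d = c \<otimes> b"
  have "a \<otimes> v = u \<otimes> b \<longleftrightarrow> c \<otimes> v = u \<otimes> d"
    if u: "u \<in> carrier R" "v \<in> regular_elements R" for u v
  proof -
    have v: "v \<in> carrier R" using u by (simp add: regular_closed)
    \<comment> \<open>Both equations become the same after multiplying by one of the denominators.\<close>
    have 1: "(a \<otimes> v) \<otimes> d = (c \<otimes> v) \<otimes> b"
      using e assms bd u v by (metis m_assoc m_comm)
    have 2: "(u \<otimes> b) \<otimes> d = (u \<otimes> d) \<otimes> b"
      using bd u by (simp add: m_assoc m_comm[of b d])
    show ?thesis
    proof
      assume "a \<otimes> v = u \<otimes> b"
      hence "(c \<otimes> v) \<otimes> b = (u \<otimes> d) \<otimes> b" using 1 2 by simp
      thus "c \<otimes> v = u \<otimes> d" using assms bd u v by - (rule regularD[of b]; simp)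
    next
      assume "c \<otimes> v = u \<otimes> d"
      hence "(a \<otimes> v) \<otimes> d = (u \<otimes> b) \<otimes> d" using 1 2 by simp
      thus "a \<otimes> v = u \<otimes> b" using assms bd u v by - (rule regularD[of d]; simp)
    qed
  qed
  thus "fraction R a b = fraction R c d" by (auto simp: fraction_def)
qed

lemma fraction_in_carrier:
  "a \<in> carrier R \<Longrightarrow> b \<in> regular_elements R \<Longrightarrow> fraction R a b \<in> carrier (total_quotient_ring R)"
  by (auto simp: total_quotient_ring_def)

lemma fraction_cases:
  assumes "u \<in> carrier (total_quotient_ring R)"
  obtains a b where "a \<in> carrier R" "b \<in> regular_elements R" "u = fraction R a b"
  using assms by (auto simp: total_quotient_ring_def)

lemma mem_fractionD:
  assumes "(c, d) \<in> fraction R a b" "a \<in> carrier R" "b \<in> regular_elements R"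
  shows "c \<in> carrier R" "d \<in> regular_elements R" "fraction R c d = fraction R a b"
proof -
  show c: "c \<in> carrier R" and d: "d \<in> regular_elements R"
    using assms by (auto simp: fraction_def)
  show "fraction R c d = fraction R a b"
    using assms c d by (subst fraction_eq_iff) (auto simp: fraction_def)
qed

text \<open>The operations of the quotient ring are unions over all representatives. Such a union collapses
  to a single class as soon as the result is independent of the representatives.\<close>
lemma fraction_union:
  assumes "a \<in> carrier R" "b \<in> regular_elements R" "c \<in> carrier R" "d \<in> regular_elements R"
    and "\<And>a' b' c' d'. (a', b') \<in> fraction R a b \<Longrightarrow> (c', d') \<in> fraction R c d \<Longrightarrow>
           F a' b' c' d' = G"
  shows "(\<Union>(a', b')\<in>fraction R a b. \<Union>(c', d')\<in>fraction R c d. F a' b' c' d') = G"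
proof -
  have "(a, b) \<in> fraction R a b" "(c, d) \<in> fraction R c d" using assms by (auto simp: fraction_def)
  thus ?thesis using assms(5) by fastforce
qed

lemma mult_fraction:
  assumes "a \<in> carrier R" "b \<in> regular_elements R" "c \<in> carrier R" "d \<in> regular_elements R"
  shows "fraction R a b \<otimes>\<^bsub>total_quotient_ring R\<^esub> fraction R c d = fraction R (a \<otimes> c) (b \<otimes> d)"
  unfolding total_quotient_ring_def monoid.simps
proof (rule fraction_union[OF assms])
  fix a' b' c' d' assume *: "(a', b') \<in> fraction R a b" "(c', d') \<in> fraction R c d"
  have 1: "a' \<in> carrier R" "b' \<in> regular_elements R" "c' \<in> carrier R" "d' \<in> regular_elements R"
    using mem_fractionD(1,2)[OF *(1)] mem_fractionD(1,2)[OF *(2)] assms by simp_all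
  have 2: "a \<otimes> b' = a' \<otimes> b" "c \<otimes> d' = c' \<otimes> d" using * by (auto simp: fraction_def)
  have "(a' \<otimes> c') \<otimes> (b \<otimes> d) = (a' \<otimes> b) \<otimes> (c' \<otimes> d)"
    using 1 assms by (simp add: m_ac regular_closed)
  also have "\<dots> = (a \<otimes> c) \<otimes> (b' \<otimes> d')"
    unfolding 2[symmetric] using 1 assms by (simp add: m_ac regular_closed)
  finally show "fraction R (a' \<otimes> c') (b' \<otimes> d') = fraction R (a \<otimes> c) (b \<otimes> d)"
    using 1 assms by (subst fraction_eq_iff) (auto simp: regular_mult regular_closed)
qed

lemma add_fraction:
  assumes "a \<in> carrier R" "b \<in> regular_elements R" "c \<in> carrier R" "d \<in> regular_elements R"
  shows "fraction R a b \<oplus>\<^bsub>total_quotient_ring R\<^esub> fraction R c d =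
           fraction R ((a \<otimes> d) \<oplus> (c \<otimes> b)) (b \<otimes> d)"
  unfolding total_quotient_ring_def ring_record_simps
proof (rule fraction_union[OF assms])
  fix a' b' c' d' assume *: "(a', b') \<in> fraction R a b" "(c', d') \<in> fraction R c d"
  have 1: "a' \<in> carrier R" "b' \<in> regular_elements R" "c' \<in> carrier R" "d' \<in> regular_elements R"
    using mem_fractionD(1,2)[OF *(1)] mem_fractionD(1,2)[OF *(2)] assms by simp_all
  have 2: "a \<otimes> b' = a' \<otimes> b" "c \<otimes> d' = c' \<otimes> d" using * by (auto simp: fraction_def)
  have "((a' \<otimes> d') \<oplus> (c' \<otimes> b')) \<otimes> (b \<otimes> d) =
        (a' \<otimes> b) \<otimes> (d' \<otimes> d) \<oplus> (c' \<otimes> d) \<otimes> (b' \<otimes> b)"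
    using 1 assms by (simp add: m_ac l_distr r_distr regular_closed)
  also have "\<dots> = ((a \<otimes> d) \<oplus> (c \<otimes> b)) \<otimes> (b' \<otimes> d')"
    unfolding 2[symmetric] using 1 assms by (simp add: m_ac l_distr r_distr regular_closed)
  finally show "fraction R ((a' \<otimes> d') \<oplus> (c' \<otimes> b')) (b' \<otimes> d') =
      fraction R ((a \<otimes> d) \<oplus> (c \<otimes> b)) (b \<otimes> d)"
    using 1 assms by (subst fraction_eq_iff) (auto simp: regular_mult regular_closed)
qed

lemma add_fraction_same_denominator:
  assumes "a \<in> carrier R" "b \<in> carrier R" "d \<in> regular_elements R"
  shows "fraction R a d \<oplus>\<^bsub>total_quotient_ring R\<^esub> fraction R b d = fraction R (a \<oplus> b) d"
  using assms
  by (subst add_fraction; (subst fraction_eq_iff)?)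
     (auto simp: regular_mult regular_closed l_distr r_distr m_ac)

lemma total_quotient_ring_one: "\<one>\<^bsub>total_quotient_ring R\<^esub> = fraction R \<one> \<one>"
  and total_quotient_ring_zero: "\<zero>\<^bsub>total_quotient_ring R\<^esub> = fraction R \<zero> \<one>"
  by (simp_all add: total_quotient_ring_def)

lemma cring_total_quotient_ring: "cring (total_quotient_ring R)"
proof (rule cringI)
  let ?Q = "total_quotient_ring R"
  note [simp] = fraction_in_carrier mult_fraction add_fraction regular_closed regular_mult
    regular_one total_quotient_ring_one total_quotient_ring_zero
  show "abelian_group ?Q"
  proof (rule abelian_groupI)
    fix u assume "u \<in> carrier ?Q"
    then obtain a b where u: "a \<in> carrier R" "b \<in> regular_elements R" "u = fraction R a b"
      by (rule fraction_cases)
    show "\<exists>v\<in>carrier ?Q. v \<oplus>\<^bsub>?Q\<^esub> u = \<zero>\<^bsub>?Q\<^esub>"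
      using u by (intro bexI[of _ "fraction R (\<ominus> a) b"])
        (simp_all add: add_fraction_same_denominator l_neg fraction_eq_iff del: add_fraction)
    show "\<zero>\<^bsub>?Q\<^esub> \<oplus>\<^bsub>?Q\<^esub> u = u"
      using u by simp
    fix v assume "v \<in> carrier ?Q"
    then obtain c d where v: "c \<in> carrier R" "d \<in> regular_elements R" "v = fraction R c d"
      by (rule fraction_cases)
    show "u \<oplus>\<^bsub>?Q\<^esub> v \<in> carrier ?Q" using u v by simp
    show "u \<oplus>\<^bsub>?Q\<^esub> v = v \<oplus>\<^bsub>?Q\<^esub> u" using u v by (simp add: m_comm a_comm)
    fix w assume "w \<in> carrier ?Q"
    then obtain e f where w: "e \<in> carrier R" "f \<in> regular_elements R" "w = fraction R e f"
      by (rule fraction_cases)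
    show "(u \<oplus>\<^bsub>?Q\<^esub> v) \<oplus>\<^bsub>?Q\<^esub> w = u \<oplus>\<^bsub>?Q\<^esub> (v \<oplus>\<^bsub>?Q\<^esub> w)"
      using u v w by (simp add: m_ac l_distr r_distr a_assoc)
  qed (simp)
  show "comm_monoid ?Q"
  proof (rule comm_monoidI)
    fix u assume "u \<in> carrier ?Q"
    then obtain a b where u: "a \<in> carrier R" "b \<in> regular_elements R" "u = fraction R a b"
      by (rule fraction_cases)
    show "\<one>\<^bsub>?Q\<^esub> \<otimes>\<^bsub>?Q\<^esub> u = u"
      using u by simp
    fix v assume "v \<in> carrier ?Q"
    then obtain c d where v: "c \<in> carrier R" "d \<in> regular_elements R" "v = fraction R c d"
      by (rule fraction_cases)
    show "u \<otimes>\<^bsub>?Q\<^esub> v \<in> carrier ?Q" using u v by simp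
    show "u \<otimes>\<^bsub>?Q\<^esub> v = v \<otimes>\<^bsub>?Q\<^esub> u" using u v by (simp add: m_comm)
    fix w assume "w \<in> carrier ?Q"
    then obtain e f where w: "e \<in> carrier R" "f \<in> regular_elements R" "w = fraction R e f"
      by (rule fraction_cases)
    show "(u \<otimes>\<^bsub>?Q\<^esub> v) \<otimes>\<^bsub>?Q\<^esub> w = u \<otimes>\<^bsub>?Q\<^esub> (v \<otimes>\<^bsub>?Q\<^esub> w)"
      using u v w by (simp add: m_ac)
  qed (simp)
  fix u v w assume "u \<in> carrier ?Q" "v \<in> carrier ?Q" "w \<in> carrier ?Q"
  then obtain a b c d e f where
    u: "a \<in> carrier R" "b \<in> regular_elements R" "u = fraction R a b" and
    v: "c \<in> carrier R" "d \<in> regular_elements R" "v = fraction R c d" and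
    w: "e \<in> carrier R" "f \<in> regular_elements R" "w = fraction R e f"
    by (elim fraction_cases)
  show "(u \<oplus>\<^bsub>?Q\<^esub> v) \<otimes>\<^bsub>?Q\<^esub> w = u \<otimes>\<^bsub>?Q\<^esub> w \<oplus>\<^bsub>?Q\<^esub> v \<otimes>\<^bsub>?Q\<^esub> w"
    using u v w by (simp add: fraction_eq_iff) (simp add: m_ac l_distr r_distr)
qed

lemma finsum_fraction:
  assumes "finite I" "d \<in> regular_elements R" "\<And>i. i \<in> I \<Longrightarrow> g i \<in> carrier R"
  shows "(\<Oplus>\<^bsub>total_quotient_ring R\<^esub>i\<in>I. fraction R (g i) d) = fraction R (\<Oplus>i\<in>I. g i) d"
  using assms(1,3)
proof (induction I)
  case empty
  interpret Q: cring "total_quotient_ring R" by (rule cring_total_quotient_ring)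
  show ?case using assms(2)
    by (simp add: total_quotient_ring_zero fraction_eq_iff regular_one regular_closed)
next
  case (insert i I)
  interpret Q: cring "total_quotient_ring R" by (rule cring_total_quotient_ring)
  show ?case using insert assms(2)
    by (subst Q.finsum_insert)
       (auto simp: fraction_in_carrier add_fraction_same_denominator finsum_insert)
qed

lemma finprod_fraction:
  assumes "finite I" "\<And>i. i \<in> I \<Longrightarrow> g i \<in> carrier R" "\<And>i. i \<in> I \<Longrightarrow> d i \<in> regular_elements R"
  shows "(\<Otimes>i\<in>I. d i) \<in> regular_elements R"
    and "(\<Otimes>\<^bsub>total_quotient_ring R\<^esub>i\<in>I. fraction R (g i) (d i)) = fraction R (\<Otimes>i\<in>I. g i) (\<Otimes>i\<in>I. d i)"
proof -
  interpret Q: cring "total_quotient_ring R" by (rule cring_total_quotient_ring)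
  have "(\<Otimes>i\<in>I. d i) \<in> regular_elements R \<and>
    (\<Otimes>\<^bsub>total_quotient_ring R\<^esub>i\<in>I. fraction R (g i) (d i)) = fraction R (\<Otimes>i\<in>I. g i) (\<Otimes>i\<in>I. d i)"
    using assms
  proof (induction I)
    case empty
    show ?case by (simp add: total_quotient_ring_one regular_one)
  next
    case (insert i I)
    thus ?case
      by (subst Q.finprod_insert)
         (auto simp: fraction_in_carrier finprod_insert regular_mult regular_closed mult_fraction Pi_iff)
  qed
  thus "(\<Otimes>i\<in>I. d i) \<in> regular_elements R"
    and "(\<Otimes>\<^bsub>total_quotient_ring R\<^esub>i\<in>I. fraction R (g i) (d i)) = fraction R (\<Otimes>i\<in>I. g i) (\<Otimes>i\<in>I. d i)"
    by auto
qed

end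

section \<open>Meromorphic functions on a pointed compact Riemann surface\<close>

locale pointed_riemann_surface =
  fixes \<A> :: "'a::t2_space atlas" and pinf :: 'a
  assumes surface: "compact_riemann_surface \<A>"
begin

text \<open>No condition is put on the value at the marked point, so that constants are regular and sums,
  products and polynomials can be formed without a correction there.\<close>
definition regular_away :: "('a \<Rightarrow> complex) \<Rightarrow> bool" where
  "regular_away f \<longleftrightarrow> rs_holomorphic_on \<A> f (- {pinf}) \<and> rs_meromorphic_at \<A> f pinf"

lemma chart_at:
  obtains U \<phi> where "(U, \<phi>) \<in> \<A>" "p \<in> U"
proof -
  have "p \<in> (\<Union>(U, \<phi>)\<in>\<A>. U)" using surface by (simp add: compact_riemann_surface_def)
  thus ?thesis using that by auto
qed

lemma chart:
  assumes "(U, \<phi>) \<in> \<A>"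
  shows chart_open: "open U" and chart_open_image: "open (\<phi> ` U)"
    and chart_continuous: "continuous_on U \<phi>"
    and chart_inv_continuous: "continuous_on (\<phi> ` U) (inv_into U \<phi>)"
    and chart_inv: "p \<in> U \<Longrightarrow> inv_into U \<phi> (\<phi> p) = p"
    and chart_inv_right: "z \<in> \<phi> ` U \<Longrightarrow> \<phi> (inv_into U \<phi> z) = z"
proof -
  have h: "open U" "open (\<phi> ` U)" "homeomorphism U (\<phi> ` U) \<phi> (inv_into U \<phi>)"
    using surface assms unfolding compact_riemann_surface_def by fastforce+
  show "open U" "open (\<phi> ` U)" by (fact h)+
  show "continuous_on U \<phi>" "continuous_on (\<phi> ` U) (inv_into U \<phi>)"
    "p \<in> U \<Longrightarrow> inv_into U \<phi> (\<phi> p) = p"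
    "z \<in> \<phi> ` U \<Longrightarrow> \<phi> (inv_into U \<phi> z) = z"
    using h(3) by (auto simp: homeomorphism_def)
qed

lemma chart_image_open:
  assumes "(U, \<phi>) \<in> \<A>" "open W" "W \<subseteq> U"
  shows "open (\<phi> ` W)"
proof -
  have "\<phi> ` W = \<phi> ` U \<inter> inv_into U \<phi> -` W"
    using assms chart_inv[OF assms(1)] by (force simp: image_iff)
  thus ?thesis
    using continuous_open_preimage[OF chart_inv_continuous[OF assms(1)] chart_open_image[OF assms(1)] assms(2)]
    by simp
qed

lemma chart_inv_image_open:
  assumes "(U, \<phi>) \<in> \<A>" "open V" "V \<subseteq> \<phi> ` U"
  shows "open (inv_into U \<phi> ` V)"
proof -
  have "inv_into U \<phi> ` V = U \<inter> \<phi> -` V"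
    using assms chart_inv[OF assms(1)] by (force simp: image_iff)
  thus ?thesis
    using continuous_open_preimage[OF chart_continuous[OF assms(1)] chart_open[OF assms(1)] assms(2)]
    by simp
qed

lemma chart_filterlim:
  assumes "(U, \<phi>) \<in> \<A>" "p \<in> U"
  shows "filterlim \<phi> (at (\<phi> p)) (at p)"
  unfolding filterlim_at
proof
  have "eventually (\<lambda>q. q \<in> U \<and> q \<noteq> p) (at p)"
    using chart_open[OF assms(1)] assms(2) by (auto simp: eventually_at_topological)
  thus "\<forall>\<^sub>F x in at p. \<phi> x \<in> UNIV \<and> \<phi> x \<noteq> \<phi> p"
  proof eventually_elim
    case (elim q)
    thus ?case using chart_inv[OF assms(1), of q] chart_inv[OF assms] by auto
  qed
  show "(\<phi> \<longlongrightarrow> \<phi> p) (at p)"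
    using chart_continuous[OF assms(1)] chart_open[OF assms(1)] assms(2)
    by (simp add: continuous_on_eq_continuous_at isCont_def)
qed

lemma chart_inv_filterlim:
  assumes "(U, \<phi>) \<in> \<A>" "p \<in> U"
  shows "filterlim (inv_into U \<phi>) (at p) (at (\<phi> p))"
  unfolding filterlim_at
proof
  have "eventually (\<lambda>z. z \<in> \<phi> ` U \<and> z \<noteq> \<phi> p) (at (\<phi> p))"
    using chart_open_image[OF assms(1)] assms(2) by (auto simp: eventually_at_topological)
  thus "\<forall>\<^sub>F x in at (\<phi> p). inv_into U \<phi> x \<in> UNIV \<and> inv_into U \<phi> x \<noteq> p"
  proof eventually_elim
    case (elim z)
    thus ?case using chart_inv_right[OF assms(1), of z] by auto
  qed
  have "isCont (inv_into U \<phi>) (\<phi> p)"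
    using chart_inv_continuous[OF assms(1)] chart_open_image[OF assms(1)] assms(2)
    by (simp add: continuous_on_eq_continuous_at)
  thus "(inv_into U \<phi> \<longlongrightarrow> p) (at (\<phi> p))"
    using chart_inv[OF assms] by (simp add: isCont_def)
qed

lemma at_neq_bot: "at (p :: 'a) \<noteq> bot"
proof
  obtain U \<phi> where c: "(U, \<phi>) \<in> \<A>" "p \<in> U" by (rule chart_at)
  assume "at p = bot"
  hence "eventually (\<lambda>_. False) (at p)" by simp
  hence "eventually (\<lambda>z. False) (at (\<phi> p))"
    using chart_inv_filterlim[OF c] unfolding filterlim_iff by (elim allE[of _ "\<lambda>_. False"] impE)
  thus False by simp
qed

lemma eventually_at_chart:
  assumes "(U, \<phi>) \<in> \<A>" "p \<in> U"
    and "eventually (\<lambda>z. R (inv_into U \<phi> z)) (at (\<phi> p))"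
  shows "eventually R (at p)"
proof -
  have "eventually (\<lambda>q. R (inv_into U \<phi> (\<phi> q))) (at p)"
    by (rule eventually_compose_filterlim[OF assms(3) chart_filterlim[OF assms(1,2)]])
  moreover have "eventually (\<lambda>q. q \<in> U) (at p)"
    using chart_open[OF assms(1)] assms(2) by (auto simp: eventually_at_topological)
  ultimately show ?thesis by eventually_elim (use chart_inv[OF assms(1)] in simp)
qed

lemma regular_away_holomorphic:
  "regular_away f \<Longrightarrow> (U, \<phi>) \<in> \<A> \<Longrightarrow> (f \<circ> inv_into U \<phi>) holomorphic_on \<phi> ` (U - {pinf})"
  unfolding regular_away_def rs_holomorphic_on_def by (auto simp: Diff_eq)

lemma regular_away_meromorphic:
  assumes "regular_away f" "(U, \<phi>) \<in> \<A>" "p \<in> U"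
  shows "(f \<circ> inv_into U \<phi>) meromorphic_on {\<phi> p}"
proof (cases "p = pinf")
  case True
  thus ?thesis using assms unfolding regular_away_def rs_meromorphic_at_def by auto
next
  case False
  have "open (\<phi> ` (U - {pinf}))"
    by (rule chart_image_open[OF assms(2)]) (use chart_open[OF assms(2)] in \<open>auto intro: open_delete\<close>)
  hence "(f \<circ> inv_into U \<phi>) analytic_on \<phi> ` (U - {pinf})"
    using regular_away_holomorphic[OF assms(1,2)] by (simp add: analytic_on_open)
  thus ?thesis
    using False assms by (intro analytic_on_imp_meromorphic_on) (auto elim: analytic_on_subset)
qed

lemma regular_away_isCont:
  assumes "regular_away f" "p \<noteq> pinf"
  shows "isCont f p"
proof -
  obtain U \<phi> where c: "(U, \<phi>) \<in> \<A>" "p \<in> U" by (rule chart_at)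
  have o: "open (U - {pinf})" using chart_open[OF c(1)] by (rule open_delete)
  have "continuous_on (U - {pinf}) ((f \<circ> inv_into U \<phi>) \<circ> \<phi>)"
  proof (rule continuous_on_compose)
    show "continuous_on (U - {pinf}) \<phi>"
      using chart_continuous[OF c(1)] by (rule continuous_on_subset) auto
    show "continuous_on (\<phi> ` (U - {pinf})) (f \<circ> inv_into U \<phi>)"
      by (rule holomorphic_on_imp_continuous_on[OF regular_away_holomorphic[OF assms(1) c(1)]])
  qed
  hence "continuous_on (U - {pinf}) f"
    by (rule continuous_on_eq) (use chart_inv[OF c(1)] in auto)
  thus ?thesis using o c(2) assms(2) by (simp add: continuous_on_eq_continuous_at)
qed

lemma regular_awayI:
  assumes "\<And>U \<phi>. (U, \<phi>) \<in> \<A> \<Longrightarrow> (f \<circ> inv_into U \<phi>) holomorphic_on \<phi> ` (U - {pinf})"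
    and "\<And>U \<phi>. (U, \<phi>) \<in> \<A> \<Longrightarrow> pinf \<in> U \<Longrightarrow> (f \<circ> inv_into U \<phi>) meromorphic_on {\<phi> pinf}"
  shows "regular_away f"
  using assms unfolding regular_away_def rs_holomorphic_on_def rs_meromorphic_at_def
  by (auto simp: Diff_eq)

lemma regular_away_const: "regular_away (\<lambda>_. c)"
  by (rule regular_awayI) (auto simp: o_def intro!: holomorphic_intros meromorphic_intros)

lemma regular_away_add: "regular_away f \<Longrightarrow> regular_away g \<Longrightarrow> regular_away (\<lambda>P. f P + g P)"
  using regular_away_holomorphic[of f] regular_away_holomorphic[of g]
    regular_away_meromorphic[of f] regular_away_meromorphic[of g]
  by (intro regular_awayI) (auto simp: o_def intro!: holomorphic_intros meromorphic_intros)

lemma regular_away_mult: "regular_away f \<Longrightarrow> regular_away g \<Longrightarrow> regular_away (\<lambda>P. f P * g P)"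
  using regular_away_holomorphic[of f] regular_away_holomorphic[of g]
    regular_away_meromorphic[of f] regular_away_meromorphic[of g]
  by (intro regular_awayI) (auto simp: o_def intro!: holomorphic_intros meromorphic_intros)

lemma regular_away_sum: "(\<And>i. i \<in> I \<Longrightarrow> regular_away (f i)) \<Longrightarrow> regular_away (\<lambda>P. \<Sum>i\<in>I. f i P)"
  by (induction I rule: infinite_finite_induct) (auto intro: regular_away_const regular_away_add)

lemma regular_away_power: "regular_away f \<Longrightarrow> regular_away (\<lambda>P. f P ^ n)"
  by (induction n) (auto intro: regular_away_const regular_away_mult)

lemma regular_away_prod: "(\<And>i. i \<in> I \<Longrightarrow> regular_away (f i)) \<Longrightarrow> regular_away (\<lambda>P. \<Prod>i\<in>I. f i P)"
  by (induction I rule: infinite_finite_induct) (auto intro: regular_away_const regular_away_mult)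

lemma regular_away_poly: "regular_away f \<Longrightarrow> regular_away (\<lambda>P. poly p (f P))"
  by (induction p) (auto intro!: regular_away_const regular_away_add regular_away_mult)

lemma regular_away_cong:
  assumes "regular_away f" "\<And>P. P \<noteq> pinf \<Longrightarrow> g P = f P"
  shows "regular_away g"
proof (rule regular_awayI)
  fix U \<phi> assume c: "(U, \<phi>) \<in> \<A>"
  show "(g \<circ> inv_into U \<phi>) holomorphic_on \<phi> ` (U - {pinf})"
    by (rule holomorphic_transform[OF regular_away_holomorphic[OF assms(1) c]])
       (use assms(2) chart_inv[OF c] in \<open>auto, metis\<close>)
  assume i: "pinf \<in> U"
  have "eventually (\<lambda>z. inv_into U \<phi> z \<noteq> pinf) (at (\<phi> pinf))"
    using chart_inv_filterlim[OF c i] by (simp add: filterlim_at)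
  hence "eventually (\<lambda>z. (g \<circ> inv_into U \<phi>) z = (f \<circ> inv_into U \<phi>) z) (at (\<phi> pinf))"
    by eventually_elim (use assms(2) in auto)
  thus "(g \<circ> inv_into U \<phi>) meromorphic_on {\<phi> pinf}"
    using regular_away_meromorphic[OF assms(1) c i]
    by (subst meromorphic_on_cong[where g = "f \<circ> inv_into U \<phi>"]) auto
qed

text \<open>At each point a meromorphic germ either vanishes on a punctured neighbourhood or has no zero on
  one. The points of either kind form an open set, so only one kind occurs on a connected surface.\<close>
lemma identity_theorem:
  assumes "regular_away f"
  shows "(\<forall>P. P \<noteq> pinf \<longrightarrow> f P = 0) \<or> (\<forall>p. eventually (\<lambda>P. f P \<noteq> 0) (at p))"
proof -
  define A where "A = {p. eventually (\<lambda>P. f P = 0) (at p)}"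
  define B where "B = {p. eventually (\<lambda>P. f P \<noteq> 0) (at p)}"
  have "A \<union> B = UNIV"
  proof -
    have "p \<in> A \<union> B" for p
    proof -
      obtain U \<phi> where c: "(U, \<phi>) \<in> \<A>" "p \<in> U" by (rule chart_at)
      let ?g = "f \<circ> inv_into U \<phi>"
      have "isolated_singularity_at ?g (\<phi> p)" "not_essential ?g (\<phi> p)"
        using regular_away_meromorphic[OF assms c] by (auto simp: meromorphic_at_iff)
      hence "eventually (\<lambda>z. ?g z = 0) (at (\<phi> p)) \<or> eventually (\<lambda>z. ?g z \<noteq> 0) (at (\<phi> p))"
        using not_essential_frequently_0_imp_eventually_0[of ?g "\<phi> p"]
        by (auto simp: frequently_def)
      thus ?thesis
        using eventually_at_chart[OF c, of "\<lambda>P. f P = 0"] eventually_at_chart[OF c, of "\<lambda>P. f P \<noteq> 0"]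
        by (auto simp: A_def B_def)
    qed
    thus ?thesis by blast
  qed
  moreover have "A \<inter> B = {}"
  proof -
    have False if "p \<in> A" "p \<in> B" for p
    proof -
      have "eventually (\<lambda>P. False) (at p)"
        using that unfolding A_def B_def mem_Collect_eq by eventually_elim simp
      thus False using at_neq_bot by (simp add: trivial_limit_def)
    qed
    thus ?thesis by blast
  qed
  moreover have "open {p. eventually (\<lambda>P. S (f P)) (at p)}" if S: "S = (\<lambda>z. z = 0) \<or> S = (\<lambda>z. z \<noteq> 0)" for S
    unfolding open_subopen[of "{p. _ p}"]
  proof safe
    fix p assume "eventually (\<lambda>P. S (f P)) (at p)"
    then obtain W where W: "open W" "p \<in> W" "\<And>P. P \<in> W \<Longrightarrow> P \<noteq> p \<Longrightarrow> S (f P)"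
      by (auto simp: eventually_at_topological)
    have "eventually (\<lambda>P. S (f P)) (at q)" if q: "q \<in> W" for q
    proof (cases "q = p")
      case True thus ?thesis using W by (auto simp: eventually_at_topological)
    next
      case False
      have "open (W - {p})" using W(1) by (rule open_delete)
      thus ?thesis using False q W(3) unfolding eventually_at_topological
        by (intro exI[of _ "W - {p}"]) auto
    qed
    thus "\<exists>T. open T \<and> p \<in> T \<and> T \<subseteq> {p. eventually (\<lambda>P. S (f P)) (at p)}"
      using W by (intro exI[of _ W]) auto
  qed
  hence "open A" "open B" unfolding A_def B_def by blast+
  ultimately have "A = {} \<or> B = {}"
    using surface unfolding compact_riemann_surface_def connected_def
    by (metis Int_UNIV_right Int_commute order_refl)
  hence "A = UNIV \<or> B = UNIV" using \<open>A \<union> B = UNIV\<close> by auto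
  moreover have "f P = 0" if "A = UNIV" "P \<noteq> pinf" for P
  proof -
    have ev: "eventually (\<lambda>Q. f Q = 0) (at P)" using that(1) by (auto simp: A_def)
    have "(f \<longlongrightarrow> f P) (at P)" using regular_away_isCont[OF assms that(2)] by (simp add: isCont_def)
    hence "((\<lambda>_. 0) \<longlongrightarrow> f P) (at P)" by (rule Lim_transform_eventually) (use ev in auto)
    thus ?thesis using at_neq_bot by (simp add: tendsto_const_iff)
  qed
  ultimately show ?thesis by (auto simp: B_def)
qed

text \<open>The continuous extension is holomorphic and its modulus attains a maximum by compactness. By the
  maximum principle in charts, the points with the extremal value form an open and closed set.\<close>
lemma liouville:
  assumes "regular_away f" "(f \<longlongrightarrow> L) (at pinf)"
  shows "P \<noteq> pinf \<Longrightarrow> f P = L"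
proof -
  define F where "F = (\<lambda>P. if P = pinf then L else f P)"
  have F: "regular_away F" by (rule regular_away_cong[OF assms(1)]) (simp add: F_def)
  have cont: "isCont F p" for p
  proof (cases "p = pinf")
    case True
    have "eventually (\<lambda>q. q \<noteq> pinf) (at pinf)" by (auto simp: eventually_at_topological)
    hence "eventually (\<lambda>q. f q = F q) (at pinf)" by eventually_elim (simp add: F_def)
    from Lim_transform_eventually[OF assms(2) this]
    show ?thesis using True by (simp add: isCont_def F_def)
  qed (use F regular_away_isCont in blast)
  hence cF: "continuous_on UNIV F" by (simp add: continuous_on_eq_continuous_at)
  have "compact (UNIV :: 'a set)" using surface by (simp add: compact_riemann_surface_def)
  moreover have "continuous_on UNIV (\<lambda>p. norm (F p))" using cF by (intro continuous_intros)
  ultimately obtain p0 where p0: "\<And>p. norm (F p) \<le> norm (F p0)"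
    using continuous_attains_sup[of UNIV "\<lambda>p. norm (F p)"] by auto
  define Z where "Z = {p. F p = F p0}"
  have "closed Z"
    unfolding Z_def using cF by (intro closed_Collect_eq) auto
  moreover have "open Z"
    unfolding open_subopen[of Z]
  proof safe
    fix p assume p: "p \<in> Z"
    obtain U \<phi> where c: "(U, \<phi>) \<in> \<A>" "p \<in> U" by (rule chart_at)
    let ?g = "F \<circ> inv_into U \<phi>"
    have "continuous_on (\<phi> ` U) ?g"
      by (rule continuous_on_compose[OF chart_inv_continuous[OF c(1)]])
         (rule continuous_on_subset[OF cF], simp)
    moreover have "?g holomorphic_on \<phi> ` U - {\<phi> pinf}"
    proof (rule holomorphic_on_subset[OF regular_away_holomorphic[OF F c(1)]])
    qed auto
    ultimately have hol: "?g holomorphic_on \<phi> ` U"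
      using no_isolated_singularity[of "\<phi> ` U" ?g "{\<phi> pinf}"] chart_open_image[OF c(1)] by simp
    obtain e where e: "e > 0" "ball (\<phi> p) e \<subseteq> \<phi> ` U"
      using chart_open_image[OF c(1)] c(2) by (meson imageI open_contains_ball)
    have "?g constant_on ball (\<phi> p) e"
    proof (rule maximum_modulus_principle[where U = "ball (\<phi> p) e" and \<xi> = "\<phi> p"])
      show "?g holomorphic_on ball (\<phi> p) e" using hol e(2) by (rule holomorphic_on_subset)
      fix z
      show "norm (?g z) \<le> norm (?g (\<phi> p))"
        using p p0 chart_inv[OF c] by (simp add: Z_def)
    qed (use e(1) in auto)
    then obtain k where k: "\<And>z. z \<in> ball (\<phi> p) e \<Longrightarrow> ?g z = k" unfolding constant_on_def by blast
    have "k = F p0" using k[of "\<phi> p"] e(1) p chart_inv[OF c] by (simp add: Z_def)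
    hence "inv_into U \<phi> ` ball (\<phi> p) e \<subseteq> Z" using k by (auto simp: Z_def)
    moreover have "open (inv_into U \<phi> ` ball (\<phi> p) e)"
      by (rule chart_inv_image_open[OF c(1) open_ball e(2)])
    moreover have "p \<in> inv_into U \<phi> ` ball (\<phi> p) e"
      using chart_inv[OF c] e(1) by (metis centre_in_ball imageI)
    ultimately show "\<exists>T. open T \<and> p \<in> T \<and> T \<subseteq> Z" by blast
  qed
  ultimately have "Z = UNIV \<or> Z = {}"
    using surface unfolding compact_riemann_surface_def
    by (metis connected_clopen[of UNIV] closed_closedin open_openin subtopology_UNIV)
  hence "Z = UNIV" by (auto simp: Z_def)
  hence "F P = F p0" for P unfolding Z_def by blast
  hence "F P = F pinf" for P by metis
  thus "f P = L" if "P \<noteq> pinf" using that unfolding F_def by metis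
qed

text \<open>The order at the marked point is defined through one chosen chart. Exposing that chart here allows
  all functions to be compared in the same coordinate.\<close>
lemma local_factorization:
  obtains U \<phi> where "(U, \<phi>) \<in> \<A>" "pinf \<in> U"
    "\<And>f. regular_away f \<Longrightarrow> \<exists>P. P \<noteq> pinf \<and> f P \<noteq> 0 \<Longrightarrow>
       \<exists>G d. d > 0 \<and> G holomorphic_on cball (\<phi> pinf) d \<and> G (\<phi> pinf) \<noteq> 0 \<and>
         (\<forall>w\<in>cball (\<phi> pinf) d - {\<phi> pinf}.
            f (inv_into U \<phi> w) = G w * (w - \<phi> pinf) powi (rs_order \<A> f pinf) \<and> G w \<noteq> 0)"
proof -
  \<comment> \<open>The chart through which \<open>rs_order\<close> is defined.\<close>
  define sel where "sel = (SOME c. c \<in> \<A> \<and> pinf \<in> fst c)"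
  have "\<exists>c. c \<in> \<A> \<and> pinf \<in> fst c" using chart_at[of pinf] by (metis fst_conv)
  hence "sel \<in> \<A> \<and> pinf \<in> fst sel" unfolding sel_def by (rule someI_ex)
  then obtain U \<phi> where sel: "sel = (U, \<phi>)" and c: "(U, \<phi>) \<in> \<A>" "pinf \<in> U" by (cases sel) auto
  define \<psi> where "\<psi> = inv_into U \<phi>"
  define z0 where "z0 = \<phi> pinf"
  have ord_eq: "rs_order \<A> f pinf = zorder (f \<circ> \<psi>) z0" for f
    using sel by (simp add: rs_order_def sel_def[symmetric] \<psi>_def z0_def)
  have "\<exists>G e. e > 0 \<and> G holomorphic_on cball z0 e \<and> G z0 \<noteq> 0 \<and>
      (\<forall>w\<in>cball z0 e - {z0}. f (\<psi> w) = G w * (w - z0) powi (rs_order \<A> f pinf) \<and> G w \<noteq> 0)"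
    if f: "regular_away f" "\<exists>P. P \<noteq> pinf \<and> f P \<noteq> 0" for f
  proof -
    have "eventually (\<lambda>P. f P \<noteq> 0) (at pinf)" using identity_theorem[OF f(1)] f(2) by blast
    hence "eventually (\<lambda>w. f (\<psi> w) \<noteq> 0) (at z0)"
      using chart_inv_filterlim[OF c] unfolding \<psi>_def z0_def by (rule eventually_compose_filterlim)
    hence fr: "\<exists>\<^sub>F w in at z0. (f \<circ> \<psi>) w \<noteq> 0" by (simp add: eventually_frequently)
    have "isolated_singularity_at (f \<circ> \<psi>) z0" "not_essential (f \<circ> \<psi>) z0"
      using regular_away_meromorphic[OF f(1) c] by (auto simp: meromorphic_at_iff \<psi>_def z0_def)
    from zorder_exist[OF this fr] show ?thesis
      unfolding ord_eq by (intro exI[of _ "zor_poly (f \<circ> \<psi>) z0"]) (auto simp: o_def)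
  qed
  thus thesis using c unfolding \<psi>_def z0_def by (intro that) auto
qed

text \<open>A function of positive order would tend to \<open>0\<close> at the marked point and thus vanish
  identically by \<open>liouville\<close>.\<close>
lemma order_nonpos:
  assumes "regular_away f" "\<exists>P. P \<noteq> pinf \<and> f P \<noteq> 0"
  shows "rs_order \<A> f pinf \<le> 0"
proof (rule ccontr)
  assume n: "\<not> rs_order \<A> f pinf \<le> 0"
  obtain U \<phi> where c: "(U, \<phi>) \<in> \<A>" "pinf \<in> U" and loc:
    "\<And>f. regular_away f \<Longrightarrow> \<exists>P. P \<noteq> pinf \<and> f P \<noteq> 0 \<Longrightarrow>
       \<exists>G d. d > 0 \<and> G holomorphic_on cball (\<phi> pinf) d \<and> G (\<phi> pinf) \<noteq> 0 \<and>
         (\<forall>w\<in>cball (\<phi> pinf) d - {\<phi> pinf}.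
            f (inv_into U \<phi> w) = G w * (w - \<phi> pinf) powi (rs_order \<A> f pinf) \<and> G w \<noteq> 0)"
    by (rule local_factorization) (rule that)
  obtain G d where G: "d > 0" "G holomorphic_on cball (\<phi> pinf) d"
    "\<And>w. w \<in> cball (\<phi> pinf) d - {\<phi> pinf} \<Longrightarrow>
       f (inv_into U \<phi> w) = G w * (w - \<phi> pinf) powi (rs_order \<A> f pinf)"
    using loc[OF assms] by blast
  define k where "k = nat (rs_order \<A> f pinf)"
  have k: "rs_order \<A> f pinf = int k" "k > 0" using n by (auto simp: k_def)
  have "isCont G (\<phi> pinf)" using holomorphic_on_imp_continuous_on[OF G(2)] G(1)
    by (intro continuous_on_interior[of "cball (\<phi> pinf) d"]) auto
  hence "isCont (\<lambda>w. G w * (w - \<phi> pinf) ^ k) (\<phi> pinf)" by (intro continuous_intros)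
  hence "((\<lambda>w. G w * (w - \<phi> pinf) ^ k) \<longlongrightarrow> 0) (at (\<phi> pinf))" using k(2) by (simp add: isCont_def power_0_left)
  moreover have "eventually (\<lambda>w. w \<in> cball (\<phi> pinf) d - {\<phi> pinf}) (at (\<phi> pinf))"
    using G(1) by (auto simp: eventually_at dist_commute intro!: exI[of _ d])
  hence "eventually (\<lambda>w. G w * (w - \<phi> pinf) ^ k = f (inv_into U \<phi> w)) (at (\<phi> pinf))"
    by eventually_elim (use G(3) k in simp)
  ultimately have "((\<lambda>w. f (inv_into U \<phi> w)) \<longlongrightarrow> 0) (at (\<phi> pinf))" by (rule Lim_transform_eventually)
  hence "((\<lambda>q. f (inv_into U \<phi> (\<phi> q))) \<longlongrightarrow> 0) (at pinf)"
    by (rule filterlim_compose) (rule chart_filterlim[OF c])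
  moreover have "eventually (\<lambda>q. q \<in> U) (at pinf)"
    using chart_open[OF c(1)] c(2) by (auto simp: eventually_at_topological)
  hence "eventually (\<lambda>q. f (inv_into U \<phi> (\<phi> q)) = f q) (at pinf)"
    by eventually_elim (use chart_inv[OF c(1)] in simp)
  ultimately have "(f \<longlongrightarrow> 0) (at pinf)" by (rule Lim_transform_eventually)
  from liouville[OF assms(1) this] show False using assms(2) by blast
qed

text \<open>In a chart, \<open>x = G(w) (w - z\<^sub>0)\<^sup>-\<^sup>r\<close> with \<open>G(z\<^sub>0) \<noteq> 0\<close>. With a holomorphic \<open>r\<close>-th root of \<open>G\<close>, the function
  \<open>\<omega>(w) = (w - z\<^sub>0) G(w)\<^sup>-\<^sup>1\<^sup>/\<^sup>r\<close> is a local coordinate with \<open>x = \<omega>\<^sup>-\<^sup>r\<close>, and \<open>pt\<close> is its inverse.\<close>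
lemma uniformizer:
  assumes x: "regular_away x" "\<exists>P. P \<noteq> pinf \<and> x P \<noteq> 0" and r: "r > 0"
    and ord: "rs_order \<A> x pinf = - int r"
  obtains pt :: "complex \<Rightarrow> 'a" where
    "filterlim pt (at pinf) (at 0)"
    "eventually (\<lambda>u. x (pt u) * u ^ r = 1) (at 0)"
    "\<And>f. regular_away f \<Longrightarrow> (\<exists>P. P \<noteq> pinf \<and> f P \<noteq> 0) \<Longrightarrow>
       \<exists>a. a \<noteq> 0 \<and> ((\<lambda>u. f (pt u) * u powi (- rs_order \<A> f pinf)) \<longlongrightarrow> a) (at 0)"
proof -
  obtain U \<phi> where c: "(U, \<phi>) \<in> \<A>" "pinf \<in> U" and loc:
    "\<And>f. regular_away f \<Longrightarrow> \<exists>P. P \<noteq> pinf \<and> f P \<noteq> 0 \<Longrightarrow>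
       \<exists>G d. d > 0 \<and> G holomorphic_on cball (\<phi> pinf) d \<and> G (\<phi> pinf) \<noteq> 0 \<and>
         (\<forall>w\<in>cball (\<phi> pinf) d - {\<phi> pinf}.
            f (inv_into U \<phi> w) = G w * (w - \<phi> pinf) powi (rs_order \<A> f pinf) \<and> G w \<noteq> 0)"
    by (rule local_factorization) (rule that)
  define \<psi> where "\<psi> = inv_into U \<phi>"
  define z0 where "z0 = \<phi> pinf"
  note local = loc[folded \<psi>_def z0_def]
  obtain G e where G: "e > 0" "G holomorphic_on cball z0 e" "G z0 \<noteq> 0"
    "\<And>w. w \<in> cball z0 e - {z0} \<Longrightarrow> x (\<psi> w) = G w * (w - z0) powi (- int r) \<and> G w \<noteq> 0"
    using local[OF x] unfolding ord by blast
  have G0: "G w \<noteq> 0" if "w \<in> ball z0 e" for w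
    using G(3) G(4)[of w] that by (cases "w = z0") auto
  have holG: "G holomorphic_on ball z0 e" using G(2) by (rule holomorphic_on_subset) auto
  obtain l where l: "l holomorphic_on ball z0 e" "\<And>w. w \<in> ball z0 e \<Longrightarrow> G w = exp (l w)"
    using contractible_imp_holomorphic_log[OF holG convex_imp_contractible[OF convex_ball]] G0
    by blast
  define E where "E w = exp (- l w / of_nat r)" for w
  define \<omega> where "\<omega> w = (w - z0) * E w" for w
  have holE: "E holomorphic_on ball z0 e" unfolding E_def by (intro holomorphic_intros l) (use r in auto)
  have hol\<omega>: "\<omega> holomorphic_on ball z0 e" unfolding \<omega>_def by (intro holomorphic_intros holE)
  have Er: "E w ^ r * G w = 1" if "w \<in> ball z0 e" for w
  proof -
    have "E w ^ r = exp (- l w)"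
      unfolding E_def exp_of_nat_mult[symmetric] using r by simp
    thus ?thesis using l(2)[OF that] by (simp add: exp_minus)
  qed
  have "deriv \<omega> z0 = E z0"
  proof (rule DERIV_imp_deriv)
    have "E field_differentiable at z0"
      using holE G(1) by (auto simp: holomorphic_on_open field_differentiable_def)
    then obtain E' where "(E has_field_derivative E') (at z0)" by (auto simp: field_differentiable_def)
    thus "(\<omega> has_field_derivative E z0) (at z0)"
      unfolding \<omega>_def by (auto intro!: derivative_eq_intros)
  qed
  hence "deriv \<omega> z0 \<noteq> 0" by (simp add: E_def)
  then obtain \<rho> where \<rho>: "\<rho> > 0" "ball z0 \<rho> \<subseteq> ball z0 e" "open (\<omega> ` ball z0 \<rho>)" "inj_on \<omega> (ball z0 \<rho>)"
    using has_complex_derivative_locally_invertible[OF hol\<omega> _ open_ball, of z0] G(1) by auto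
  obtain v where v: "v holomorphic_on (\<omega> ` ball z0 \<rho>)" "\<And>w. w \<in> ball z0 \<rho> \<Longrightarrow> v (\<omega> w) = w"
    using holomorphic_has_inverse[OF holomorphic_on_subset[OF hol\<omega> \<rho>(2)] open_ball \<rho>(4)] by metis
  have \<omega>0: "\<omega> z0 = 0" by (simp add: \<omega>_def)
  have v0: "v 0 = z0" using v(2)[of z0] \<rho>(1) \<omega>0 by simp
  have N: "eventually (\<lambda>u. u \<in> \<omega> ` ball z0 \<rho>) (at 0)"
    using \<rho>(1,3) \<omega>0 by (intro eventually_at_in_open') (auto intro!: image_eqI[of _ _ z0])
  have ev: "eventually (\<lambda>u. u \<noteq> 0 \<and> v u \<in> ball z0 e - {z0} \<and> u = (v u - z0) * E (v u)) (at 0)"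
    using N eventually_neq_at_within[of 0 0 UNIV]
  proof eventually_elim
    case (elim u)
    then obtain w where w: "w \<in> ball z0 \<rho>" "u = \<omega> w" by blast
    thus ?case using v(2)[OF w(1)] elim \<rho>(2) by (auto simp: \<omega>_def)
  qed
  have "isCont v (\<omega> z0)"
    using holomorphic_on_imp_continuous_on[OF v(1)] \<rho>(1,3)
    by (auto simp: continuous_on_eq_continuous_at)
  hence "isCont v 0" by (simp add: \<omega>0)
  hence vlim: "(v \<longlongrightarrow> z0) (at 0)" by (simp add: isCont_def v0)
  have vfl: "filterlim v (at z0) (at 0)"
    unfolding filterlim_at using vlim ev by (auto elim: eventually_mono)
  define pt where "pt = \<psi> \<circ> v"
  show thesis
  proof (rule that)
    show "filterlim pt (at pinf) (at 0)"
      unfolding pt_def o_def \<psi>_def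
      by (rule filterlim_compose[OF chart_inv_filterlim[OF c] vfl[unfolded z0_def]])
    show "eventually (\<lambda>u. x (pt u) * u ^ r = 1) (at 0)"
      using ev
    proof eventually_elim
      case (elim u)
      define w where "w = v u"
      have w: "w \<in> ball z0 e" "w \<noteq> z0" "u = (w - z0) * E w" using elim by (auto simp: w_def)
      have "x (pt u) = G w * (w - z0) powi (- int r)"
        using G(4)[of w] w(1,2) by (simp add: pt_def w_def)
      moreover have "u ^ r = (w - z0) ^ r * E w ^ r"
        unfolding w(3) by (rule power_mult_distrib)
      moreover have "(w - z0) powi (- int r) * (w - z0) ^ r = 1"
        using w(2) by (simp add: power_int_minus)
      ultimately have "x (pt u) * u ^ r = E w ^ r * G w"
        by (metis (no_types, lifting) mult.assoc mult.commute mult.right_neutral)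
      thus ?case using Er[OF w(1)] by simp
    qed
    fix f assume f: "regular_away f" "\<exists>P. P \<noteq> pinf \<and> f P \<noteq> 0"
    define n where "n = rs_order \<A> f pinf"
    obtain F d where F: "d > 0" "F holomorphic_on cball z0 d" "F z0 \<noteq> 0"
      "\<And>w. w \<in> cball z0 d - {z0} \<Longrightarrow> f (\<psi> w) = F w * (w - z0) powi n \<and> F w \<noteq> 0"
      using local[OF f] unfolding n_def by blast
    have "isCont E z0" using holomorphic_on_imp_continuous_on[OF holE] G(1)
      by (simp add: continuous_on_eq_continuous_at)
    hence Elim: "((\<lambda>u. E (v u)) \<longlongrightarrow> E z0) (at 0)" by (rule isCont_tendsto_compose) (rule vlim)
    have "isCont F z0" using holomorphic_on_imp_continuous_on[OF F(2)] F(1)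
      by (intro continuous_on_interior[of "cball z0 d"]) auto
    hence Flim: "((\<lambda>u. F (v u)) \<longlongrightarrow> F z0) (at 0)" by (rule isCont_tendsto_compose) (rule vlim)
    have E0: "E w \<noteq> 0" for w by (simp add: E_def)
    have "((\<lambda>u. F (v u) * E (v u) powi (- n)) \<longlongrightarrow> F z0 * E z0 powi (- n)) (at 0)"
      by (intro tendsto_intros Flim Elim E0)
    moreover have "eventually (\<lambda>w. w \<in> cball z0 d) (at z0)"
      using F(1) by (auto simp: eventually_at dist_commute intro!: exI[of _ d])
    hence "eventually (\<lambda>u. v u \<in> cball z0 d) (at 0)"
      by (rule eventually_compose_filterlim[OF _ vfl])
    with ev have "eventually (\<lambda>u. F (v u) * E (v u) powi (- n) = f (pt u) * u powi (- n)) (at 0)"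
    proof eventually_elim
      case (elim u)
      define w where "w = v u"
      have w: "w \<in> cball z0 d" "w \<noteq> z0" "u = (w - z0) * E w" using elim by (auto simp: w_def)
      have "f (pt u) = F w * (w - z0) powi n"
        using F(4)[of w] w(1,2) by (simp add: pt_def w_def)
      moreover have "u powi (- n) = (w - z0) powi (- n) * E w powi (- n)"
        unfolding w(3) by (rule power_int_mult_distrib)
      moreover have "(w - z0) powi n * (w - z0) powi (- n) = 1"
        using w(2) by (simp add: power_int_minus)
      ultimately have "f (pt u) * u powi (- n) = F w * E w powi (- n)"
        by (metis (no_types, lifting) mult.assoc mult.right_neutral)
      thus ?case by (simp add: w_def)
    qed
    ultimately have "((\<lambda>u. f (pt u) * u powi (- n)) \<longlongrightarrow> F z0 * E z0 powi (- n)) (at 0)"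
      by (rule Lim_transform_eventually)
    thus "\<exists>a. a \<noteq> 0 \<and> ((\<lambda>u. f (pt u) * u powi (- rs_order \<A> f pinf)) \<longlongrightarrow> a) (at 0)"
      using F(3) E0[of z0] unfolding n_def by (intro exI[of _ "F z0 * E z0 powi (- n)"]) (auto simp: n_def)
  qed
qed

end

section \<open>The affine ring of a Weierstrass curve\<close>

locale weierstrass =
  fixes C :: "'a::t2_space weierstrass_data"
  assumes curve: "weierstrass_curve C"

sublocale weierstrass \<subseteq> pointed_riemann_surface "w_atlas C" "w_inf C"
  by unfold_locales (use curve in \<open>simp add: weierstrass_curve_def\<close>)

context weierstrass
begin

\<comment> \<open>Keeps \<open>w_gen C 1\<close>, the degree \<open>r\<close>, in its stated form under simplification.\<close>
declare One_nat_def [simp del]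

abbreviation "K \<equiv> carrier (RX C)"
abbreviation "pinf \<equiv> w_inf C"
abbreviation "r \<equiv> w_r C"
abbreviation "x \<equiv> w_x C"

lemma carrier_RX: "f \<in> K \<longleftrightarrow> f pinf = 0 \<and> regular_away f"
  by (auto simp: RX_def regular_away_def)

lemma RX_simps [simp]:
  "f \<otimes>\<^bsub>RX C\<^esub> g = (\<lambda>P. f P * g P)" "f \<oplus>\<^bsub>RX C\<^esub> g = (\<lambda>P. f P + g P)"
  "\<zero>\<^bsub>RX C\<^esub> = (\<lambda>P. 0)" "\<one>\<^bsub>RX C\<^esub> = (\<lambda>P. if P = pinf then 0 else 1)"
  by (simp_all add: RX_def)

definition cut :: "('a \<Rightarrow> complex) \<Rightarrow> 'a \<Rightarrow> complex" where
  "cut f = (\<lambda>P. if P = pinf then 0 else f P)"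

lemma cut_carrier: "regular_away f \<Longrightarrow> cut f \<in> K"
  unfolding carrier_RX by (auto simp: cut_def intro: regular_away_cong)

lemma carrier_regular: "f \<in> K \<Longrightarrow> regular_away f" and carrier_inf: "f \<in> K \<Longrightarrow> f pinf = 0"
  by (auto simp: carrier_RX)

lemma carrier_ext:
  "f \<in> K \<Longrightarrow> g \<in> K \<Longrightarrow> (\<And>P. P \<noteq> pinf \<Longrightarrow> f P = g P) \<Longrightarrow> f = g"
  by (rule ext) (metis carrier_inf)

lemma carrier_mult: "f \<in> K \<Longrightarrow> g \<in> K \<Longrightarrow> (\<lambda>P. f P * g P) \<in> K"
  by (auto simp: carrier_RX intro: regular_away_mult)

lemma carrier_add: "f \<in> K \<Longrightarrow> g \<in> K \<Longrightarrow> (\<lambda>P. f P + g P) \<in> K"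
  by (auto simp: carrier_RX intro: regular_away_add)

lemma carrier_scale: "f \<in> K \<Longrightarrow> (\<lambda>P. c * f P) \<in> K"
  by (auto simp: carrier_RX intro: regular_away_mult regular_away_const)

lemma carrier_diff: "f \<in> K \<Longrightarrow> g \<in> K \<Longrightarrow> (\<lambda>P. f P - g P) \<in> K"
  using carrier_add[of f "\<lambda>P. (-1) * g P"] carrier_scale[of g "-1"] by simp

lemma carrier_sum: "(\<And>i. i \<in> I \<Longrightarrow> f i \<in> K) \<Longrightarrow> (\<lambda>P. \<Sum>i\<in>I. f i P) \<in> K"
  by (auto simp: carrier_RX intro!: regular_away_sum)

lemma carrier_zero: "(\<lambda>P. 0) \<in> K"
  by (simp add: carrier_RX regular_away_const)

lemma carrier_one: "(\<lambda>P. if P = pinf then 0 else 1) \<in> K"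
  using cut_carrier[OF regular_away_const[of 1]] by (simp add: cut_def)

lemma cring_RX: "cring (RX C)"
proof (rule cringI)
  show "abelian_group (RX C)"
  proof (rule abelian_groupI)
    fix f assume f: "f \<in> K"
    show "\<exists>g\<in>K. g \<oplus>\<^bsub>RX C\<^esub> f = \<zero>\<^bsub>RX C\<^esub>"
      using carrier_scale[OF f, of "-1"] by (intro bexI[of _ "\<lambda>P. (-1) * f P"]) auto
  qed (use carrier_zero carrier_add in \<open>auto simp: algebra_simps\<close>)
  show "comm_monoid (RX C)"
    by (rule comm_monoidI) (use carrier_one carrier_mult carrier_inf in \<open>auto simp: algebra_simps fun_eq_iff\<close>)
qed (auto simp: algebra_simps)

sublocale RX: cring "RX C" by (rule cring_RX)

lemma RX_minus:
  assumes "f \<in> K" "g \<in> K"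
  shows "f \<ominus>\<^bsub>RX C\<^esub> g = (\<lambda>P. f P - g P)"
proof -
  have "\<ominus>\<^bsub>RX C\<^esub> g = (\<lambda>P. (-1) * g P)"
    by (rule RX.minus_equality) (use assms carrier_scale[of g "-1"] in auto)
  thus ?thesis by (simp add: a_minus_def)
qed

lemma RX_finsum:
  "(\<And>i. i \<in> I \<Longrightarrow> g i \<in> K) \<Longrightarrow> (\<Oplus>\<^bsub>RX C\<^esub>i\<in>I. g i) = (\<lambda>P. \<Sum>i\<in>I. g i P)"
proof (induction I rule: infinite_finite_induct)
  case (infinite I)
  thus ?case by (simp add: finsum_def finprod_def)
next
  case (insert i I)
  thus ?case by (subst RX.finsum_insert) auto
qed auto

lemma nonzero_iff: "f \<in> K \<Longrightarrow> f \<noteq> (\<lambda>P. 0) \<longleftrightarrow> (\<exists>P. P \<noteq> pinf \<and> f P \<noteq> 0)"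
  unfolding fun_eq_iff using carrier_inf[of f] by metis

text \<open>Two nonzero functions are both free of zeros on a punctured neighbourhood of \<open>\<infinity>\<close>.\<close>
lemma no_zero_divisors:
  assumes "f \<in> K" "g \<in> K" "(\<lambda>P. f P * g P) = (\<lambda>P. 0)"
  shows "f = (\<lambda>P. 0) \<or> g = (\<lambda>P. 0)"
proof (rule ccontr)
  assume "\<not> ?thesis"
  hence "eventually (\<lambda>P. f P \<noteq> 0) (at pinf)" "eventually (\<lambda>P. g P \<noteq> 0) (at pinf)"
    using identity_theorem[of f] identity_theorem[of g] nonzero_iff[of f] nonzero_iff[of g]
      assms(1,2) carrier_regular by blast+
  hence "eventually (\<lambda>P. False) (at pinf)"
  proof eventually_elim
    case (elim P)
    thus False using fun_cong[OF assms(3), of P] by simp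
  qed
  thus False using at_neq_bot by (simp add: trivial_limit_def)
qed

lemma regular_elements_RX: "regular_elements (RX C) = K - {\<lambda>P. 0}"
proof (intro equalityI subsetI)
  fix f assume f: "f \<in> regular_elements (RX C)"
  have "(\<lambda>P. if P = pinf then 0 else 1 :: complex) \<noteq> (\<lambda>P. 0)"
  proof
    assume *: "(\<lambda>P. if P = pinf then 0 else 1 :: complex) = (\<lambda>P. 0)"
    have "P = pinf" for P using fun_cong[OF *, of P] by (auto split: if_splits)
    hence "eventually (\<lambda>P. False) (at pinf)" by (auto simp: eventually_at_topological)
    thus False using at_neq_bot by (simp add: trivial_limit_def)
  qed
  hence "f \<noteq> (\<lambda>P. 0)"
    using RX.regular_cancel_zero[OF f RX.one_closed] by auto
  thus "f \<in> K - {\<lambda>P. 0}" using RX.regular_closed[OF f] by simp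
next
  fix f assume "f \<in> K - {\<lambda>P. 0}"
  thus "f \<in> regular_elements (RX C)"
    unfolding regular_elements_def using no_zero_divisors by auto
qed

lemma x_carrier: "x \<in> K"
  using curve by (simp add: weierstrass_curve_def has_pole_order_def)

lemma y_pole_order: "j \<in> {2..w_num C} \<Longrightarrow> has_pole_order C (w_y C j) (w_gen C j)"
  using curve by (simp add: weierstrass_curve_def)

lemma y_carrier: "j \<in> {2..w_num C} \<Longrightarrow> w_y C j \<in> K"
  using y_pole_order[of j] by (simp add: has_pole_order_def)

lemma r_pos: "0 < r"
  using curve by (simp add: weierstrass_curve_def)

lemma xpoly_carrier: "xpoly C p \<in> K"
  using cut_carrier[OF regular_away_poly[OF carrier_regular[OF x_carrier], of p]]
  by (simp add: xpoly_def cut_def)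

lemma xpoly_eq: "P \<noteq> pinf \<Longrightarrow> xpoly C p P = poly p (x P)"
  by (simp add: xpoly_def)

lemma ybasis_carrier: "ybasis C i \<in> K"
proof -
  have "regular_away (\<lambda>P. \<Prod>j=2..w_num C. w_y C j P ^ w_exp C i j)"
    by (intro regular_away_prod regular_away_power carrier_regular y_carrier)
  from cut_carrier[OF this] show ?thesis by (simp add: ybasis_def cut_def)
qed

end

section \<open>Pole orders at infinity\<close>

text \<open>Fixing the parametrisation makes leading coefficients at \<open>\<infinity>\<close> well defined, so that they add and
  multiply.\<close>
locale uniformized_weierstrass = weierstrass +
  fixes pt :: "complex \<Rightarrow> 'a"
  assumes pt_lim: "filterlim pt (at (w_inf C)) (at 0)"
    and pt_x: "eventually (\<lambda>u. w_x C (pt u) * u ^ w_gen C 1 = 1) (at 0)"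
    and pt_pole: "f \<in> carrier (RX C) \<Longrightarrow> f \<noteq> (\<lambda>P. 0) \<Longrightarrow>
       \<exists>a. a \<noteq> 0 \<and> ((\<lambda>u. f (pt u) * u powi (- wt C f)) \<longlongrightarrow> a) (at 0)"

lemma (in weierstrass) uniformizer_exists:
  obtains pt where "uniformized_weierstrass C pt"
proof -
  have p: "has_pole_order C x r" using curve by (simp add: weierstrass_curve_def)
  hence "rs_order (w_atlas C) x pinf = - int r" "x \<noteq> (\<lambda>P. 0)"
    by (simp_all add: has_pole_order_def wt_def)
  then obtain pt :: "complex \<Rightarrow> 'a" where pt: "filterlim pt (at pinf) (at 0)"
    "eventually (\<lambda>u. x (pt u) * u ^ r = 1) (at 0)"
    "\<And>f. regular_away f \<Longrightarrow> (\<exists>P. P \<noteq> pinf \<and> f P \<noteq> 0) \<Longrightarrow>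
       \<exists>a. a \<noteq> 0 \<and> ((\<lambda>u. f (pt u) * u powi (- rs_order (w_atlas C) f pinf)) \<longlongrightarrow> a) (at 0)"
    using uniformizer[OF carrier_regular[OF x_carrier] _ r_pos] nonzero_iff[OF x_carrier] by blast
  have "uniformized_weierstrass C pt"
  proof unfold_locales
    fix f assume "f \<in> K" "f \<noteq> (\<lambda>P. 0)"
    thus "\<exists>a. a \<noteq> 0 \<and> ((\<lambda>u. f (pt u) * u powi (- wt C f)) \<longlongrightarrow> a) (at 0)"
      unfolding wt_def using nonzero_iff[of f] by (intro pt(3)) (auto intro: carrier_regular)
  qed (use pt in auto)
  thus ?thesis by (rule that)
qed

context uniformized_weierstrass
begin

text \<open>The coefficient of \<open>u\<^sup>-\<^sup>n\<close> of a function with pole order at most \<open>n\<close>. The value \<open>a = 0\<close> is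
  admitted and means that the pole order is smaller than \<open>n\<close>.\<close>
definition pole :: "('a \<Rightarrow> complex) \<Rightarrow> nat \<Rightarrow> complex \<Rightarrow> bool" where
  "pole f n a \<longleftrightarrow> ((\<lambda>u. f (pt u) * u ^ n) \<longlongrightarrow> a) (at 0)"

definition pole_degree :: "('a \<Rightarrow> complex) \<Rightarrow> nat" where
  "pole_degree f = nat (- wt C f)"

lemma pt_neq_inf: "eventually (\<lambda>u. pt u \<noteq> pinf) (at 0)"
  using pt_lim by (simp add: filterlim_at)

lemma wt_nonpos: "f \<in> K \<Longrightarrow> f \<noteq> (\<lambda>P. 0) \<Longrightarrow> wt C f \<le> 0"
  unfolding wt_def using order_nonpos[of f] nonzero_iff[of f] carrier_regular[of f] by blast

lemma pole_exists:
  assumes "f \<in> K" "f \<noteq> (\<lambda>P. 0)"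
  shows "\<exists>a. a \<noteq> 0 \<and> pole f (pole_degree f) a"
proof -
  have "- wt C f = int (pole_degree f)" using wt_nonpos[OF assms] by (simp add: pole_degree_def)
  thus ?thesis using pt_pole[OF assms] by (auto simp: pole_def)
qed

lemma pole_cong:
  assumes "pole f n a" "\<And>P. P \<noteq> pinf \<Longrightarrow> f P = g P"
  shows "pole g n a"
  using assms(1) unfolding pole_def
  by (rule Lim_transform_eventually)
     (use pt_neq_inf in \<open>eventually_elim, simp add: assms(2)\<close>)

lemma pole_const: "pole (\<lambda>_. c) 0 c"
  by (simp add: pole_def)

lemma pole_mult: "pole f n a \<Longrightarrow> pole g m b \<Longrightarrow> pole (\<lambda>P. f P * g P) (n + m) (a * b)"
  unfolding pole_def by (drule (1) tendsto_mult) (simp add: power_add mult_ac)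

lemma pole_scale: "pole f n a \<Longrightarrow> pole (\<lambda>P. c * f P) n (c * a)"
  unfolding pole_def by (drule tendsto_mult_left[of _ _ _ c]) (simp add: mult_ac)

lemma pole_add: "pole f n a \<Longrightarrow> pole g n b \<Longrightarrow> pole (\<lambda>P. f P + g P) n (a + b)"
  unfolding pole_def by (drule (1) tendsto_add) (simp add: algebra_simps)

lemma pole_diff: "pole f n a \<Longrightarrow> pole g n b \<Longrightarrow> pole (\<lambda>P. f P - g P) n (a - b)"
  unfolding pole_def by (drule (1) tendsto_diff) (simp add: algebra_simps)

lemma pole_sum: "(\<And>i. i \<in> I \<Longrightarrow> pole (f i) n (a i)) \<Longrightarrow> pole (\<lambda>P. \<Sum>i\<in>I. f i P) n (\<Sum>i\<in>I. a i)"
  unfolding pole_def sum_distrib_right by (rule tendsto_sum)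

lemma pole_power: "pole f n a \<Longrightarrow> pole (\<lambda>P. f P ^ k) (n * k) (a ^ k)"
  unfolding pole_def by (drule tendsto_power[of _ _ _ k]) (simp add: power_mult power_mult_distrib)

lemma pole_prod:
  assumes "\<And>i. i \<in> I \<Longrightarrow> pole (f i) (n i) (a i)"
  shows "pole (\<lambda>P. \<Prod>i\<in>I. f i P) (\<Sum>i\<in>I. n i) (\<Prod>i\<in>I. a i)"
  unfolding pole_def power_sum prod.distrib[symmetric]
  by (rule tendsto_prod) (use assms in \<open>simp add: pole_def\<close>)

lemma pole_lower:
  assumes "pole f n a" "n < m"
  shows "pole f m 0"
proof -
  have "((\<lambda>u. (f (pt u) * u ^ n) * u ^ (m - n)) \<longlongrightarrow> a * 0 ^ (m - n)) (at 0)"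
    using assms(1) unfolding pole_def by (intro tendsto_intros)
  thus ?thesis using assms(2)
    by (simp add: pole_def mult.assoc power_add[symmetric] power_0_left)
qed

lemma pole_zero: "pole (\<lambda>P. 0) n 0"
  by (simp add: pole_def)

lemma pole_value_unique: "pole f n a \<Longrightarrow> pole f n b \<Longrightarrow> a = b"
  unfolding pole_def by (rule tendsto_unique) auto

lemma pole_unique:
  assumes "pole f n a" "pole f m b" "a \<noteq> 0" "b \<noteq> 0"
  shows "n = m"
  using pole_lower[OF assms(1), of m] pole_lower[OF assms(2), of n]
    pole_value_unique[of f] assms by (metis linorder_neqE_nat)

lemma pole_degree_eqI: "f \<in> K \<Longrightarrow> pole f n a \<Longrightarrow> a \<noteq> 0 \<Longrightarrow> f \<noteq> (\<lambda>P. 0) \<and> pole_degree f = n"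
  using pole_exists[of f] pole_unique[of f] pole_zero[of n] pole_value_unique[of f] by metis

lemma wt_eqI: "f \<in> K \<Longrightarrow> pole f n a \<Longrightarrow> a \<noteq> 0 \<Longrightarrow> - wt C f = int n"
  using pole_degree_eqI[of f n a] wt_nonpos[of f] by (auto simp: pole_degree_def)

lemma pole_degree_less:
  assumes "f \<in> K" "f \<noteq> (\<lambda>P. 0)" "pole f n 0"
  shows "pole_degree f < n"
proof (rule ccontr)
  assume n: "\<not> pole_degree f < n"
  obtain a where a: "a \<noteq> 0" "pole f (pole_degree f) a" using pole_exists[OF assms(1,2)] by blast
  have "pole f (pole_degree f) 0"
    using n pole_lower[OF assms(3), of "pole_degree f"] assms(3) by (cases "n = pole_degree f") auto
  thus False using a pole_value_unique by blast
qed

lemma pole_has_pole_order: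
  assumes "has_pole_order C f n"
  shows "\<exists>a. a \<noteq> 0 \<and> pole f n a"
proof -
  have f: "f \<in> K" "f \<noteq> (\<lambda>P. 0)" "pole_degree f = n"
    using assms by (simp_all add: has_pole_order_def pole_degree_def)
  show ?thesis using pole_exists[OF f(1,2)] f(3) by blast
qed

lemma HX_iff: "n \<in> HX C \<longleftrightarrow> (\<exists>f\<in>K. \<exists>a. a \<noteq> 0 \<and> pole f n a)"
proof
  assume "n \<in> HX C"
  then obtain f where f: "has_pole_order C f n" by (auto simp: HX_def)
  hence "f \<in> K" by (simp add: has_pole_order_def)
  thus "\<exists>f\<in>K. \<exists>a. a \<noteq> 0 \<and> pole f n a" using pole_has_pole_order[OF f] by blast
next
  assume "\<exists>f\<in>K. \<exists>a. a \<noteq> 0 \<and> pole f n a"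
  then obtain f a where f: "f \<in> K" "pole f n a" "a \<noteq> 0" by blast
  have "has_pole_order C f n"
    using pole_degree_eqI[OF f] wt_eqI[OF f] f(1) by (simp add: has_pole_order_def)
  thus "n \<in> HX C" by (auto simp: HX_def)
qed

lemma pole_degree_HX:
  assumes "f \<in> K" "f \<noteq> (\<lambda>P. 0)"
  shows "pole_degree f \<in> HX C"
  unfolding HX_iff using pole_exists[OF assms] assms(1) by blast

lemma HX_add: "m \<in> HX C \<Longrightarrow> n \<in> HX C \<Longrightarrow> m + n \<in> HX C"
proof -
  assume "m \<in> HX C" "n \<in> HX C"
  then obtain f a g b where *: "f \<in> K" "a \<noteq> 0" "pole f m a" "g \<in> K" "b \<noteq> 0" "pole g n b"
    unfolding HX_iff by blast
  show "m + n \<in> HX C"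
    unfolding HX_iff using carrier_mult[OF *(1,4)] pole_mult[OF *(3,6)] *(2,5)
    by (metis mult_eq_0_iff)
qed

lemma HX_zero: "0 \<in> HX C"
proof -
  have "pole (\<lambda>P. if P = pinf then 0 else 1) 0 1" by (rule pole_cong[OF pole_const[of 1]]) simp
  thus ?thesis unfolding HX_iff using carrier_one zero_neq_one by metis
qed

lemma HX_mult: "n \<in> HX C \<Longrightarrow> k * n \<in> HX C"
  by (induction k) (auto intro: HX_zero HX_add)

lemma pole_x: "pole x r 1"
  unfolding pole_def
  by (rule Lim_transform_eventually[OF tendsto_const])
     (use pt_x in \<open>eventually_elim, simp\<close>)

lemma pole_poly: "p \<noteq> 0 \<Longrightarrow> pole (\<lambda>P. poly p (x P)) (r * degree p) (lead_coeff p)"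
proof (induction p)
  case (pCons c p)
  show ?case
  proof (cases "p = 0")
    case True
    thus ?thesis using pole_const[of c] by simp
  next
    case False
    have "pole (\<lambda>P. x P * poly p (x P)) (r + r * degree p) (1 * lead_coeff p)"
      by (rule pole_mult[OF pole_x pCons.IH[OF False]])
    moreover have "pole (\<lambda>P. c) (r + r * degree p) 0"
      by (rule pole_lower[OF pole_const]) (use r_pos in simp)
    ultimately have "pole (\<lambda>P. c + x P * poly p (x P)) (r + r * degree p) (0 + 1 * lead_coeff p)"
      by (intro pole_add)
    thus ?thesis using False by simp
  qed
qed simp

lemma x_transcendental: "(\<And>P. P \<noteq> pinf \<Longrightarrow> poly p (x P) = 0) \<Longrightarrow> p = 0"
  using pole_poly[of p] pole_cong[of "\<lambda>P. poly p (x P)" _ _ "\<lambda>P. 0"] pole_zero pole_value_unique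
  by (metis leading_coeff_neq_0)

lemma xpoly_zero_iff: "xpoly C p = (\<lambda>P. 0) \<longleftrightarrow> p = 0"
  using x_transcendental[of p] by (auto simp: xpoly_def fun_eq_iff split: if_splits)

text \<open>The order of \<open>p\<^sub>k(x) g\<^sub>k\<close> is congruent to \<open>n\<^sub>k\<close> modulo \<open>r\<close>. As the \<open>n\<^sub>k\<close> are pairwise incongruent, the
  nonzero summands have distinct orders and the largest one cannot be cancelled.\<close>
lemma leading_summand:
  fixes n :: "nat \<Rightarrow> nat" and p :: "nat \<Rightarrow> complex poly"
  assumes g: "\<And>k. k < r \<Longrightarrow> \<exists>b. b \<noteq> 0 \<and> pole (g k) (n k) b"
    and distinct: "\<And>i k. i < r \<Longrightarrow> k < r \<Longrightarrow> [n i = n k] (mod r) \<Longrightarrow> i = k"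
    and p: "k < r" "p k \<noteq> 0"
  obtains i a where "i < r" "p i \<noteq> 0" "a \<noteq> 0"
    "pole (\<lambda>P. \<Sum>k<r. poly (p k) (x P) * g k P) (r * degree (p i) + n i) a"
proof -
  obtain b where b: "\<And>k. k < r \<Longrightarrow> b k \<noteq> 0" "\<And>k. k < r \<Longrightarrow> pole (g k) (n k) (b k)"
    using g by metis
  define N where "N k = r * degree (p k) + n k" for k
  define S where "S = {k. k < r \<and> p k \<noteq> 0}"
  have S: "finite S" "S \<noteq> {}" using p by (auto simp: S_def)
  have "Max (N ` S) \<in> N ` S" using S by simp
  then obtain i where i: "i \<in> S" "N i = Max (N ` S)" by auto
  have max: "N k \<le> N i" if "k \<in> S" for k using that S by (simp add: i(2))
  have "pole (\<lambda>P. poly (p k) (x P) * g k P) (N i) (if k = i then lead_coeff (p i) * b i else 0)"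
    if k: "k < r" for k
  proof (cases "p k = 0")
    case True
    thus ?thesis using i pole_zero by (auto simp: S_def)
  next
    case False
    hence kS: "k \<in> S" using k by (simp add: S_def)
    have pk: "pole (\<lambda>P. poly (p k) (x P) * g k P) (N k) (lead_coeff (p k) * b k)"
      unfolding N_def by (rule pole_mult[OF pole_poly[OF False] b(2)[OF k]])
    show ?thesis
    proof (cases "k = i")
      case False
      have "N k \<noteq> N i"
      proof
        assume "N k = N i"
        moreover have "[N j = n j] (mod r)" for j unfolding N_def by (simp add: Cong.cong_def)
        ultimately have "[n k = n i] (mod r)" by (metis cong_sym cong_trans)
        thus False using distinct[of k i] k i False by (auto simp: S_def)
      qed
      hence "N k < N i" using max[OF kS] by simp
      from pole_lower[OF pk this] show ?thesis using False by simp
    qed (use pk in simp)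
  qed
  hence "pole (\<lambda>P. \<Sum>k<r. poly (p k) (x P) * g k P) (N i)
      (\<Sum>k<r. if k = i then lead_coeff (p i) * b i else 0)"
    by (intro pole_sum) auto
  thus ?thesis using i(1) b(1) unfolding S_def N_def by (intro that[of i "lead_coeff (p i) * b i"]) auto
qed

section \<open>Freeness over the polynomial ring\<close>

abbreviation "e \<equiv> std_basis C"
abbreviation "y \<equiv> ybasis C"

definition class_min :: "nat \<Rightarrow> nat" where
  "class_min k = (LEAST h. h \<in> HX C \<and> [h = k] (mod r))"

lemma class_min:
  "class_min k \<in> HX C" "[class_min k = k] (mod r)"
  "n \<in> HX C \<Longrightarrow> [n = k] (mod r) \<Longrightarrow> class_min k \<le> n"
proof -
  have "coprime (w_s C) r" using curve by (simp add: weierstrass_curve_def coprime_iff_gcd_eq_1)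
  then obtain c where c: "[w_s C * c = 1] (mod r)" using cong_solve_coprime_nat[of "w_s C" r] by (auto simp: One_nat_def)
  have "2 \<in> {2..w_num C}" using curve by (simp add: weierstrass_curve_def)
  hence "w_s C \<in> HX C"
    unfolding HX_def using y_pole_order[of 2] by blast
  hence "(c * k) * w_s C \<in> HX C" by (rule HX_mult)
  moreover have "[(c * k) * w_s C = k] (mod r)"
    using cong_mult[OF c cong_refl[of k]] by (simp add: mult_ac)
  ultimately have "\<exists>h. h \<in> HX C \<and> [h = k] (mod r)" by blast
  from LeastI_ex[OF this] show "class_min k \<in> HX C" "[class_min k = k] (mod r)"
    by (auto simp: class_min_def)
  show "n \<in> HX C \<Longrightarrow> [n = k] (mod r) \<Longrightarrow> class_min k \<le> n"
    unfolding class_min_def by (rule Least_le) auto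
qed

lemma std_basis_bij: "bij_betw e {..<r} (class_min ` {..<r})"
proof -
  have E: "{(LEAST h. h \<in> HX C \<and> [h = k] (mod r)) | k. k < r} = class_min ` {..<r}"
    by (auto simp: class_min_def)
  have inj: "inj_on class_min {..<r}"
  proof (rule inj_onI)
    fix i k assume ik: "i \<in> {..<r}" "k \<in> {..<r}" "class_min i = class_min k"
    have "[i = k] (mod r)"
      using class_min(2)[of i] class_min(2)[of k] ik(3) by (metis cong_sym cong_trans)
    thus "i = k" using ik(1,2) by (simp add: cong_less_modulus_unique_nat)
  qed
  let ?l = "sorted_list_of_set (class_min ` {..<r})"
  have "length ?l = r" using card_image[OF inj] by simp
  moreover have "bij_betw ((!) ?l) {..<length ?l} (set ?l)"
    by (rule bij_betw_nth) auto
  moreover have "e = (!) ?l" by (rule ext) (simp add: std_basis_def E)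
  ultimately show ?thesis by simp
qed

lemma std_basis_eq_class_min: "i < r \<Longrightarrow> \<exists>k<r. e i = class_min k"
  using std_basis_bij by (auto simp: bij_betw_def)

lemma std_basis_distinct: "i < r \<Longrightarrow> k < r \<Longrightarrow> [e i = e k] (mod r) \<Longrightarrow> i = k"
proof -
  assume i: "i < r" and k: "k < r" and c: "[e i = e k] (mod r)"
  obtain i' k' where *: "i' < r" "k' < r" "e i = class_min i'" "e k = class_min k'"
    using std_basis_eq_class_min i k by blast
  have "[i' = k'] (mod r)"
    using c class_min(2)[of i'] class_min(2)[of k'] * by (metis cong_sym cong_trans)
  hence "i' = k'" using * by (simp add: cong_less_modulus_unique_nat)
  thus "i = k" using * i k std_basis_bij unfolding bij_betw_def inj_on_def by auto
qed

lemma std_basis_class: "\<exists>i<r. [n = e i] (mod r)"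
proof -
  have "class_min (n mod r) \<in> e ` {..<r}"
    using std_basis_bij r_pos by (auto simp: bij_betw_def)
  then obtain i where i: "i < r" "e i = class_min (n mod r)" by auto
  have "[n = e i] (mod r)" using class_min(2)[of "n mod r"] unfolding i(2) by (simp add: Cong.cong_def)
  thus ?thesis using i by blast
qed

lemma std_basis_decompose:
  assumes "n \<in> HX C"
  obtains i q where "i < r" "n = e i + r * q"
proof -
  obtain i where i: "i < r" "[n = e i] (mod r)" using std_basis_class by blast
  obtain k where k: "e i = class_min k" using std_basis_eq_class_min[OF i(1)] by blast
  have "[n = k] (mod r)" using i(2) class_min(2)[of k] k by (metis cong_trans)
  hence le: "e i \<le> n" using class_min(3)[OF assms] k by simp
  hence "r dvd n - e i" using i(2) by (simp add: cong_altdef_nat)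
  then obtain q where "n - e i = r * q" by (auto elim: dvdE)
  hence "n = e i + r * q" using le by simp
  thus ?thesis by (rule that[OF i(1)])
qed

lemma pole_ybasis: "i < r \<Longrightarrow> \<exists>b. b \<noteq> 0 \<and> pole (y i) (e i) b"
proof -
  assume i: "i < r"
  have "\<exists>a. a \<noteq> 0 \<and> pole (w_y C j) (w_gen C j) a" if "j \<in> {2..w_num C}" for j
    by (rule pole_has_pole_order[OF y_pole_order[OF that]])
  then obtain a where a: "\<And>j. j \<in> {2..w_num C} \<Longrightarrow> a j \<noteq> 0"
    "\<And>j. j \<in> {2..w_num C} \<Longrightarrow> pole (w_y C j) (w_gen C j) (a j)" by metis
  have "pole (\<lambda>P. \<Prod>j=2..w_num C. w_y C j P ^ w_exp C i j) (\<Sum>j=2..w_num C. w_gen C j * w_exp C i j)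
      (\<Prod>j=2..w_num C. a j ^ w_exp C i j)"
    by (intro pole_prod pole_power a)
  moreover have "(\<Sum>j=2..w_num C. w_gen C j * w_exp C i j) = e i"
    using curve i unfolding weierstrass_curve_def by (simp add: mult.commute)
  ultimately have "pole (y i) (e i) (\<Prod>j=2..w_num C. a j ^ w_exp C i j)"
    by (auto simp: ybasis_def elim: pole_cong)
  moreover have "(\<Prod>j=2..w_num C. a j ^ w_exp C i j) \<noteq> 0" using a(1) by simp
  ultimately show ?thesis by blast
qed

text \<open>The pole order \<open>n\<close> of \<open>f\<close> lies in the semigroup, so \<open>n = e\<^sub>i + r q\<close> for some \<open>i\<close> by minimality of \<open>e\<^sub>i\<close> in
  its class. A multiple of \<open>x\<^sup>q y\<^sub>i\<close> cancels the leading term and lowers the order.\<close>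
lemma expansion_exists:
  assumes "f \<in> K"
  shows "\<exists>p. \<forall>P. P \<noteq> pinf \<longrightarrow> f P = (\<Sum>k<r. poly (p k) (x P) * y k P)"
  using assms
proof (induction "pole_degree f" arbitrary: f rule: less_induct)
  case (less f)
  show ?case
  proof (cases "f = (\<lambda>P. 0)")
    case True
    thus ?thesis by (intro exI[of _ "\<lambda>k. 0"]) simp
  next
    case False
    obtain a where a: "a \<noteq> 0" "pole f (pole_degree f) a"
      using pole_exists[OF less.prems False] by blast
    obtain i q where i: "i < r" "pole_degree f = e i + r * q"
      by (rule std_basis_decompose[OF pole_degree_HX[OF less.prems False]])
    obtain b where b: "b \<noteq> 0" "pole (y i) (e i) b" using pole_ybasis[OF i(1)] by blast
    define m where "m = monom (a / b) q"
    define g where "g = (\<lambda>P. f P - xpoly C m P * y i P)"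
    have gK: "g \<in> K" unfolding g_def
      by (intro carrier_diff carrier_mult less.prems xpoly_carrier ybasis_carrier)
    have "m \<noteq> 0" "degree m = q" "lead_coeff m = a / b" using a b by (auto simp: m_def degree_monom_eq)
    hence "pole (\<lambda>P. poly m (x P) * y i P) (r * q + e i) (a / b * b)"
      using pole_mult[OF pole_poly[of m] b(2)] by simp
    hence "pole (\<lambda>P. poly m (x P) * y i P) (pole_degree f) a" using i(2) b(1) by (simp add: add.commute)
    from pole_diff[OF a(2) this] have "pole (\<lambda>P. f P - poly m (x P) * y i P) (pole_degree f) 0" by simp
    hence "pole g (pole_degree f) 0"
      by (rule pole_cong) (simp add: g_def xpoly_eq)
    hence "g = (\<lambda>P. 0) \<or> pole_degree g < pole_degree f" using pole_degree_less[OF gK] by blast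
    hence "\<exists>p. \<forall>P. P \<noteq> pinf \<longrightarrow> g P = (\<Sum>k<r. poly (p k) (x P) * y k P)"
      using less.hyps[OF _ gK] by (auto intro: exI[of _ "\<lambda>k. 0"])
    then obtain p where p: "\<And>P. P \<noteq> pinf \<Longrightarrow> g P = (\<Sum>k<r. poly (p k) (x P) * y k P)" by blast
    have "f P = (\<Sum>k<r. poly (p k + (if k = i then m else 0)) (x P) * y k P)" if P: "P \<noteq> pinf" for P
    proof -
      have "(\<Sum>k<r. poly (p k + (if k = i then m else 0)) (x P) * y k P) =
          (\<Sum>k<r. poly (p k) (x P) * y k P) + (\<Sum>k<r. if k = i then poly m (x P) * y k P else 0)"
        unfolding sum.distrib[symmetric] by (intro sum.cong) (auto simp: algebra_simps)
      also have "\<dots> = g P + poly m (x P) * y i P" using p[OF P] i(1) by simp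
      finally show ?thesis using P by (simp add: g_def xpoly_eq)
    qed
    thus ?thesis by (intro exI[of _ "\<lambda>k. p k + (if k = i then m else 0)"]) auto
  qed
qed

lemma ybasis_independent:
  assumes "\<And>P. P \<noteq> pinf \<Longrightarrow> (\<Sum>k<r. poly (p k) (x P) * y k P) = 0" "k < r"
  shows "p k = 0"
proof (rule ccontr)
  assume pk: "p k \<noteq> 0"
  obtain i a where ia: "a \<noteq> 0" "pole (\<lambda>P. \<Sum>k<r. poly (p k) (x P) * y k P) (r * degree (p i) + e i) a"
    by (rule leading_summand[of y e k p])
       (use pole_ybasis std_basis_distinct assms(2) pk in auto)
  have "pole (\<lambda>P. \<Sum>k<r. poly (p k) (x P) * y k P) (r * degree (p i) + e i) 0"
    by (rule pole_cong[OF pole_zero]) (simp add: assms(1))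
  from pole_value_unique[OF this ia(2)] ia(1) show False by simp
qed

text \<open>Only the coordinates with index below \<open>r\<close> are determined by the function.\<close>
definition coord :: "('a \<Rightarrow> complex) \<Rightarrow> nat \<Rightarrow> complex poly" where
  "coord f = (SOME p. \<forall>P. P \<noteq> pinf \<longrightarrow> f P = (\<Sum>k<r. poly (p k) (x P) * y k P))"

lemma coord_expand: "f \<in> K \<Longrightarrow> P \<noteq> pinf \<Longrightarrow> f P = (\<Sum>k<r. poly (coord f k) (x P) * y k P)"
  using someI_ex[OF expansion_exists[of f]] unfolding coord_def by blast

lemma coord_eqI:
  assumes "f \<in> K" "\<And>P. P \<noteq> pinf \<Longrightarrow> f P = (\<Sum>k<r. poly (p k) (x P) * y k P)" "k < r"
  shows "coord f k = p k"
proof -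
  have "coord f k - p k = 0"
  proof (rule ybasis_independent[OF _ assms(3)])
    fix P assume P: "P \<noteq> pinf"
    show "(\<Sum>k<r. poly (coord f k - p k) (x P) * y k P) = 0"
      using coord_expand[OF assms(1) P] assms(2)[OF P] by (simp add: algebra_simps sum_subtractf)
  qed
  thus ?thesis by simp
qed

lemma coord_combination:
  assumes f: "f \<in> K" and g: "\<And>i. i \<in> I \<Longrightarrow> g i \<in> K"
    and fg: "\<And>P. P \<noteq> pinf \<Longrightarrow> f P = (\<Sum>i\<in>I. poly (q i) (x P) * g i P)" and k: "k < r"
  shows "coord f k = (\<Sum>i\<in>I. q i * coord (g i) k)"
proof (rule coord_eqI[OF f _ k])
  fix P assume P: "P \<noteq> pinf"
  have "f P = (\<Sum>i\<in>I. \<Sum>k<r. poly (q i) (x P) * (poly (coord (g i) k) (x P) * y k P))"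
    unfolding fg[OF P] sum_distrib_left[symmetric]
    by (intro sum.cong refl arg_cong2[where f = "(*)"]) (use coord_expand[OF g P] in simp)
  also have "\<dots> = (\<Sum>k<r. \<Sum>i\<in>I. poly (q i) (x P) * (poly (coord (g i) k) (x P) * y k P))"
    by (rule sum.swap)
  also have "\<dots> = (\<Sum>k<r. poly (\<Sum>i\<in>I. q i * coord (g i) k) (x P) * y k P)"
    by (intro sum.cong refl) (simp add: poly_sum sum_distrib_right mult.assoc)
  finally show "f P = \<dots>" .
qed

text \<open>Filtered by the pole order, the functions of order less than \<open>L\<close> form a space whose \<open>L\<close> successive
  quotients are at most one-dimensional.\<close>
lemma linearly_dependent:
  assumes "finite I" "card I > L" "\<And>i. i \<in> I \<Longrightarrow> f i \<in> K" "\<And>i. i \<in> I \<Longrightarrow> pole (f i) L 0"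
  shows "\<exists>c. (\<exists>i\<in>I. c i \<noteq> 0) \<and> (\<forall>P. (\<Sum>i\<in>I. c i * f i P) = 0)"
  using assms
proof (induction L arbitrary: I f)
  case 0
  have "f i = (\<lambda>P. 0)" if "i \<in> I" for i
    using pole_degree_less[OF 0(3)[OF that] _ 0(4)[OF that]] by blast
  moreover obtain i where "i \<in> I" using 0(2) by fastforce
  ultimately show ?case by (intro exI[of _ "\<lambda>_. 1"]) auto
next
  case (Suc L)
  have "\<exists>a. pole (f i) L a" if i: "i \<in> I" for i
  proof (cases "f i = (\<lambda>P. 0)")
    case True
    thus ?thesis using pole_zero by metis
  next
    case False
    obtain a where "pole (f i) (pole_degree (f i)) a" using pole_exists[OF Suc.prems(3)[OF i] False] by blast
    moreover have "pole_degree (f i) \<le> L"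
      using pole_degree_less[OF Suc.prems(3)[OF i] False Suc.prems(4)[OF i]] by simp
    ultimately show ?thesis using pole_lower[of "f i" "pole_degree (f i)" a L]
      by (cases "pole_degree (f i) = L") auto
  qed
  then obtain a where a: "\<And>i. i \<in> I \<Longrightarrow> pole (f i) L (a i)" by metis
  show ?case
  proof (cases "\<forall>i\<in>I. a i = 0")
    case True
    thus ?thesis using Suc.prems a by (intro Suc.IH) auto
  next
    case False
    then obtain i0 where i0: "i0 \<in> I" "a i0 \<noteq> 0" by blast
    define t where "t i = a i / a i0" for i
    define g where "g i = (\<lambda>P. f i P - t i * f i0 P)" for i
    have "\<exists>c. (\<exists>i\<in>I - {i0}. c i \<noteq> 0) \<and> (\<forall>P. (\<Sum>i\<in>I - {i0}. c i * g i P) = 0)"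
    proof (rule Suc.IH)
      show "finite (I - {i0})" "L < card (I - {i0})" using Suc.prems(1,2) i0(1) by simp_all
      fix i assume i: "i \<in> I - {i0}"
      show "g i \<in> K" unfolding g_def using i i0 by (intro carrier_diff carrier_scale Suc.prems(3)) auto
      have "pole (\<lambda>P. f i P - t i * f i0 P) L (a i - t i * a i0)"
        using i i0 by (intro pole_diff pole_scale a) auto
      thus "pole (g i) L 0" using i0(2) by (simp add: g_def t_def)
    qed
    then obtain c where c: "\<exists>i\<in>I - {i0}. c i \<noteq> 0" "\<And>P. (\<Sum>i\<in>I - {i0}. c i * g i P) = 0" by blast
    define c' where "c' i = (if i = i0 then - (\<Sum>i\<in>I - {i0}. c i * t i) else c i)" for i
    have "(\<Sum>i\<in>I. c' i * f i P) = 0" for P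
    proof -
      have "(\<Sum>i\<in>I. c' i * f i P) = c' i0 * f i0 P + (\<Sum>i\<in>I - {i0}. c' i * f i P)"
        using Suc.prems(1) i0(1) by (rule sum.remove)
      also have "(\<Sum>i\<in>I - {i0}. c' i * f i P) = (\<Sum>i\<in>I - {i0}. c i * f i P)"
        by (intro sum.cong) (auto simp: c'_def)
      also have "c' i0 * f i0 P + \<dots> = (\<Sum>i\<in>I - {i0}. c i * g i P)"
        by (simp add: c'_def g_def algebra_simps sum_subtractf sum_distrib_left)
      finally show ?thesis using c(2) by simp
    qed
    moreover have "\<exists>i\<in>I. c' i \<noteq> 0" using c(1) by (auto simp: c'_def)
    ultimately show ?thesis by blast
  qed
qed

text \<open>With \<open>n\<close> the pole order of \<open>b\<close> and \<open>E = \<Sum> e\<^sub>i\<close>, the \<open>(r + 1) M\<close> functions \<open>x\<^sup>j\<close> and \<open>x\<^sup>j b y\<^sub>i\<close> with \<open>j < M\<close>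
  have pole order less than \<open>r M + n + E\<close>. For \<open>M > n + E\<close> they are therefore linearly dependent,
  which gives a relation \<open>c(x) = b b'\<close>. It is nontrivial with \<open>c \<noteq> 0\<close> because the \<open>b y\<^sub>i\<close> are
  independent over \<open>\<complex>[x]\<close>.\<close>
lemma exists_multiple_in_RP:
  assumes b: "b \<in> K" "b \<noteq> (\<lambda>P. 0)"
  obtains b' c where "b' \<in> K" "c \<noteq> 0" "\<And>P. P \<noteq> pinf \<Longrightarrow> b P * b' P = poly c (x P)"
proof -
  define n where "n = pole_degree b"
  define E where "E = (\<Sum>i<r. e i)"
  define M where "M = n + E + 1"
  \<comment> \<open>The extra index \<open>r\<close> stands for the constant function \<open>1\<close>.\<close>
  define g where "g i = (if i < r then (\<lambda>P. b P * y i P) else (\<lambda>P. if P = pinf then 0 else 1))" for i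
  define F where "F = (\<lambda>(i, j). (\<lambda>P. xpoly C (monom 1 j) P * g i P))"
  define I where "I = {..r} \<times> {..<M}"
  obtain \<beta> where \<beta>: "\<beta> \<noteq> 0" "pole b n \<beta>" using pole_exists[OF b] unfolding n_def by blast
  have gK: "g i \<in> K" for i
    using carrier_mult[OF b(1) ybasis_carrier[of i]] carrier_one by (auto simp: g_def)
  have gp: "\<exists>m a. m \<le> n + E \<and> pole (g i) m a" for i
  proof (cases "i < r")
    case True
    obtain a where "pole (y i) (e i) a" using pole_ybasis[OF True] by blast
    from pole_mult[OF \<beta>(2) this] have "pole (g i) (n + e i) (\<beta> * a)" using True by (simp add: g_def)
    moreover have "e i \<le> E" unfolding E_def using True by (intro member_le_sum) auto
    ultimately show ?thesis by (intro exI[of _ "n + e i"] exI[of _ "\<beta> * a"]) simp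
  next
    case False
    have "pole (\<lambda>P. if P = pinf then 0 else 1) 0 1" by (rule pole_cong[OF pole_const[of 1]]) simp
    thus ?thesis using False by (intro exI[of _ 0] exI[of _ 1]) (simp add: g_def)
  qed
  have "\<exists>c. (\<exists>i\<in>I. c i \<noteq> 0) \<and> (\<forall>P. (\<Sum>i\<in>I. c i * F i P) = 0)"
  proof (rule linearly_dependent)
    show "finite I" by (simp add: I_def)
    show "r * M + n + E < card I" by (simp add: I_def M_def)
    fix ij assume "ij \<in> I"
    then obtain i j where ij: "ij = (i, j)" "j < M" by (auto simp: I_def)
    show "F ij \<in> K" unfolding F_def ij by (simp add: carrier_mult xpoly_carrier gK)
    obtain m a where m: "m \<le> n + E" "pole (g i) m a" using gp by blast
    have "monom (1::complex) j \<noteq> 0" by simp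
    from pole_mult[OF pole_poly[OF this] m(2)]
    have "pole (\<lambda>P. poly (monom 1 j) (x P) * g i P) (r * j + m) a" by (simp add: degree_monom_eq)
    hence "pole (F ij) (r * j + m) a"
      by (rule pole_cong) (simp add: F_def ij xpoly_eq)
    moreover have "r * j < r * M" using ij(2) r_pos by simp
    hence "r * j + m < r * M + n + E" using m(1) by linarith
    ultimately show "pole (F ij) (r * M + n + E) 0" by (rule pole_lower)
  qed
  then obtain c where c: "\<exists>i\<in>I. c i \<noteq> 0" "\<And>P. (\<Sum>i\<in>I. c i * F i P) = 0" by blast
  define q where "q i = (\<Sum>j<M. monom (c (i, j)) j)" for i
  have rel: "(\<Sum>i\<le>r. poly (q i) (x P) * g i P) = 0" if P: "P \<noteq> pinf" for P
  proof -
    have "(\<Sum>i\<le>r. poly (q i) (x P) * g i P) = (\<Sum>i\<le>r. \<Sum>j<M. c (i, j) * F (i, j) P)"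
      using P by (simp add: q_def poly_sum poly_monom sum_distrib_right F_def xpoly_eq mult.assoc)
    also have "\<dots> = (\<Sum>ij\<in>I. c ij * F ij P)" unfolding I_def by (simp add: sum.cartesian_product)
    finally show ?thesis using c(2) by simp
  qed
  define b' where "b' = (\<lambda>P. \<Sum>k<r. - xpoly C (q k) P * y k P)"
  have b'K: "b' \<in> K"
  proof -
    have "(\<lambda>P. \<Sum>k<r. (-1) * (xpoly C (q k) P * y k P)) \<in> K"
      by (intro carrier_sum carrier_scale carrier_mult xpoly_carrier ybasis_carrier)
    thus ?thesis by (simp add: b'_def)
  qed
  have bb': "b P * b' P = poly (q r) (x P)" if P: "P \<noteq> pinf" for P
  proof -
    have "(\<Sum>i\<le>r. poly (q i) (x P) * g i P) = (\<Sum>i<r. poly (q i) (x P) * g i P) + poly (q r) (x P)"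
      using P by (simp add: lessThan_Suc_atMost[symmetric] g_def)
    also have "(\<Sum>i<r. poly (q i) (x P) * g i P) = - (b P * b' P)"
      unfolding b'_def sum_distrib_left sum_negf[symmetric]
      by (intro sum.cong) (use P in \<open>auto simp: g_def xpoly_eq\<close>)
    finally show ?thesis using rel[OF P] by simp
  qed
  have "q r \<noteq> 0"
  proof
    assume q0: "q r = 0"
    hence "(\<lambda>P. b P * b' P) = (\<lambda>P. 0)"
      using bb' carrier_inf[OF b(1)] by (intro ext) (metis mult_zero_left poly_0)
    hence "b' = (\<lambda>P. 0)" using no_zero_divisors[OF b(1) b'K] b(2) by blast
    moreover have "(\<Sum>k<r. poly (- q k) (x P) * y k P) = b' P" if "P \<noteq> pinf" for P
      using that by (simp add: b'_def xpoly_eq)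
    ultimately have "(\<Sum>k<r. poly (- q k) (x P) * y k P) = 0" if "P \<noteq> pinf" for P
      using that by simp
    hence "- q k = 0" if "k < r" for k by (rule ybasis_independent[OF _ that])
    hence q: "q k = 0" if "k \<le> r" for k using that q0 by (cases "k = r") auto
    have "c (i, j) = 0" if "i \<le> r" "j < M" for i j
    proof -
      have "c (i, j) = coeff (q i) j" using that by (simp add: q_def coeff_sum)
      thus ?thesis using q that by simp
    qed
    thus False using c(1) by (auto simp: I_def)
  qed
  thus ?thesis using that[OF b'K _ bb'] by blast
qed

section \<open>Functions on the fibre product\<close>

lemma tens_eq: "(P, Q) \<in> fibre_product C \<Longrightarrow> tens C a b (P, Q) = a P * b Q"
  and tens_out: "w \<notin> fibre_product C \<Longrightarrow> tens C a b w = 0"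
  by (simp_all add: tens_def)

lemma fibre_productD:
  "(P, Q) \<in> fibre_product C \<Longrightarrow> P \<noteq> pinf \<and> Q \<noteq> pinf \<and> x P = x Q"
  by (simp add: fibre_product_def)

lemma root_of_unity_sum:
  assumes "i < r" "k < r" "i \<noteq> k"
  defines "\<zeta> \<equiv> exp (2 * of_real pi * \<i> / of_nat r)"
  shows "(\<Sum>m<r. (\<zeta> ^ e i / \<zeta> ^ e k) ^ m) = 0"
proof -
  define w where "w = \<zeta> ^ e i / \<zeta> ^ e k"
  have pow: "\<zeta> ^ n = exp (2 * of_real pi * \<i> * of_nat n / of_nat r)" for n
    unfolding \<zeta>_def exp_of_nat_mult[symmetric] by (simp add: mult_ac)
  have z: "\<zeta> \<noteq> 0" by (simp add: \<zeta>_def)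
  have "\<zeta> ^ r = 1" unfolding pow using r_pos by (simp add: exp_eq_1)
  hence "w ^ r = 1" using z by (simp add: w_def power_divide power_mult[symmetric] mult.commute[of _ r])
                    (simp add: power_mult)
  moreover have "w \<noteq> 1"
  proof
    assume "w = 1"
    hence "\<zeta> ^ e i = \<zeta> ^ e k" using z by (simp add: w_def)
    hence "e i mod r = e k mod r"
      unfolding pow using complex_root_unity_eq[of r "e i" "e k"] r_pos
      by (simp add: mult_ac One_nat_def)
    thus False using std_basis_distinct[of i k] assms by (simp add: Cong.cong_def)
  qed
  ultimately show ?thesis unfolding w_def[symmetric] by (simp add: sum_gp_strict)
qed

text \<open>Let \<open>m\<close> be the largest of the numbers \<open>ord a\<^sub>i + e\<^sub>i\<close>, attained at \<open>i\<^sub>0\<close>. Evaluating at the pairs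
  \<open>(pt(u), pt(\<zeta>\<^sup>j u))\<close>, multiplying by \<open>u\<^sup>m\<close> and letting \<open>u\<close> tend to \<open>0\<close> yields
  \<open>\<Sum> \<alpha>\<^sub>i \<beta>\<^sub>i \<zeta> ^ (- j e\<^sub>i) = 0\<close> for every \<open>j\<close>, where \<open>\<alpha>\<^sub>i\<close> and \<open>\<beta>\<^sub>i\<close> are the leading coefficients. Since the
  \<open>e\<^sub>i\<close> are incongruent modulo \<open>r\<close>, orthogonality of characters isolates the nonzero term
  \<open>\<alpha>\<^sub>i \<beta>\<^sub>i\<close> with \<open>i = i\<^sub>0\<close>.\<close>
lemma tensor_independent:
  assumes aK: "\<And>i. i < r \<Longrightarrow> a i \<in> K"
    and zero: "\<And>P Q. (P, Q) \<in> fibre_product C \<Longrightarrow> (\<Sum>i<r. a i P * y i Q) = 0"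
    and k: "k < r"
  shows "a k = (\<lambda>P. 0)"
proof (rule ccontr)
  assume ak: "a k \<noteq> (\<lambda>P. 0)"
  define S where "S = {i. i < r \<and> a i \<noteq> (\<lambda>P. 0)}"
  define N where "N i = pole_degree (a i) + e i" for i
  have S: "finite S" "S \<noteq> {}" using k ak by (auto simp: S_def)
  define m where "m = Max (N ` S)"
  have "m \<in> N ` S" unfolding m_def using S by simp
  then obtain i0 where i0: "i0 \<in> S" "N i0 = m" by auto
  have max: "N i \<le> m" if "i \<in> S" for i using that S by (simp add: m_def)
  have "\<exists>\<alpha>. (i = i0 \<longrightarrow> \<alpha> \<noteq> 0) \<and> pole (a i) (m - e i) \<alpha> \<and> (e i \<le> m \<or> a i = (\<lambda>P. 0))" if i: "i < r" for i
  proof (cases "i \<in> S")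
    case True
    hence nz: "a i \<noteq> (\<lambda>P. 0)" by (simp add: S_def)
    obtain \<alpha> where \<alpha>: "\<alpha> \<noteq> 0" "pole (a i) (pole_degree (a i)) \<alpha>"
      using pole_exists[OF aK[OF i] nz] by blast
    show ?thesis
    proof (cases "N i = m")
      case True
      hence "pole_degree (a i) = m - e i" "e i \<le> m" by (auto simp: N_def)
      thus ?thesis using \<alpha> by auto
    next
      case False
      hence "N i < m" using max[OF True] by simp
      hence "pole_degree (a i) < m - e i" "e i \<le> m" by (auto simp: N_def)
      thus ?thesis using pole_lower[OF \<alpha>(2)] False i0(2) by auto
    qed
  next
    case False
    hence "a i = (\<lambda>P. 0)" "i \<noteq> i0" using i i0 by (auto simp: S_def)
    thus ?thesis using pole_zero by auto
  qed
  then obtain \<alpha> where \<alpha>: "\<And>i. i < r \<Longrightarrow> (i = i0 \<longrightarrow> \<alpha> i \<noteq> 0) \<and> pole (a i) (m - e i) (\<alpha> i) \<and>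
      (e i \<le> m \<or> a i = (\<lambda>P. 0))" by metis
  have i0r: "i0 < r" using i0 by (simp add: S_def)
  obtain \<beta> where \<beta>: "\<And>i. i < r \<Longrightarrow> \<beta> i \<noteq> 0 \<and> pole (y i) (e i) (\<beta> i)" using pole_ybasis by metis
  define \<zeta> where "\<zeta> = exp (2 * of_real pi * \<i> / of_nat r)"
  have z: "\<zeta> \<noteq> 0" by (simp add: \<zeta>_def)
  have zr: "\<zeta> ^ r = 1"
    unfolding \<zeta>_def exp_of_nat_mult[symmetric] using r_pos by (simp add: exp_eq_1)
  have eq: "(\<Sum>i<r. \<alpha> i * \<beta> i / (\<zeta> ^ j) ^ e i) = 0" for j
  proof -
    define \<xi> where "\<xi> = \<zeta> ^ j"
    have \<xi>: "\<xi> \<noteq> 0" "\<xi> ^ r = 1"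
      using z zr by (simp_all add: \<xi>_def power_mult[symmetric] mult.commute[of j] )
        (simp add: power_mult)
    have rot: "filterlim (\<lambda>u. \<xi> * u) (at 0) (at 0)"
      unfolding filterlim_at
    proof
      have "((\<lambda>u. \<xi> * u) \<longlongrightarrow> \<xi> * 0) (at 0)" by (intro tendsto_intros)
      thus "((\<lambda>u. \<xi> * u) \<longlongrightarrow> 0) (at 0)" by simp
      show "\<forall>\<^sub>F u in at 0. \<xi> * u \<in> UNIV \<and> \<xi> * u \<noteq> 0"
        using eventually_neq_at_within[of 0 0 UNIV] by eventually_elim (use \<xi> in simp)
    qed
    have fib: "eventually (\<lambda>u. (pt u, pt (\<xi> * u)) \<in> fibre_product C \<and> u \<noteq> 0) (at 0)"
      using pt_neq_inf eventually_compose_filterlim[OF pt_neq_inf rot] pt_x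
        eventually_compose_filterlim[OF pt_x rot] eventually_neq_at_within[of 0 0 UNIV]
    proof eventually_elim
      case (elim u)
      have "x (pt u) * u ^ r = x (pt (\<xi> * u)) * u ^ r"
        using elim(3,4) \<xi>(2) by (simp add: power_mult_distrib)
      hence "x (pt u) = x (pt (\<xi> * u))" using elim(5) by simp
      thus ?case using elim by (simp add: fibre_product_def)
    qed
    have "((\<lambda>u. (a i (pt u) * u ^ (m - e i)) * (y i (pt (\<xi> * u)) * (\<xi> * u) ^ e i) / \<xi> ^ e i)
            \<longlongrightarrow> \<alpha> i * \<beta> i / \<xi> ^ e i) (at 0)" if i: "i < r" for i
    proof -
      have "((\<lambda>u. y i (pt u) * u ^ e i) \<longlongrightarrow> \<beta> i) (at 0)" using \<beta>[OF i] by (simp add: pole_def)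
      hence "((\<lambda>u. y i (pt (\<xi> * u)) * (\<xi> * u) ^ e i) \<longlongrightarrow> \<beta> i) (at 0)"
        by (rule filterlim_compose) (rule rot)
      moreover have "((\<lambda>u. a i (pt u) * u ^ (m - e i)) \<longlongrightarrow> \<alpha> i) (at 0)" using \<alpha>[OF i] by (simp add: pole_def)
      ultimately show ?thesis using \<xi>(1) by (intro tendsto_intros) auto
    qed
    hence "((\<lambda>u. \<Sum>i<r. (a i (pt u) * u ^ (m - e i)) * (y i (pt (\<xi> * u)) * (\<xi> * u) ^ e i) / \<xi> ^ e i)
            \<longlongrightarrow> (\<Sum>i<r. \<alpha> i * \<beta> i / \<xi> ^ e i)) (at 0)"
      by (intro tendsto_sum) auto
    moreover have "eventually (\<lambda>u. (\<Sum>i<r. (a i (pt u) * u ^ (m - e i)) *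
        (y i (pt (\<xi> * u)) * (\<xi> * u) ^ e i) / \<xi> ^ e i) = 0) (at 0)"
      using fib
    proof eventually_elim
      case (elim u)
      have "(a i (pt u) * u ^ (m - e i)) * (y i (pt (\<xi> * u)) * (\<xi> * u) ^ e i) / \<xi> ^ e i =
          u ^ m * (a i (pt u) * y i (pt (\<xi> * u)))" if i: "i < r" for i
      proof (cases "a i = (\<lambda>P. 0)")
        case False
        hence "u ^ m = u ^ (m - e i) * u ^ e i"
          using \<alpha>[OF i] by (simp add: power_add[symmetric])
        thus ?thesis using \<xi>(1) by (simp add: power_mult_distrib)
      qed simp
      hence "(\<Sum>i<r. (a i (pt u) * u ^ (m - e i)) * (y i (pt (\<xi> * u)) * (\<xi> * u) ^ e i) / \<xi> ^ e i) =
          u ^ m * (\<Sum>i<r. a i (pt u) * y i (pt (\<xi> * u)))"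
        unfolding sum_distrib_left by (intro sum.cong) auto
      thus ?case using zero elim by simp
    qed
    hence "((\<lambda>u. \<Sum>i<r. (a i (pt u) * u ^ (m - e i)) * (y i (pt (\<xi> * u)) * (\<xi> * u) ^ e i) / \<xi> ^ e i)
            \<longlongrightarrow> 0) (at 0)" by (rule tendsto_eventually)
    ultimately show ?thesis unfolding \<xi>_def[symmetric] by (intro tendsto_unique[OF _ _ \<open>(_ \<longlongrightarrow> 0) _\<close>]) auto
  qed
  have "0 = (\<Sum>j<r. (\<zeta> ^ j) ^ e i0 * (\<Sum>i<r. \<alpha> i * \<beta> i / (\<zeta> ^ j) ^ e i))"
    by (simp add: eq)
  also have "\<dots> = (\<Sum>i<r. \<Sum>j<r. (\<zeta> ^ j) ^ e i0 * (\<alpha> i * \<beta> i / (\<zeta> ^ j) ^ e i))"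
    unfolding sum_distrib_left by (rule sum.swap)
  also have "\<dots> = (\<Sum>i<r. \<alpha> i * \<beta> i * (\<Sum>j<r. (\<zeta> ^ e i0 / \<zeta> ^ e i) ^ j))"
    unfolding sum_distrib_left
    by (intro sum.cong) (simp_all add: power_divide power_mult[symmetric] mult.commute)
  also have "\<dots> = (\<Sum>i<r. if i = i0 then \<alpha> i * \<beta> i * of_nat r else 0)"
    using root_of_unity_sum[of i0] i0r z unfolding \<zeta>_def[symmetric]
    by (intro sum.cong) auto
  also have "\<dots> = \<alpha> i0 * \<beta> i0 * of_nat r" using i0r by simp
  finally show False using \<alpha>[OF i0r] \<beta>[OF i0r] r_pos by simp
qed

lemma TX_simps [simp]:
  "F \<otimes>\<^bsub>TX C\<^esub> G = (\<lambda>w. F w * G w)" "F \<oplus>\<^bsub>TX C\<^esub> G = (\<lambda>w. F w + G w)"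
  "\<zero>\<^bsub>TX C\<^esub> = (\<lambda>w. 0)" "\<one>\<^bsub>TX C\<^esub> = (\<lambda>w. if w \<in> fibre_product C then 1 else 0)"
  by (simp_all add: TX_def)

text \<open>Expanding the second factors in the basis and moving the coefficients in \<open>\<complex>[x]\<close> to the first
  factor brings every tensor into the form \<open>\<Sum> A\<^sub>i \<otimes> y\<^sub>i\<close>.\<close>
lemma TX_sum_tensI:
  assumes "finite I" "\<And>k. k \<in> I \<Longrightarrow> a k \<in> K" "\<And>k. k \<in> I \<Longrightarrow> b k \<in> K"
  shows "(\<lambda>w. \<Sum>k\<in>I. tens C (a k) (b k) w) \<in> carrier (TX C)"
    and "\<exists>A. (\<forall>i<r. A i \<in> K) \<and>
      (\<lambda>w. \<Sum>k\<in>I. tens C (a k) (b k) w) = (\<lambda>w. \<Sum>i<r. tens C (A i) (y i) w)"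
proof -
  define A where "A i = (\<lambda>P. \<Sum>k\<in>I. a k P * xpoly C (coord (b k) i) P)" for i
  have AK: "A i \<in> K" for i
    unfolding A_def by (intro carrier_sum carrier_mult assms xpoly_carrier)
  have "(\<Sum>k\<in>I. tens C (a k) (b k) w) = (\<Sum>i<r. tens C (A i) (y i) w)" for w
  proof (cases "w \<in> fibre_product C")
    case True
    obtain P Q where w: "w = (P, Q)" by (cases w)
    have PQ: "P \<noteq> pinf" "Q \<noteq> pinf" "x P = x Q" using fibre_productD True w by auto
    have "(\<Sum>k\<in>I. tens C (a k) (b k) w) =
        (\<Sum>k\<in>I. \<Sum>i<r. a k P * poly (coord (b k) i) (x P) * y i Q)"
      using True by (intro sum.cong)
        (simp_all add: w tens_eq coord_expand[OF assms(3) PQ(2)] PQ(3) sum_distrib_left mult.assoc)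
    also have "\<dots> = (\<Sum>i<r. \<Sum>k\<in>I. a k P * poly (coord (b k) i) (x P) * y i Q)"
      by (rule sum.swap)
    also have "\<dots> = (\<Sum>i<r. tens C (A i) (y i) w)"
      using True PQ by (simp add: w tens_eq A_def xpoly_eq sum_distrib_right)
    finally show ?thesis .
  qed (simp add: tens_out)
  hence eq: "(\<lambda>w. \<Sum>k\<in>I. tens C (a k) (b k) w) = (\<lambda>w. \<Sum>i<r. tens C (A i) (y i) w)" by blast
  thus "\<exists>A. (\<forall>i<r. A i \<in> K) \<and>
      (\<lambda>w. \<Sum>k\<in>I. tens C (a k) (b k) w) = (\<lambda>w. \<Sum>i<r. tens C (A i) (y i) w)"
    using AK by blast
  show "(\<lambda>w. \<Sum>k\<in>I. tens C (a k) (b k) w) \<in> carrier (TX C)"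
    unfolding eq TX_def partial_object.simps mem_Collect_eq
    by (intro exI[of _ r] exI[of _ A] exI[of _ "ybasis C"] conjI allI impI AK ybasis_carrier refl)
qed

lemma TX_normal_form:
  assumes "F \<in> carrier (TX C)"
  obtains A where "\<And>i. i < r \<Longrightarrow> A i \<in> K" "F = (\<lambda>w. \<Sum>i<r. tens C (A i) (y i) w)"
proof -
  obtain n :: nat and a b where ab: "\<forall>k<n. a k \<in> K \<and> b k \<in> K" "F = (\<lambda>w. \<Sum>k<n. tens C (a k) (b k) w)"
    using assms unfolding TX_def by auto
  have "\<exists>A. (\<forall>i<r. A i \<in> K) \<and>
      (\<lambda>w. \<Sum>k<n. tens C (a k) (b k) w) = (\<lambda>w. \<Sum>i<r. tens C (A i) (y i) w)"
    by (rule TX_sum_tensI(2)) (use ab(1) in auto)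
  thus ?thesis using that ab(2) by auto
qed

lemma tens_carrier: "a \<in> K \<Longrightarrow> b \<in> K \<Longrightarrow> tens C a b \<in> carrier (TX C)"
  using TX_sum_tensI(1)[of "{0::nat}" "\<lambda>_. a" "\<lambda>_. b"] by simp

lemma TX_add_closed:
  assumes "F \<in> carrier (TX C)" "G \<in> carrier (TX C)"
  shows "(\<lambda>w. F w + G w) \<in> carrier (TX C)"
proof -
  obtain A where A: "\<And>i. i < r \<Longrightarrow> A i \<in> K" "F = (\<lambda>w. \<Sum>i<r. tens C (A i) (y i) w)"
    using assms(1) by (rule TX_normal_form) (rule that)
  obtain B where B: "\<And>i. i < r \<Longrightarrow> B i \<in> K" "G = (\<lambda>w. \<Sum>i<r. tens C (B i) (y i) w)"
    using assms(2) by (rule TX_normal_form) (rule that)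
  have "(\<lambda>w. \<Sum>i<r. tens C (\<lambda>P. A i P + B i P) (y i) w) \<in> carrier (TX C)"
    by (intro TX_sum_tensI(1)) (use A(1) B(1) ybasis_carrier in \<open>auto intro: carrier_add\<close>)
  moreover have "(\<lambda>w. F w + G w) = (\<lambda>w. \<Sum>i<r. tens C (\<lambda>P. A i P + B i P) (y i) w)"
    unfolding A(2) B(2) sum.distrib[symmetric]
    by (intro ext sum.cong) (auto simp: tens_def algebra_simps)
  ultimately show ?thesis by simp
qed

lemma TX_mult_closed:
  assumes "F \<in> carrier (TX C)" "G \<in> carrier (TX C)"
  shows "(\<lambda>w. F w * G w) \<in> carrier (TX C)"
proof -
  obtain A where A: "\<And>i. i < r \<Longrightarrow> A i \<in> K" "F = (\<lambda>w. \<Sum>i<r. tens C (A i) (y i) w)"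
    using assms(1) by (rule TX_normal_form) (rule that)
  obtain B where B: "\<And>i. i < r \<Longrightarrow> B i \<in> K" "G = (\<lambda>w. \<Sum>i<r. tens C (B i) (y i) w)"
    using assms(2) by (rule TX_normal_form) (rule that)
  have "(\<lambda>w. \<Sum>ij\<in>{..<r} \<times> {..<r}. tens C (\<lambda>P. A (fst ij) P * B (snd ij) P)
      (\<lambda>P. y (fst ij) P * y (snd ij) P) w) \<in> carrier (TX C)"
    by (intro TX_sum_tensI(1)) (use A(1) B(1) ybasis_carrier in \<open>auto intro: carrier_mult\<close>)
  moreover have "(\<lambda>w. F w * G w) = (\<lambda>w. \<Sum>ij\<in>{..<r} \<times> {..<r}. tens C (\<lambda>P. A (fst ij) P * B (snd ij) P)
      (\<lambda>P. y (fst ij) P * y (snd ij) P) w)"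
    unfolding A(2) B(2) sum_product sum.cartesian_product
    by (intro ext sum.cong) (auto simp: tens_def algebra_simps)
  ultimately show ?thesis by simp
qed

lemma TX_vanish: "F \<in> carrier (TX C) \<Longrightarrow> w \<notin> fibre_product C \<Longrightarrow> F w = 0"
  by (elim TX_normal_form) (simp add: tens_out)

lemma TX_one_eq: "\<one>\<^bsub>TX C\<^esub> = tens C \<one>\<^bsub>RX C\<^esub> \<one>\<^bsub>RX C\<^esub>"
proof
  fix w
  show "\<one>\<^bsub>TX C\<^esub> w = tens C \<one>\<^bsub>RX C\<^esub> \<one>\<^bsub>RX C\<^esub> w"
    using fibre_productD[of "fst w" "snd w"] by (simp add: tens_def)
qed

lemma TX_uminus:
  assumes "F \<in> carrier (TX C)"
  shows "(\<lambda>w. - F w) \<in> carrier (TX C)"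
proof -
  have "tens C (\<lambda>P. (-1) * \<one>\<^bsub>RX C\<^esub> P) \<one>\<^bsub>RX C\<^esub> \<in> carrier (TX C)"
    by (intro tens_carrier carrier_scale RX.one_closed)
  from TX_mult_closed[OF this assms] show ?thesis
    by (rule back_subst[of "\<lambda>F. F \<in> carrier (TX C)"])
       (use TX_vanish[OF assms] fibre_productD in \<open>fastforce simp: tens_def fun_eq_iff\<close>)
qed

lemma cring_TX: "cring (TX C)"
proof (rule cringI)
  have one: "\<one>\<^bsub>TX C\<^esub> \<in> carrier (TX C)"
    unfolding TX_one_eq by (intro tens_carrier RX.one_closed)
  have zero: "\<zero>\<^bsub>TX C\<^esub> \<in> carrier (TX C)"
    using TX_sum_tensI(1)[of "{} :: nat set"] by simp
  show "abelian_group (TX C)"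
  proof (rule abelian_groupI)
    fix F assume F: "F \<in> carrier (TX C)"
    show "\<exists>G\<in>carrier (TX C). G \<oplus>\<^bsub>TX C\<^esub> F = \<zero>\<^bsub>TX C\<^esub>"
      using TX_uminus[OF F] by (intro bexI[of _ "\<lambda>w. - F w"]) auto
  qed (use zero TX_add_closed in \<open>auto simp: algebra_simps\<close>)
  show "comm_monoid (TX C)"
  proof (rule comm_monoidI)
    show "\<one>\<^bsub>TX C\<^esub> \<in> carrier (TX C)" by (rule one)
    fix F assume F: "F \<in> carrier (TX C)"
    show "\<one>\<^bsub>TX C\<^esub> \<otimes>\<^bsub>TX C\<^esub> F = F" using TX_vanish[OF F] by (auto simp: fun_eq_iff)
  qed (use TX_mult_closed in \<open>auto simp: algebra_simps\<close>)
qed (auto simp: algebra_simps)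

sublocale TX: cring "TX C" by (rule cring_TX)

lemma TX_finprod:
  assumes "finite J" "\<And>j. j \<in> J \<Longrightarrow> g j \<in> carrier (TX C)" "w \<in> fibre_product C"
  shows "(\<Otimes>\<^bsub>TX C\<^esub>j\<in>J. g j) w = (\<Prod>j\<in>J. g j w)"
  using assms(1,2)
proof (induction J)
  case (insert j J)
  thus ?case by (subst TX.finprod_insert) auto
qed (use assms(3) in simp)

text \<open>Multiplication by \<open>b \<otimes> 1\<close> acts on the coefficients \<open>A\<^sub>i\<close> of \<open>\<Sum> A\<^sub>i \<otimes> y\<^sub>i\<close> separately, and these lie
  in a domain.\<close>
lemma tens_regular:
  assumes b: "b \<in> K" "b \<noteq> (\<lambda>P. 0)"
  shows "tens C b \<one>\<^bsub>RX C\<^esub> \<in> regular_elements (TX C)"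
  unfolding regular_elements_def
proof (intro CollectI conjI ballI impI)
  show "tens C b \<one>\<^bsub>RX C\<^esub> \<in> carrier (TX C)" by (intro tens_carrier b(1) RX.one_closed)
  fix F assume F: "F \<in> carrier (TX C)" and z: "F \<otimes>\<^bsub>TX C\<^esub> tens C b \<one>\<^bsub>RX C\<^esub> = \<zero>\<^bsub>TX C\<^esub>"
  obtain A where A: "\<And>i. i < r \<Longrightarrow> A i \<in> K" "F = (\<lambda>w. \<Sum>i<r. tens C (A i) (y i) w)"
    using F by (rule TX_normal_form) (rule that)
  have "A i = (\<lambda>P. 0)" if i: "i < r" for i
  proof -
    have "(\<lambda>P. A i P * b P) = (\<lambda>P. 0)"
    proof (rule tensor_independent[of "\<lambda>i P. A i P * b P", OF _ _ i])
      fix P Q assume PQ: "(P, Q) \<in> fibre_product C"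
      have "(\<Sum>i<r. A i P * b P * y i Q) = F (P, Q) * tens C b \<one>\<^bsub>RX C\<^esub> (P, Q)"
        using fibre_productD[OF PQ]
        by (simp add: A(2) tens_eq[OF PQ] sum_distrib_left sum_distrib_right mult_ac)
      also have "\<dots> = 0" using fun_cong[OF z, of "(P, Q)"] by simp
      finally show "(\<Sum>i<r. A i P * b P * y i Q) = 0" .
    qed (use A(1) b in \<open>auto intro: carrier_mult\<close>)
    thus ?thesis using no_zero_divisors[OF A(1)[OF i] b(1)] b(2) by blast
  qed
  thus "F = \<zero>\<^bsub>TX C\<^esub>" by (auto simp: A(2) tens_def fun_eq_iff intro!: sum.neutral)
qed

end

section \<open>Minimal polynomials and divided differences\<close>

lemma poly_at_x: "poly (at_x f c) v = poly (poly f [:v:]) c"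
  by (induction f) (simp_all add: at_x_def map_poly_pCons)

lemma at_x_pCons: "at_x (pCons a f) c = pCons (poly a c) (at_x f c)"
  by (simp add: at_x_def map_poly_pCons)

context uniformized_weierstrass
begin

sublocale QX: cring "QX C" by (rule RX.cring_total_quotient_ring)

text \<open>Let \<open>g\<^sub>0\<close> have least degree among the nonzero polynomials that vanish at \<open>v\<close>. Pseudo-division shows that
  \<open>g\<^sub>0\<close> divides \<open>c f\<close> for some nonzero \<open>c\<close> in \<open>\<complex>[x]\<close>. Since \<open>f\<close> is prime, either \<open>f\<close> divides \<open>g\<^sub>0\<close>, or
  \<open>g\<^sub>0\<close> divides \<open>c\<close> and would be a nonzero polynomial in \<open>x\<close> alone that vanishes on the curve.\<close>
lemma irreducible_minimal_degree:
  fixes f g :: "complex poly poly"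
  assumes f: "Factorial_Ring.irreducible f" "lead_coeff f = 1"
    and fg: "\<And>P. P \<noteq> pinf \<Longrightarrow> poly (at_x f (x P)) (v P) = 0"
      "\<And>P. P \<noteq> pinf \<Longrightarrow> poly (at_x g (x P)) (v P) = 0"
    and g: "g \<noteq> 0"
  shows "degree f \<le> degree g"
proof -
  let ?Z = "\<lambda>g. g \<noteq> 0 \<and> (\<forall>P. P \<noteq> pinf \<longrightarrow> poly (at_x g (x P)) (v P) = 0)"
  define g0 where "g0 = (ARG_MIN degree g. ?Z g)"
  have "?Z g" using fg g by blast
  hence g0: "?Z g0" unfolding g0_def by (rule arg_min_natI)
  have min: "degree g0 \<le> degree g" if "?Z g" for g
    unfolding g0_def using that by (rule arg_min_nat_le)
  obtain q s where qs: "pseudo_divmod f g0 = (q, s)" by (cases "pseudo_divmod f g0")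
  define c where "c = Polynomial.smult (coeff g0 (degree g0) ^ (Suc (degree f) - degree g0)) (1 :: complex poly poly)"
  have g0n: "g0 \<noteq> 0" using g0 by blast
  have div: "c * f = g0 * q + s" and s: "s = 0 \<or> degree s < degree g0"
    using pseudo_divmod[OF g0n qs] by (simp_all add: c_def)
  have "poly (at_x s (x P)) (v P) = 0" if "P \<noteq> pinf" for P
  proof -
    have "s = c * f - g0 * q" using div by simp
    thus ?thesis using fg(1)[OF that] g0 that by (simp add: poly_at_x)
  qed
  hence "s = 0" using s min[of s] by (cases "s = 0") auto
  hence fq: "c * f = g0 * q" using div by simp
  have c0: "c \<noteq> 0" "degree c = 0" using g0n by (simp_all add: c_def)
  have "prime_elem f" using f(1) by (simp add: prime_elem_iff_irreducible)
  moreover have "f dvd g0 * q" unfolding fq[symmetric] by simp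
  ultimately consider "f dvd g0" | "f dvd q" by (auto simp: prime_elem_dvd_mult_iff)
  thus ?thesis
  proof cases
    case 1
    hence "degree f \<le> degree g0" using g0n by (rule dvd_imp_degree_le)
    thus ?thesis using min[of g] \<open>?Z g\<close> by simp
  next
    case 2
    then obtain q' where "q = f * q'" by (auto elim: dvdE)
    moreover have "f \<noteq> 0" using f(2) by auto
    ultimately have "c = g0 * q'" using fq by (simp add: mult_ac)
    hence "degree g0 = 0" using c0 by (metis degree_mult_eq mult_eq_0_iff add_is_0)
    then obtain p where p: "g0 = [:p:]" by (rule degree_eq_zeroE)
    have "p = 0"
      by (rule x_transcendental) (use g0 in \<open>simp add: p poly_at_x\<close>)
    thus ?thesis using p g0n by simp
  qed
qed

lemma min_poly_derivative_nonzero: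
  assumes f: "Factorial_Ring.irreducible f" "lead_coeff f = 1"
    and zero: "\<And>P. P \<noteq> pinf \<Longrightarrow> poly (at_x f (x P)) (v P) = 0"
  shows "\<exists>P. P \<noteq> pinf \<and> poly (at_x (pderiv f) (x P)) (v P) \<noteq> 0"
proof (rule ccontr)
  assume *: "\<not> ?thesis"
  have "degree f \<noteq> 0"
  proof
    assume "degree f = 0"
    hence "f = 1" using f(2) by (auto elim!: degree_eq_zeroE simp: one_pCons)
    thus False using f(1) by (simp add: irreducible_def)
  qed
  hence "pderiv f \<noteq> 0" "degree (pderiv f) < degree f"
    by (simp_all add: pderiv_eq_0_iff degree_pderiv)
  thus False using irreducible_minimal_degree[OF f zero, of "pderiv f"] * by force
qed

lemma regular_away_at_x: "v \<in> K \<Longrightarrow> regular_away (\<lambda>P. poly (at_x f (x P)) (v P))"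
  by (induction f)
     (simp_all add: at_x_def map_poly_pCons regular_away_const regular_away_add regular_away_mult
        regular_away_poly carrier_regular x_carrier)

text \<open>Horner's scheme expresses the divided difference of \<open>a + y f\<close> through that of \<open>f\<close>.\<close>
lemma divided_difference_carrier:
  assumes j: "j \<in> {2..w_num C}"
  shows "divided_difference C f j \<in> carrier (TX C)"
proof (induction f)
  case 0
  have "divided_difference C 0 j = \<zero>\<^bsub>TX C\<^esub>"
    by (auto simp: divided_difference_def at_x_def)
  thus ?case using TX.zero_closed by (simp only:)
next
  case (pCons a f)
  define g where "g = cut (\<lambda>P. poly (at_x f (x P)) (w_y C j P))"
  have gK: "g \<in> K" unfolding g_def by (intro cut_carrier regular_away_at_x y_carrier j)
  have "divided_difference C (pCons a f) j =
      (\<lambda>w. tens C \<one>\<^bsub>RX C\<^esub> g w + tens C (w_y C j) \<one>\<^bsub>RX C\<^esub> w * divided_difference C f j w)"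
  proof
    fix w :: "'a \<times> 'a"
    obtain P Q where w: "w = (P, Q)" by (cases w)
    show "divided_difference C (pCons a f) j w =
      tens C \<one>\<^bsub>RX C\<^esub> g w + tens C (w_y C j) \<one>\<^bsub>RX C\<^esub> w * divided_difference C f j w"
      using fibre_productD[of P Q]
      by (cases "w \<in> fibre_product C")
         (simp_all add: w divided_difference_def tens_def at_x_pCons synthetic_div_pCons g_def cut_def)
  qed
  moreover have "\<dots> \<in> carrier (TX C)"
    by (intro TX_add_closed TX_mult_closed tens_carrier RX.one_closed gK y_carrier j pCons.IH)
  ultimately show ?case by simp
qed

text \<open>The derivative of the minimal polynomial has smaller degree, so it does not vanish at \<open>y\<^sub>j\<close>.\<close>
lemma partial_y_regular:
  assumes j: "j \<in> {2..w_num C}" and f: "is_min_poly C j f"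
  shows "partial_y C f j \<in> regular_elements (TX C)"
proof -
  define g where "g = cut (\<lambda>P. poly (at_x (pderiv f) (x P)) (w_y C j P))"
  have gK: "g \<in> K" unfolding g_def by (intro cut_carrier regular_away_at_x y_carrier j)
  have "\<exists>P. P \<noteq> pinf \<and> poly (at_x (pderiv f) (x P)) (w_y C j P) \<noteq> 0"
    by (rule min_poly_derivative_nonzero) (use f in \<open>auto simp: is_min_poly_def\<close>)
  hence "g \<noteq> (\<lambda>P. 0)" by (auto simp: g_def cut_def fun_eq_iff)
  moreover have "partial_y C f j = tens C g \<one>\<^bsub>RX C\<^esub>"
  proof
    fix w :: "'a \<times> 'a"
    obtain P Q where w: "w = (P, Q)" by (cases w)
    show "partial_y C f j w = tens C g \<one>\<^bsub>RX C\<^esub> w"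
      using fibre_productD[of P Q] by (simp add: w partial_y_def tens_def g_def cut_def)
  qed
  ultimately show ?thesis using tens_regular[OF gK] by simp
qed

section \<open>The trace\<close>

definition trace_poly :: "('a \<Rightarrow> complex) \<Rightarrow> complex poly" where
  "trace_poly a = (\<Sum>j<r. coord (\<lambda>P. a P * y j P) j)"

lemma trace_poly_combination:
  assumes f: "f \<in> K" and g: "\<And>i. i \<in> I \<Longrightarrow> g i \<in> K"
    and fg: "\<And>P. P \<noteq> pinf \<Longrightarrow> f P = (\<Sum>i\<in>I. poly (q i) (x P) * g i P)"
  shows "trace_poly f = (\<Sum>i\<in>I. q i * trace_poly (g i))"
proof -
  have "coord (\<lambda>P. f P * y j P) j = (\<Sum>i\<in>I. q i * coord (\<lambda>P. g i P * y j P) j)" if "j < r" for j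
    by (rule coord_combination[OF _ _ _ that])
       (use fg in \<open>auto simp: sum_distrib_right mult.assoc intro: carrier_mult f g ybasis_carrier\<close>)
  hence "trace_poly f = (\<Sum>j<r. \<Sum>i\<in>I. q i * coord (\<lambda>P. g i P * y j P) j)" by (simp add: trace_poly_def)
  also have "\<dots> = (\<Sum>i\<in>I. q i * trace_poly (g i))"
    unfolding trace_poly_def sum_distrib_left by (rule sum.swap)
  finally show ?thesis .
qed

lemma xpoly_regular: "c \<noteq> 0 \<Longrightarrow> xpoly C c \<in> regular_elements (RX C)"
  using xpoly_zero_iff xpoly_carrier by (simp add: regular_elements_RX)

lemma fraction_eq_pointwise:
  assumes "a \<in> K" "c \<in> K" "b \<in> regular_elements (RX C)" "d \<in> regular_elements (RX C)"
  shows "fraction (RX C) a b = fraction (RX C) c d \<longleftrightarrow> (\<forall>P. P \<noteq> pinf \<longrightarrow> a P * d P = c P * b P)"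
  unfolding RX.fraction_eq_iff[OF assms] RX_simps
  unfolding fun_eq_iff using carrier_inf[OF assms(1)] carrier_inf[OF assms(2)] by (metis mult_zero_left)

lemma fraction_mult_to_QX:
  assumes "a \<in> K" "b \<in> regular_elements (RX C)" "c \<in> K"
  shows "fraction (RX C) a b \<otimes>\<^bsub>QX C\<^esub> to_QX C c = fraction (RX C) (\<lambda>P. a P * c P) b"
proof -
  have "b \<otimes>\<^bsub>RX C\<^esub> \<one>\<^bsub>RX C\<^esub> = b" using RX.regular_closed[OF assms(2)] by (rule RX.r_one)
  thus ?thesis
    unfolding to_QX_def
    by (subst RX.mult_fraction[OF assms(1,2,3) RX.regular_one]) (simp only: RX_simps)
qed

text \<open>The matrix of multiplication by \<open>a\<close> with entries divided by \<open>c\<close> represents \<open>a / c\<close>. For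
  uniqueness, any other matrix over the quotient field of \<open>\<complex>[x]\<close> is given a common denominator, and
  its numerators are compared with the coordinates in the free module \<open>R\<^sub>X\<close>.\<close>
lemma trace_X_fraction:
  assumes a: "a \<in> K" and c: "c \<noteq> 0"
  shows "trace_X C (fraction (RX C) a (xpoly C c)) = fraction (RX C) (xpoly C (trace_poly a)) (xpoly C c)"
  unfolding trace_X_def
proof (rule the_equality)
  note creg = xpoly_regular[OF c]
  have ayK: "(\<lambda>P. a P * y j P) \<in> K" for j by (intro carrier_mult a ybasis_carrier)
  have xyK: "(\<lambda>P. xpoly C p P * y j P) \<in> K" for p j by (intro carrier_mult xpoly_carrier ybasis_carrier)
  \<comment> \<open>Linear combinations of the basis with a common denominator.\<close>
  have comb: "(\<Oplus>\<^bsub>QX C\<^esub>i\<in>{..<r}. fraction (RX C) (xpoly C (m i)) (xpoly C d) \<otimes>\<^bsub>QX C\<^esub> to_QX C (y i)) =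
      fraction (RX C) (\<lambda>P. \<Sum>i<r. xpoly C (m i) P * y i P) (xpoly C d)" if d: "d \<noteq> 0" for m d
  proof -
    have "(\<Oplus>\<^bsub>QX C\<^esub>i\<in>{..<r}. fraction (RX C) (xpoly C (m i)) (xpoly C d) \<otimes>\<^bsub>QX C\<^esub> to_QX C (y i)) =
        (\<Oplus>\<^bsub>QX C\<^esub>i\<in>{..<r}. fraction (RX C) (\<lambda>P. xpoly C (m i) P * y i P) (xpoly C d))"
      using xyK by (intro QX.finsum_cong')
        (auto simp: fraction_mult_to_QX xpoly_carrier xpoly_regular d ybasis_carrier RX.fraction_in_carrier)
    also have "\<dots> = fraction (RX C) (\<Oplus>\<^bsub>RX C\<^esub>i\<in>{..<r}. (\<lambda>P. xpoly C (m i) P * y i P)) (xpoly C d)"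
      using xyK by (intro RX.finsum_fraction xpoly_regular d) auto
    also have "(\<Oplus>\<^bsub>RX C\<^esub>i\<in>{..<r}. (\<lambda>P. xpoly C (m i) P * y i P)) =
        (\<lambda>P. \<Sum>i<r. xpoly C (m i) P * y i P)" using xyK by (intro RX_finsum)
    finally show ?thesis .
  qed
  have diag: "(\<Oplus>\<^bsub>QX C\<^esub>i\<in>{..<r}. fraction (RX C) (xpoly C (m i)) (xpoly C d)) =
      fraction (RX C) (xpoly C (\<Sum>i<r. m i)) (xpoly C d)" if d: "d \<noteq> 0" for m d
  proof -
    have "(\<lambda>P. \<Sum>i<r. xpoly C (m i) P) = xpoly C (\<Sum>i<r. m i)"
      by (rule ext) (simp add: xpoly_def poly_sum)
    hence "(\<Oplus>\<^bsub>RX C\<^esub>i\<in>{..<r}. xpoly C (m i)) = xpoly C (\<Sum>i<r. m i)"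
      using RX_finsum[of "{..<r}" "\<lambda>i. xpoly C (m i)"] xpoly_carrier by simp
    thus ?thesis
      using RX.finsum_fraction[OF _ xpoly_regular[OF d], of "{..<r}" "\<lambda>i. xpoly C (m i)"] xpoly_carrier
      by simp
  qed
  show "\<exists>m. (\<forall>i<r. \<forall>j<r. m i j \<in> QP C) \<and>
     (\<forall>j<r. fraction (RX C) a (xpoly C c) \<otimes>\<^bsub>QX C\<^esub> to_QX C (y j) =
        (\<Oplus>\<^bsub>QX C\<^esub>i\<in>{..<r}. m i j \<otimes>\<^bsub>QX C\<^esub> to_QX C (y i))) \<and>
     fraction (RX C) (xpoly C (trace_poly a)) (xpoly C c) = (\<Oplus>\<^bsub>QX C\<^esub>i\<in>{..<r}. m i i)"
  proof (intro exI[of _ "\<lambda>i j. fraction (RX C) (xpoly C (coord (\<lambda>P. a P * y j P) i)) (xpoly C c)"] conjI allI impI)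
    fix i j
    show "fraction (RX C) (xpoly C (coord (\<lambda>P. a P * y j P) i)) (xpoly C c) \<in> QP C"
      unfolding QP_def RP_def using c xpoly_zero_iff by fastforce
  next
    fix j assume "j < r"
    have "(\<lambda>P. \<Sum>i<r. xpoly C (coord (\<lambda>P. a P * y j P) i) P * y i P) = (\<lambda>P. a P * y j P)"
      by (rule carrier_ext)
         (use ayK xyK coord_expand[OF ayK] in \<open>auto simp: xpoly_eq intro!: carrier_sum\<close>)
    thus "fraction (RX C) a (xpoly C c) \<otimes>\<^bsub>QX C\<^esub> to_QX C (y j) = (\<Oplus>\<^bsub>QX C\<^esub>i\<in>{..<r}.
        fraction (RX C) (xpoly C (coord (\<lambda>P. a P * y j P) i)) (xpoly C c) \<otimes>\<^bsub>QX C\<^esub> to_QX C (y i))"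
      unfolding comb[OF c] by (simp add: fraction_mult_to_QX a creg ybasis_carrier)
  next
    show "fraction (RX C) (xpoly C (trace_poly a)) (xpoly C c) = (\<Oplus>\<^bsub>QX C\<^esub>i\<in>{..<r}.
        fraction (RX C) (xpoly C (coord (\<lambda>P. a P * y i P) i)) (xpoly C c))"
      unfolding diag[OF c] trace_poly_def ..
  qed
  fix \<tau>
  assume "\<exists>m. (\<forall>i<r. \<forall>j<r. m i j \<in> QP C) \<and>
     (\<forall>j<r. fraction (RX C) a (xpoly C c) \<otimes>\<^bsub>QX C\<^esub> to_QX C (y j) =
        (\<Oplus>\<^bsub>QX C\<^esub>i\<in>{..<r}. m i j \<otimes>\<^bsub>QX C\<^esub> to_QX C (y i))) \<and>
     \<tau> = (\<Oplus>\<^bsub>QX C\<^esub>i\<in>{..<r}. m i i)"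
  then obtain m where m: "\<And>i j. i < r \<Longrightarrow> j < r \<Longrightarrow> m i j \<in> QP C"
    "\<And>j. j < r \<Longrightarrow> fraction (RX C) a (xpoly C c) \<otimes>\<^bsub>QX C\<^esub> to_QX C (y j) =
        (\<Oplus>\<^bsub>QX C\<^esub>i\<in>{..<r}. m i j \<otimes>\<^bsub>QX C\<^esub> to_QX C (y i))"
    "\<tau> = (\<Oplus>\<^bsub>QX C\<^esub>i\<in>{..<r}. m i i)" by blast
  have "\<exists>p q. q \<noteq> 0 \<and> m i j = fraction (RX C) (xpoly C p) (xpoly C q)" if "i < r" "j < r" for i j
    using m(1)[OF that] xpoly_zero_iff unfolding QP_def RP_def by auto
  then obtain p q where pq: "\<And>i j. i < r \<Longrightarrow> j < r \<Longrightarrow> q i j \<noteq> 0"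
    "\<And>i j. i < r \<Longrightarrow> j < r \<Longrightarrow> m i j = fraction (RX C) (xpoly C (p i j)) (xpoly C (q i j))" by metis
  \<comment> \<open>A common denominator of all entries.\<close>
  define d where "d = (\<Prod>i<r. \<Prod>j<r. q i j)"
  have d: "d \<noteq> 0" using pq(1) by (simp add: d_def)
  have qd: "q i j dvd d" if "i < r" "j < r" for i j
  proof -
    have "q i j dvd (\<Prod>j<r. q i j)" using that by (intro dvd_prodI) auto
    also have "\<dots> dvd d" unfolding d_def using that by (intro dvd_prodI) auto
    finally show ?thesis .
  qed
  define n where "n i j = p i j * (d div q i j)" for i j
  have mn: "m i j = fraction (RX C) (xpoly C (n i j)) (xpoly C d)" if "i < r" "j < r" for i j
  proof -
    have "p i j * d = n i j * q i j" using qd[OF that] by (simp add: n_def)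
    hence "poly (p i j) (x P) * poly d (x P) = poly (n i j) (x P) * poly (q i j) (x P)" for P
      by (metis poly_mult)
    thus ?thesis unfolding pq(2)[OF that]
      by (subst fraction_eq_pointwise) (auto simp: xpoly_carrier xpoly_regular pq(1) that d xpoly_eq)
  qed
  have dn: "d * coord (\<lambda>P. a P * y j P) i = c * n i j" if ij: "i < r" "j < r" for i j
  proof -
    have "fraction (RX C) (\<lambda>P. a P * y j P) (xpoly C c) =
        (\<Oplus>\<^bsub>QX C\<^esub>i\<in>{..<r}. m i j \<otimes>\<^bsub>QX C\<^esub> to_QX C (y i))"
      using m(2)[OF ij(2)] by (simp add: fraction_mult_to_QX a creg ybasis_carrier)
    also have "\<dots> = (\<Oplus>\<^bsub>QX C\<^esub>i\<in>{..<r}. fraction (RX C) (xpoly C (n i j)) (xpoly C d) \<otimes>\<^bsub>QX C\<^esub> to_QX C (y i))"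
      by (intro QX.finsum_cong' refl)
         (auto simp: mn ij to_QX_def xpoly_carrier xpoly_regular d ybasis_carrier RX.regular_one
           simp del: RX_simps(4) intro!: RX.fraction_in_carrier QX.m_closed)
    also have "\<dots> = fraction (RX C) (\<lambda>P. \<Sum>i<r. xpoly C (n i j) P * y i P) (xpoly C d)"
      by (rule comb[OF d])
    finally have e: "a P * y j P * poly d (x P) = (\<Sum>i<r. poly (n i j) (x P) * y i P) * poly c (x P)"
      if "P \<noteq> pinf" for P
      using that ayK[of j] carrier_sum[of "{..<r}" "\<lambda>i P. xpoly C (n i j) P * y i P"] xyK
      by (subst (asm) fraction_eq_pointwise) (auto simp: creg xpoly_regular d xpoly_eq)
    let ?g = "\<lambda>P. xpoly C d P * (a P * y j P)"
    have gK: "?g \<in> K" by (intro carrier_mult xpoly_carrier ayK)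
    have "coord ?g i = c * n i j"
      by (rule coord_eqI[OF gK _ ij(1)])
         (use e in \<open>simp add: xpoly_eq mult_ac sum_distrib_left\<close>)
    moreover have "coord ?g i = (\<Sum>k\<in>{()}. d * coord (\<lambda>P. a P * y j P) i)"
      by (rule coord_combination[OF gK _ _ ij(1)]) (use ayK in \<open>auto simp: xpoly_eq\<close>)
    ultimately show ?thesis by simp
  qed
  have "\<tau> = (\<Oplus>\<^bsub>QX C\<^esub>i\<in>{..<r}. fraction (RX C) (xpoly C (n i i)) (xpoly C d))"
    unfolding m(3) by (intro QX.finsum_cong' refl)
      (auto simp: mn xpoly_carrier xpoly_regular d intro!: RX.fraction_in_carrier)
  also have "\<dots> = fraction (RX C) (xpoly C (\<Sum>i<r. n i i)) (xpoly C d)" by (rule diag[OF d])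
  also have "\<dots> = fraction (RX C) (xpoly C (trace_poly a)) (xpoly C c)"
  proof -
    have "d * trace_poly a = c * (\<Sum>i<r. n i i)"
      unfolding trace_poly_def sum_distrib_left by (intro sum.cong) (auto simp: dn)
    hence "(\<Sum>i<r. n i i) * c = trace_poly a * d" by (simp add: mult.commute)
    hence "poly (\<Sum>i<r. n i i) (x P) * poly c (x P) = poly (trace_poly a) (x P) * poly d (x P)" for P
      by (metis poly_mult)
    thus ?thesis
      by (subst fraction_eq_pointwise) (auto simp: xpoly_carrier creg xpoly_regular d xpoly_eq)
  qed
  finally show "\<tau> = fraction (RX C) (xpoly C (trace_poly a)) (xpoly C c)" .
qed

end

section \<open>The dual basis\<close>

locale weierstrass_htilde = uniformized_weierstrass +
  fixes f :: "nat \<Rightarrow> complex poly poly"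
    and h :: "'a \<times> 'a \<Rightarrow> complex"
    and d :: nat
    and Ups :: "nat \<Rightarrow> 'a \<Rightarrow> complex"
  assumes min_polys: "\<forall>j\<in>{2..w_num C}. is_min_poly C j (f j)"
    and htilde: "is_htilde C f h d"
    and Upsilon: "is_Upsilon C h Ups"
begin

abbreviation "H \<equiv> diag h"

lemma Ups_carrier: "i < r \<Longrightarrow> Ups i \<in> K"
  using Upsilon by (simp add: is_Upsilon_def)

lemma h_expand: "(P, Q) \<in> fibre_product C \<Longrightarrow> h (P, Q) = (\<Sum>i<r. Ups i P * y i Q)"
proof -
  assume PQ: "(P, Q) \<in> fibre_product C"
  have "h = (\<lambda>w. \<Sum>i<r. tens C (Ups i) (y i) w)" using Upsilon by (simp add: is_Upsilon_def)
  thus ?thesis by (simp add: tens_eq[OF PQ])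
qed

lemma diagonal_fibre: "P \<noteq> pinf \<Longrightarrow> (P, P) \<in> fibre_product C"
  by (simp add: fibre_product_def)

lemma H_expand: "P \<noteq> pinf \<Longrightarrow> H P = (\<Sum>i<r. Ups i P * y i P)"
  using h_expand[OF diagonal_fibre] by (simp add: diag_def)

lemma h_carrier: "h \<in> carrier (TX C)"
  using htilde by (simp add: is_htilde_def)

lemma H_carrier: "H \<in> K"
proof -
  have "H = (\<lambda>P. \<Sum>i<r. Ups i P * y i P)"
  proof
    fix P
    show "H P = (\<Sum>i<r. Ups i P * y i P)"
    proof (cases "P = pinf")
      case True
      have "h (pinf, pinf) = 0"
        by (rule TX_vanish[OF h_carrier]) (simp add: fibre_product_def)
      thus ?thesis using True by (simp add: diag_def carrier_inf[OF ybasis_carrier])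
    qed (rule H_expand)
  qed
  moreover have "(\<lambda>P. \<Sum>i<r. Ups i P * y i P) \<in> K"
    by (intro carrier_sum carrier_mult Ups_carrier ybasis_carrier) auto
  ultimately show ?thesis by simp
qed

lemma H_tens_regular: "tens C H \<one>\<^bsub>RX C\<^esub> \<in> regular_elements (TX C)"
  using htilde by (simp add: is_htilde_def)

lemma H_nonzero: "H \<noteq> (\<lambda>P. 0)"
proof
  assume "H = (\<lambda>P. 0)"
  hence "tens C H \<one>\<^bsub>RX C\<^esub> = \<zero>\<^bsub>TX C\<^esub>" by (auto simp: tens_def)
  hence "\<one>\<^bsub>TX C\<^esub> = \<zero>\<^bsub>TX C\<^esub>"
    using TX.regular_cancel_zero[OF H_tens_regular TX.one_closed] TX.r_null[OF TX.one_closed] by (simp only:)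
  hence "(P, P) \<notin> fibre_product C" for P by (auto simp: fun_eq_iff split: if_splits)
  hence "P = pinf" for P using diagonal_fibre by blast
  hence "eventually (\<lambda>P. False) (at pinf)" by (auto simp: eventually_at_topological)
  thus False using at_neq_bot by (simp add: trivial_limit_def)
qed

lemma H_regular: "H \<in> regular_elements (RX C)"
  using H_carrier H_nonzero by (simp add: regular_elements_RX)

text \<open>Clearing denominators in \<open>h / (H \<otimes> 1) = p\<close> expresses a regular multiple of \<open>h\<close> through the product of
  all divided differences. Its \<open>j\<close>-th factor times \<open>y\<^sub>j \<otimes> 1 - 1 \<otimes> y\<^sub>j\<close> is
  \<open>f\<^sub>j(x, y\<^sub>j) \<otimes> 1 - 1 \<otimes> f\<^sub>j(x, y\<^sub>j) = 0\<close>.\<close>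
lemma h_vanishes_off_diagonal:
  assumes j: "j \<in> {2..w_num C}" and PQ: "(P, Q) \<in> fibre_product C"
  shows "(w_y C j P - w_y C j Q) * h (P, Q) = 0"
proof -
  let ?J = "{2..w_num C}"
  let ?dd = "\<lambda>j. divided_difference C (f j) j"
  let ?pd = "\<lambda>j. partial_y C (f j) j"
  let ?D = "\<Otimes>\<^bsub>TX C\<^esub>j\<in>?J. ?dd j"
  let ?E = "\<Otimes>\<^bsub>TX C\<^esub>j\<in>?J. ?pd j"
  have dd: "?dd i \<in> carrier (TX C)" and pd: "?pd i \<in> regular_elements (TX C)" if "i \<in> ?J" for i
    using that divided_difference_carrier partial_y_regular min_polys by auto
  have Ereg: "?E \<in> regular_elements (TX C)"
    and pRX: "p_RX C f = fraction (TX C) ?D ?E"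
    unfolding p_RX_def using TX.finprod_fraction[of ?J ?dd ?pd] dd pd by auto
  have Dc: "?D \<in> carrier (TX C)" using dd by (intro TX.finprod_closed) auto
  have "fraction (TX C) h (tens C H \<one>\<^bsub>RX C\<^esub>) = fraction (TX C) ?D ?E"
    using htilde pRX by (simp add: is_htilde_def)
  hence eq: "h \<otimes>\<^bsub>TX C\<^esub> ?E = ?D \<otimes>\<^bsub>TX C\<^esub> tens C H \<one>\<^bsub>RX C\<^esub>"
    using TX.fraction_eq_iff[OF h_carrier Dc H_tens_regular Ereg] by simp
  define F where "F = (\<lambda>w. (tens C (w_y C j) \<one>\<^bsub>RX C\<^esub> w + - tens C \<one>\<^bsub>RX C\<^esub> (w_y C j) w) * h w)"
  have FT: "F \<in> carrier (TX C)"
    unfolding F_def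
    by (intro TX_mult_closed TX_add_closed TX_uminus tens_carrier RX.one_closed y_carrier j h_carrier)
  have F_eq: "F (P, Q) = (w_y C j P - w_y C j Q) * h (P, Q)" if PQ: "(P, Q) \<in> fibre_product C" for P Q
    using fibre_productD[OF PQ] by (simp add: F_def tens_eq[OF PQ])
  have "F \<otimes>\<^bsub>TX C\<^esub> ?E = \<zero>\<^bsub>TX C\<^esub>"
  proof
    fix w :: "'a \<times> 'a"
    obtain P Q where w: "w = (P, Q)" by (cases w)
    show "(F \<otimes>\<^bsub>TX C\<^esub> ?E) w = \<zero>\<^bsub>TX C\<^esub> w"
    proof (cases "w \<in> fibre_product C")
      case False
      thus ?thesis using TX_vanish[OF FT] by simp
    next
      case True
      hence PQ: "(P, Q) \<in> fibre_product C" by (simp add: w)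
      have xx: "P \<noteq> pinf" "Q \<noteq> pinf" "x P = x Q" using fibre_productD[OF PQ] by auto
      have fj: "poly (at_x (f j) (x P)) (w_y C j P) = 0" "poly (at_x (f j) (x P)) (w_y C j Q) = 0"
        using min_polys j xx(1,2) unfolding is_min_poly_def by (blast, metis xx(3))
      have "(w_y C j P - w_y C j Q) * ?dd j (P, Q) = 0"
      proof -
        let ?p = "at_x (f j) (x P)" and ?u = "w_y C j P" and ?v = "w_y C j Q"
        have "?p + Polynomial.smult ?v (synthetic_div ?p ?v) = pCons (poly ?p ?v) (synthetic_div ?p ?v)"
          by (rule synthetic_div_correct)
        hence "poly ?p ?u + ?v * poly (synthetic_div ?p ?v) ?u =
            poly ?p ?v + ?u * poly (synthetic_div ?p ?v) ?u"
          by (metis poly_add poly_pCons poly_smult)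
        thus ?thesis using fj PQ by (auto simp: divided_difference_def algebra_simps)
      qed
      moreover have "?D (P, Q) = ?dd j (P, Q) * (\<Prod>i\<in>?J - {j}. ?dd i (P, Q))"
        using TX_finprod[of ?J ?dd "(P, Q)"] dd PQ prod.remove[of ?J j "\<lambda>i. ?dd i (P, Q)"] j by simp
      ultimately have D0: "(w_y C j P - w_y C j Q) * ?D (P, Q) = 0"
        by (simp only: mult.assoc[symmetric] mult_zero_left)
      have hE: "h (P, Q) * ?E (P, Q) = ?D (P, Q) * tens C H \<one>\<^bsub>RX C\<^esub> (P, Q)"
        using fun_cong[OF eq, of "(P, Q)"] by (simp only: RX_simps TX_simps)
      have "F (P, Q) * ?E (P, Q) = (w_y C j P - w_y C j Q) * (h (P, Q) * ?E (P, Q))"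
        by (simp only: F_eq[OF PQ] mult.assoc)
      also have "\<dots> = (w_y C j P - w_y C j Q) * ?D (P, Q) * tens C H \<one>\<^bsub>RX C\<^esub> (P, Q)"
        by (simp only: hE mult.assoc)
      also have "\<dots> = 0" by (simp only: D0 mult_zero_left)
      finally have "F (P, Q) * ?E (P, Q) = 0" .
      thus ?thesis by (simp add: w)
    qed
  qed
  from TX.regular_cancel_zero[OF Ereg FT this] have "F = (\<lambda>w. 0)" by simp
  thus ?thesis using F_eq[OF PQ] by simp
qed

text \<open>At a pair of points where \<open>h\<close> does not vanish, all generators of \<open>R\<^sub>X\<close> take equal values.\<close>
lemma h_diagonal:
  assumes a: "a \<in> K" and PQ: "(P, Q) \<in> fibre_product C"
  shows "a P * h (P, Q) = a Q * h (P, Q)"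
proof (cases "h (P, Q) = 0")
  case False
  have xx: "P \<noteq> pinf" "Q \<noteq> pinf" "x P = x Q" using fibre_productD[OF PQ] by auto
  have "w_y C j P = w_y C j Q" if "j \<in> {2..w_num C}" for j
    using h_vanishes_off_diagonal[OF that PQ] False by simp
  hence "y k P = y k Q" for k
    using xx by (simp add: ybasis_def)
  hence "a P = a Q" using coord_expand[OF a xx(1)] coord_expand[OF a xx(2)] xx(3) by simp
  thus ?thesis by simp
qed simp

text \<open>Both sides are the coefficients of \<open>1 \<otimes> y\<^sub>j\<close>: the left one in \<open>(b \<otimes> 1) h\<close>, the right one in
  \<open>(1 \<otimes> b) h\<close>. These two tensors agree by \<open>h_diagonal\<close>.\<close>
lemma mult_Ups:
  assumes b: "b \<in> K" and j: "j < r" and P: "P \<noteq> pinf"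
  shows "b P * Ups j P = (\<Sum>i<r. poly (coord (\<lambda>P. b P * y i P) j) (x P) * Ups i P)"
proof -
  let ?c = "\<lambda>i j. coord (\<lambda>P. b P * y i P) j"
  have byK: "(\<lambda>P. b P * y i P) \<in> K" for i by (intro carrier_mult b ybasis_carrier)
  define A where "A j = (\<lambda>P. b P * Ups j P - (\<Sum>i<r. xpoly C (?c i j) P * Ups i P))" for j
  have "A j = (\<lambda>P. 0)"
  proof (rule tensor_independent[of A, OF _ _ j])
    fix k assume "k < r"
    thus "A k \<in> K" unfolding A_def
      by (intro carrier_diff carrier_mult b carrier_sum xpoly_carrier Ups_carrier) auto
  next
    fix P Q assume PQ: "(P, Q) \<in> fibre_product C"
    have xx: "P \<noteq> pinf" "Q \<noteq> pinf" "x P = x Q" using fibre_productD[OF PQ] by auto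
    have "(\<Sum>j<r. A j P * y j Q) =
        (\<Sum>j<r. b P * Ups j P * y j Q) - (\<Sum>j<r. \<Sum>i<r. poly (?c i j) (x Q) * Ups i P * y j Q)"
      using xx by (simp add: A_def xpoly_eq left_diff_distrib sum_subtractf sum_distrib_right)
    also have "(\<Sum>j<r. b P * Ups j P * y j Q) = b P * h (P, Q)"
      by (simp add: h_expand[OF PQ] sum_distrib_left mult.assoc)
    also have "(\<Sum>j<r. \<Sum>i<r. poly (?c i j) (x Q) * Ups i P * y j Q) =
        (\<Sum>i<r. \<Sum>j<r. poly (?c i j) (x Q) * Ups i P * y j Q)" by (rule sum.swap)
    also have "\<dots> = (\<Sum>i<r. Ups i P * (\<Sum>j<r. poly (?c i j) (x Q) * y j Q))"
      unfolding sum_distrib_left by (intro sum.cong) (auto simp: mult_ac)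
    also have "\<dots> = (\<Sum>i<r. Ups i P * (b Q * y i Q))"
      using coord_expand[OF byK xx(2)] by simp
    also have "\<dots> = b Q * h (P, Q)"
      by (simp add: h_expand[OF PQ] sum_distrib_left mult_ac)
    finally show "(\<Sum>j<r. A j P * y j Q) = 0" using h_diagonal[OF b PQ] by simp
  qed
  hence "A j P = 0" by simp
  thus ?thesis using P by (simp add: A_def xpoly_eq)
qed

text \<open>By \<open>mult_Ups\<close>, the inner sum for fixed \<open>j\<close> is \<open>a y\<^sub>j U\<^sub>j\<close>, where \<open>\<tau>(a y\<^sub>i)\<close> is the sum over \<open>j\<close> of the
  \<open>j\<close>-th coordinates of \<open>a y\<^sub>i y\<^sub>j\<close>; and \<open>\<Sum> y\<^sub>j U\<^sub>j = H\<close>.\<close>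
lemma dual_basis_expansion:
  assumes a: "a \<in> K" and P: "P \<noteq> pinf"
  shows "(\<Sum>i<r. poly (trace_poly (\<lambda>P. a P * y i P)) (x P) * Ups i P) = a P * H P"
proof -
  have "(\<Sum>i<r. poly (trace_poly (\<lambda>P. a P * y i P)) (x P) * Ups i P) =
      (\<Sum>i<r. \<Sum>j<r. poly (coord (\<lambda>P. a P * y i P * y j P) j) (x P) * Ups i P)"
    by (simp add: trace_poly_def poly_sum sum_distrib_right)
  also have "\<dots> = (\<Sum>j<r. \<Sum>i<r. poly (coord (\<lambda>P. a P * y i P * y j P) j) (x P) * Ups i P)"
    by (rule sum.swap)
  also have "\<dots> = (\<Sum>j<r. a P * y j P * Ups j P)"
  proof (rule sum.cong[OF refl])
    fix j assume j: "j \<in> {..<r}"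
    have "(\<lambda>P. a P * y i P * y j P) = (\<lambda>P. a P * y j P * y i P)" for i
      by (simp add: mult_ac)
    thus "(\<Sum>i<r. poly (coord (\<lambda>P. a P * y i P * y j P) j) (x P) * Ups i P) = a P * y j P * Ups j P"
      using mult_Ups[OF carrier_mult[OF a ybasis_carrier[of j]] _ P, of j] j by simp
  qed
  also have "\<dots> = a P * H P"
    by (simp add: H_expand[OF P] sum_distrib_left mult_ac)
  finally show ?thesis .
qed

text \<open>The companion identity with the two tensor factors exchanged. Here \<open>mult_Ups\<close> is used to express
  \<open>a y\<^sub>j U\<^sub>i\<close> through the \<open>U\<^sub>k\<close> before coordinates are taken.\<close>
lemma dual_basis_expansion':
  assumes a: "a \<in> K" and P: "P \<noteq> pinf"
  shows "(\<Sum>i<r. poly (trace_poly (\<lambda>P. a P * Ups i P)) (x P) * y i P) = a P * H P"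
proof -
  let ?m = "\<lambda>i j k. coord (\<lambda>P. a P * y j P * y k P) i"
  have ayK: "(\<lambda>P. a P * y j P) \<in> K" for j by (intro carrier_mult a ybasis_carrier)
  have "coord (\<lambda>P. a P * Ups i P * y j P) j = (\<Sum>k<r. ?m i j k * coord (Ups k) j)" if "i < r" "j < r" for i j
  proof (rule coord_combination)
    show "(\<lambda>P. a P * Ups i P * y j P) \<in> K" using that by (intro carrier_mult a Ups_carrier ybasis_carrier)
    fix P assume "P \<noteq> pinf"
    thus "a P * Ups i P * y j P = (\<Sum>k<r. poly (?m i j k) (x P) * Ups k P)"
      using mult_Ups[OF ayK[of j] that(1), of P] by (simp add: mult_ac)
  qed (use that Ups_carrier in auto)
  hence "(\<Sum>i<r. poly (trace_poly (\<lambda>P. a P * Ups i P)) (x P) * y i P) =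
      (\<Sum>i<r. \<Sum>j<r. \<Sum>k<r. poly (?m i j k) (x P) * poly (coord (Ups k) j) (x P) * y i P)"
    by (simp add: trace_poly_def poly_sum sum_distrib_right)
  also have "\<dots> = (\<Sum>j<r. \<Sum>i<r. \<Sum>k<r. poly (?m i j k) (x P) * poly (coord (Ups k) j) (x P) * y i P)"
    by (rule sum.swap)
  also have "\<dots> = (\<Sum>j<r. \<Sum>k<r. \<Sum>i<r. poly (?m i j k) (x P) * poly (coord (Ups k) j) (x P) * y i P)"
    by (intro sum.cong refl sum.swap)
  also have "\<dots> = (\<Sum>j<r. \<Sum>k<r. poly (coord (Ups k) j) (x P) * (\<Sum>i<r. poly (?m i j k) (x P) * y i P))"
    by (simp add: sum_distrib_left mult_ac)
  also have "\<dots> = (\<Sum>j<r. \<Sum>k<r. poly (coord (Ups k) j) (x P) * (a P * y j P * y k P))"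
    using coord_expand[OF carrier_mult[OF ayK ybasis_carrier] P] by simp
  also have "\<dots> = (\<Sum>k<r. \<Sum>j<r. poly (coord (Ups k) j) (x P) * (a P * y j P * y k P))"
    by (rule sum.swap)
  also have "\<dots> = (\<Sum>k<r. a P * y k P * (\<Sum>j<r. poly (coord (Ups k) j) (x P) * y j P))"
    by (simp add: sum_distrib_left mult_ac)
  also have "\<dots> = (\<Sum>k<r. a P * y k P * Ups k P)"
    by (intro sum.cong refl) (use coord_expand[OF Ups_carrier P] in simp)
  also have "\<dots> = a P * H P"
    by (simp add: H_expand[OF P] sum_distrib_left mult_ac)
  finally show ?thesis .
qed

definition span_P :: "(nat \<Rightarrow> 'a \<Rightarrow> complex) \<Rightarrow> ('a \<Rightarrow> complex) set" where
  "span_P g = {w \<in> K. \<exists>s. \<forall>P. P \<noteq> pinf \<longrightarrow> w P = (\<Sum>i<r. poly (s i) (x P) * g i P)}"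

lemma span_Ups_mult:
  assumes a: "a \<in> K" and w: "w \<in> span_P Ups"
  shows "(\<lambda>P. a P * w P) \<in> span_P Ups"
proof -
  obtain s where s: "\<And>P. P \<noteq> pinf \<Longrightarrow> w P = (\<Sum>j<r. poly (s j) (x P) * Ups j P)"
    using w by (auto simp: span_P_def)
  let ?t = "\<lambda>i. \<Sum>j<r. s j * coord (\<lambda>P. a P * y i P) j"
  have "a P * w P = (\<Sum>i<r. poly (?t i) (x P) * Ups i P)" if P: "P \<noteq> pinf" for P
  proof -
    have "a P * w P = (\<Sum>j<r. poly (s j) (x P) * (a P * Ups j P))"
      by (simp add: s[OF P] sum_distrib_left mult_ac)
    also have "\<dots> = (\<Sum>j<r. \<Sum>i<r. poly (s j) (x P) * (poly (coord (\<lambda>P. a P * y i P) j) (x P) * Ups i P))"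
      unfolding sum_distrib_left[symmetric]
      by (intro sum.cong refl) (use mult_Ups[OF a _ P] in simp)
    also have "\<dots> = (\<Sum>i<r. \<Sum>j<r. poly (s j) (x P) * (poly (coord (\<lambda>P. a P * y i P) j) (x P) * Ups i P))"
      by (rule sum.swap)
    also have "\<dots> = (\<Sum>i<r. poly (?t i) (x P) * Ups i P)"
      by (simp add: poly_sum sum_distrib_right mult.assoc)
    finally show ?thesis .
  qed
  thus ?thesis using w a carrier_mult unfolding span_P_def
    by (intro CollectI conjI exI[of _ ?t]) auto
qed

lemma common_denominator:
  assumes "a \<in> K" "b \<in> regular_elements (RX C)"
  shows "\<exists>b' c. b' \<in> K \<and> (\<lambda>P. a P * b' P) \<in> K \<and> c \<noteq> 0 \<and>
    (\<forall>P. P \<noteq> pinf \<longrightarrow> b P * b' P = poly c (x P)) \<and>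
    fraction (RX C) a b = fraction (RX C) (\<lambda>P. a P * b' P) (xpoly C c)"
proof -
  have b: "b \<in> K" "b \<noteq> (\<lambda>P. 0)" using assms(2) by (auto simp: regular_elements_RX)
  obtain b' c where b': "b' \<in> K" "c \<noteq> 0" "\<And>P. P \<noteq> pinf \<Longrightarrow> b P * b' P = poly c (x P)"
    by (rule exists_multiple_in_RP[OF b]) (rule that)
  have aK: "(\<lambda>P. a P * b' P) \<in> K" by (intro carrier_mult assms(1) b'(1))
  have "a P * xpoly C c P = a P * b' P * b P" if "P \<noteq> pinf" for P
    using b'(3)[OF that] that by (simp add: xpoly_eq mult_ac)
  hence "fraction (RX C) a b = fraction (RX C) (\<lambda>P. a P * b' P) (xpoly C c)"
    using assms aK b'(2) by (subst fraction_eq_pointwise) (auto simp: xpoly_regular)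
  thus ?thesis using aK b' by blast
qed

text \<open>For \<open>z = a / c\<close> with \<open>c\<close> in \<open>\<complex>[x]\<close>, membership forces \<open>c\<close> to divide all \<open>\<tau>(a y\<^sub>i)\<close>, and
  \<open>dual_basis_expansion\<close> displays \<open>z\<close> as a combination of the \<open>U\<^sub>i / H\<close>. Conversely, the span is
  stable under \<open>R\<^sub>X\<close>, so it suffices that the trace of \<open>U\<^sub>i / H = U\<^sub>i b' / c\<close> is a polynomial. By
  \<open>dual_basis_expansion'\<close> for \<open>b'\<close> this trace is the \<open>i\<close>-th coordinate of \<open>1\<close>.\<close>
lemma complementary_module_eq:
  "complementary_module C = {fraction (RX C) w H | w. w \<in> span_P Ups}"
proof (intro equalityI subsetI)
  fix z assume z: "z \<in> complementary_module C"
  hence zQ: "z \<in> carrier (QX C)" and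
    tz: "\<And>a. a \<in> K \<Longrightarrow> trace_X C (z \<otimes>\<^bsub>QX C\<^esub> to_QX C a) \<in> to_QX C ` RP C"
    by (auto simp: complementary_module_def)
  obtain a0 b where ab: "a0 \<in> K" "b \<in> regular_elements (RX C)" "z = fraction (RX C) a0 b"
    using zQ by (rule RX.fraction_cases)
  obtain a c where a: "a \<in> K" and c: "c \<noteq> 0" and zac: "z = fraction (RX C) a (xpoly C c)"
    using common_denominator[OF ab(1,2)] ab(3) by blast
  have ayK: "(\<lambda>P. a P * y i P) \<in> K" for i by (intro carrier_mult a ybasis_carrier)
  have "\<exists>s. trace_poly (\<lambda>P. a P * y i P) = c * s" for i
  proof -
    have "fraction (RX C) (xpoly C (trace_poly (\<lambda>P. a P * y i P))) (xpoly C c) \<in> to_QX C ` RP C"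
      using tz[OF ybasis_carrier[of i]] unfolding zac
      by (simp add: fraction_mult_to_QX a xpoly_regular c ybasis_carrier trace_X_fraction ayK)
    then obtain s where s: "fraction (RX C) (xpoly C (trace_poly (\<lambda>P. a P * y i P))) (xpoly C c) =
        fraction (RX C) (xpoly C s) \<one>\<^bsub>RX C\<^esub>" by (auto simp: to_QX_def RP_def)
    have "poly (trace_poly (\<lambda>P. a P * y i P) - s * c) (x P) = 0" if "P \<noteq> pinf" for P
      using s that fraction_eq_pointwise[OF xpoly_carrier xpoly_carrier xpoly_regular[OF c] RX.regular_one]
      by (simp add: xpoly_eq)
    hence "trace_poly (\<lambda>P. a P * y i P) - s * c = 0" by (rule x_transcendental)
    thus ?thesis by (intro exI[of _ s]) (simp add: mult.commute)
  qed
  then obtain s where s: "\<And>i. trace_poly (\<lambda>P. a P * y i P) = c * s i" by metis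
  define w where "w = (\<lambda>P. \<Sum>i<r. xpoly C (s i) P * Ups i P)"
  have wK: "w \<in> K" unfolding w_def by (intro carrier_sum carrier_mult xpoly_carrier Ups_carrier) auto
  have "a P * H P = w P * xpoly C c P" if P: "P \<noteq> pinf" for P
    using dual_basis_expansion[OF a P] P
    by (simp add: s w_def xpoly_eq sum_distrib_left sum_distrib_right mult_ac)
  hence "z = fraction (RX C) w H"
    unfolding zac using a wK by (subst fraction_eq_pointwise) (auto simp: xpoly_regular c H_regular)
  moreover have "w \<in> span_P Ups" using wK by (auto simp: span_P_def w_def xpoly_eq)
  ultimately show "z \<in> {fraction (RX C) w H | w. w \<in> span_P Ups}" by blast
next
  fix z assume "z \<in> {fraction (RX C) w H | w. w \<in> span_P Ups}"
  then obtain w where w: "w \<in> span_P Ups" and z: "z = fraction (RX C) w H" by blast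
  have wK: "w \<in> K" using w by (simp add: span_P_def)
  have "trace_X C (z \<otimes>\<^bsub>QX C\<^esub> to_QX C g) \<in> to_QX C ` RP C" if g: "g \<in> K" for g
  proof -
    define v where "v = (\<lambda>P. w P * g P)"
    have v: "v \<in> span_P Ups" using span_Ups_mult[OF g w] by (simp add: v_def mult.commute)
    have vK: "v \<in> K" using v by (simp add: span_P_def)
    obtain s where s: "\<And>P. P \<noteq> pinf \<Longrightarrow> v P = (\<Sum>i<r. poly (s i) (x P) * Ups i P)"
      using v by (auto simp: span_P_def)
    obtain b' c where b': "(\<lambda>P. v P * b' P) \<in> K" "b' \<in> K" and c: "c \<noteq> 0" "\<And>P. P \<noteq> pinf \<Longrightarrow> H P * b' P = poly c (x P)"
      and vf: "fraction (RX C) v H = fraction (RX C) (\<lambda>P. v P * b' P) (xpoly C c)"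
      using common_denominator[OF vK H_regular] by blast
    have bUK: "(\<lambda>P. b' P * Ups i P) \<in> K" if "i < r" for i using that by (intro carrier_mult b'(2) Ups_carrier)
    have trb: "trace_poly (\<lambda>P. b' P * Ups i P) = c * coord \<one>\<^bsub>RX C\<^esub> i" if i: "i < r" for i
    proof -
      have "coord (xpoly C c) i = trace_poly (\<lambda>P. b' P * Ups i P)"
        by (rule coord_eqI[OF xpoly_carrier _ i])
           (use dual_basis_expansion'[OF b'(2)] c(2) in \<open>simp add: xpoly_eq mult.commute\<close>)
      moreover have "coord (xpoly C c) i = (\<Sum>k\<in>{()}. c * coord \<one>\<^bsub>RX C\<^esub> i)"
        by (rule coord_combination[OF xpoly_carrier _ _ i]) (use carrier_one in \<open>auto simp: xpoly_eq\<close>)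
      ultimately show ?thesis by simp
    qed
    have "trace_poly (\<lambda>P. v P * b' P) = (\<Sum>i<r. s i * trace_poly (\<lambda>P. b' P * Ups i P))"
      by (rule trace_poly_combination[OF b'(1)])
         (use bUK s in \<open>auto simp: sum_distrib_left sum_distrib_right mult_ac\<close>)
    also have "\<dots> = c * (\<Sum>i<r. s i * coord \<one>\<^bsub>RX C\<^esub> i)"
      using trb by (simp add: sum_distrib_left mult_ac del: RX_simps)
    finally obtain t where t: "trace_poly (\<lambda>P. v P * b' P) = c * t" by blast
    have "z \<otimes>\<^bsub>QX C\<^esub> to_QX C g = fraction (RX C) (\<lambda>P. v P * b' P) (xpoly C c)"
      using fraction_mult_to_QX[OF wK H_regular g] vf by (simp only: z v_def)
    hence "trace_X C (z \<otimes>\<^bsub>QX C\<^esub> to_QX C g) = fraction (RX C) (xpoly C (c * t)) (xpoly C c)"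
      by (simp add: trace_X_fraction[OF b'(1) c(1)] t)
    also have "\<dots> = to_QX C (xpoly C t)"
      unfolding to_QX_def
      by (subst fraction_eq_pointwise[OF xpoly_carrier xpoly_carrier xpoly_regular[OF c(1)] RX.regular_one])
         (simp add: xpoly_eq)
    finally show ?thesis by (simp add: RP_def)
  qed
  thus "z \<in> complementary_module C"
    unfolding complementary_module_def z using RX.fraction_in_carrier[OF wK H_regular] by blast
qed

section \<open>Truncation\<close>

lemma lin_span_RX:
  assumes "A \<subseteq> K" "\<And>i. i \<in> I \<Longrightarrow> g i \<in> K"
  shows "lin_span (RX C) A g I = {(\<lambda>P. \<Sum>i\<in>I. a i P * g i P) | a. a \<in> I \<rightarrow> A}"
proof -
  have "(\<Oplus>\<^bsub>RX C\<^esub>i\<in>I. a i \<otimes>\<^bsub>RX C\<^esub> g i) = (\<lambda>P. \<Sum>i\<in>I. a i P * g i P)" if "a \<in> I \<rightarrow> A" for a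
    using assms that RX_finsum[of I "\<lambda>i P. a i P * g i P"] by (auto simp: Pi_iff intro: carrier_mult)
  thus ?thesis unfolding lin_span_def by (intro Collect_cong ex_cong1) auto
qed

lemma lin_span_RP:
  assumes g: "\<And>i. i < r \<Longrightarrow> g i \<in> K"
  shows "lin_span (RX C) (RP C) g {..<r} = span_P g"
proof -
  have RP: "RP C \<subseteq> K" using xpoly_carrier by (auto simp: RP_def)
  show ?thesis
  proof (intro equalityI subsetI)
    fix w assume "w \<in> lin_span (RX C) (RP C) g {..<r}"
    then obtain a where a: "a \<in> {..<r} \<rightarrow> RP C" "w = (\<lambda>P. \<Sum>i<r. a i P * g i P)"
      using lin_span_RX[OF RP, of "{..<r}" g] g by auto
    have "\<forall>i<r. \<exists>s. a i = xpoly C s" using a(1) by (auto simp: RP_def Pi_iff)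
    then obtain s where s: "\<And>i. i < r \<Longrightarrow> a i = xpoly C (s i)" by metis
    have "w \<in> K" unfolding a(2) using s g by (intro carrier_sum carrier_mult) (auto simp: xpoly_carrier)
    moreover have "w P = (\<Sum>i<r. poly (s i) (x P) * g i P)" if "P \<noteq> pinf" for P
      using that s by (simp add: a(2) xpoly_eq)
    ultimately show "w \<in> span_P g" by (auto simp: span_P_def)
  next
    fix w assume "w \<in> span_P g"
    then obtain s where w: "w \<in> K" and s: "\<And>P. P \<noteq> pinf \<Longrightarrow> w P = (\<Sum>i<r. poly (s i) (x P) * g i P)"
      by (auto simp: span_P_def)
    have "w = (\<lambda>P. \<Sum>i<r. xpoly C (s i) P * g i P)"
      by (rule carrier_ext[OF w])
         (use g s in \<open>auto simp: xpoly_eq intro!: carrier_sum carrier_mult xpoly_carrier\<close>)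
    moreover have "lin_span (RX C) (RP C) g {..<r} =
        {(\<lambda>P. \<Sum>i<r. a i P * g i P) | a. a \<in> {..<r} \<rightarrow> RP C}"
      by (rule lin_span_RX[OF RP]) (simp add: g)
    ultimately show "w \<in> lin_span (RX C) (RP C) g {..<r}"
      by (auto intro!: exI[of _ "\<lambda>i. xpoly C (s i)"] simp: RP_def)
  qed
qed

lemma span_P_diff_multiple:
  assumes "w \<in> span_P g" "v \<in> span_P g"
  shows "(\<lambda>P. w P - xpoly C m P * v P) \<in> span_P g"
proof -
  obtain s where w: "w \<in> K" and s: "\<And>P. P \<noteq> pinf \<Longrightarrow> w P = (\<Sum>i<r. poly (s i) (x P) * g i P)"
    using assms(1) by (auto simp: span_P_def)
  obtain t where v: "v \<in> K" and t: "\<And>P. P \<noteq> pinf \<Longrightarrow> v P = (\<Sum>i<r. poly (t i) (x P) * g i P)"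
    using assms(2) by (auto simp: span_P_def)
  have "w P - xpoly C m P * v P = (\<Sum>i<r. poly (s i - m * t i) (x P) * g i P)" if "P \<noteq> pinf" for P
    using that by (simp add: s t xpoly_eq algebra_simps sum_subtractf sum_distrib_left)
  moreover have "(\<lambda>P. w P - xpoly C m P * v P) \<in> K" by (intro carrier_diff carrier_mult w v xpoly_carrier)
  ultimately show ?thesis unfolding span_P_def by (intro CollectI conjI exI[of _ "\<lambda>i. s i - m * t i"]) auto
qed

lemma span_P_generator:
  assumes "i < r" "g i \<in> K"
  shows "g i \<in> span_P g"
  unfolding span_P_def
  using assms by (intro CollectI conjI exI[of _ "\<lambda>k. if k = i then 1 else 0"])
    (auto simp: if_distrib[of "\<lambda>p. poly p _"] if_distrib[of "\<lambda>c. c * _"] cong: if_cong)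

text \<open>By \<open>leading_summand\<close>, the pole order of a nonzero \<open>w\<close> in the span of the \<open>g\<^sub>i\<close> is \<open>r q + n\<^sub>i\<close> for some
  \<open>i\<close> and \<open>q\<close>. So a multiple of \<open>x\<^sup>q g'\<^sub>i\<close> cancels its leading term, and the difference stays in that span.\<close>
lemma span_P_sub_of_equal_poles:
  assumes g: "\<And>i. i < r \<Longrightarrow> \<exists>a. a \<noteq> 0 \<and> pole (g i) (n i) a"
    and g': "\<And>i. i < r \<Longrightarrow> \<exists>a. a \<noteq> 0 \<and> pole (g' i) (n i) a"
    and distinct: "\<And>i k. i < r \<Longrightarrow> k < r \<Longrightarrow> [n i = n k] (mod r) \<Longrightarrow> i = k"
    and g'_in: "\<And>i. i < r \<Longrightarrow> g' i \<in> span_P g" and g'K: "\<And>i. i < r \<Longrightarrow> g' i \<in> K"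
    and w: "w \<in> span_P g"
  shows "w \<in> span_P g'"
  using w
proof (induction "pole_degree w" arbitrary: w rule: less_induct)
  case (less w)
  obtain s where wK: "w \<in> K" and s: "\<And>P. P \<noteq> pinf \<Longrightarrow> w P = (\<Sum>i<r. poly (s i) (x P) * g i P)"
    using less.prems by (auto simp: span_P_def)
  show ?case
  proof (cases "\<forall>k<r. s k = 0")
    case True
    hence "w P = (\<Sum>i<r. poly 0 (x P) * g' i P)" if "P \<noteq> pinf" for P using s[OF that] by simp
    thus ?thesis using wK unfolding span_P_def by (intro CollectI conjI exI[of _ "\<lambda>_. 0"]) auto
  next
    case False
    then obtain k where k: "k < r" "s k \<noteq> 0" by blast
    obtain i a where i: "i < r" "s i \<noteq> 0" and a: "a \<noteq> 0"
      "pole (\<lambda>P. \<Sum>k<r. poly (s k) (x P) * g k P) (r * degree (s i) + n i) a"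
      by (rule leading_summand[of g n k s]) (use g distinct k in auto)
    define N where "N = r * degree (s i) + n i"
    have wp: "pole w N a" unfolding N_def using a(2) by (rule pole_cong) (simp add: s)
    have wN: "pole_degree w = N" using pole_degree_eqI[OF wK wp a(1)] by simp
    obtain b where b: "b \<noteq> 0" "pole (g' i) (n i) b" using g'[OF i(1)] by blast
    define m where "m = monom (a / b) (degree (s i))"
    have m: "m \<noteq> 0" "degree m = degree (s i)" "lead_coeff m = a / b"
      using a b by (auto simp: m_def degree_monom_eq)
    define v where "v = (\<lambda>P. w P - xpoly C m P * g' i P)"
    have v: "v \<in> span_P g" unfolding v_def by (intro span_P_diff_multiple less.prems g'_in i)
    hence vK: "v \<in> K" by (simp add: span_P_def)
    have "pole (\<lambda>P. poly m (x P) * g' i P) N (a / b * b)"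
      unfolding N_def using pole_mult[OF pole_poly[OF m(1)] b(2)] m(2,3) by simp
    from pole_diff[OF wp this] have "pole (\<lambda>P. w P - poly m (x P) * g' i P) N 0" using b(1) by simp
    hence v0: "pole v N 0" by (rule pole_cong) (simp add: v_def xpoly_eq)
    have "v \<in> span_P g'"
    proof (cases "v = (\<lambda>P. 0)")
      case True
      thus ?thesis using carrier_zero unfolding span_P_def
        by (intro CollectI conjI exI[of _ "\<lambda>_. 0"]) auto
    next
      case False
      from pole_degree_less[OF vK False v0] have "pole_degree v < pole_degree w" by (simp add: wN)
      from less.hyps[OF this v] show ?thesis .
    qed
    from span_P_diff_multiple[OF this span_P_generator[of i g', OF i(1) g'K[OF i(1)]], of "- m"]
    have "(\<lambda>P. v P - xpoly C (- m) P * g' i P) \<in> span_P g'" .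
    moreover have "w = (\<lambda>P. v P - xpoly C (- m) P * g' i P)" by (rule ext) (simp add: v_def xpoly_def)
    ultimately show ?thesis by simp
  qed
qed

lemma pole_of_smaller_weight:
  assumes "smaller_weight C u v" "u \<in> K" "v \<in> K" "pole v n a" "a \<noteq> 0"
  shows "pole u n 0"
proof (cases "u = (\<lambda>P. 0)")
  case True
  thus ?thesis using pole_zero by simp
next
  case False
  hence "- wt C u < int n" using assms(1) wt_eqI[OF assms(3,4,5)] by (simp add: smaller_weight_def)
  hence "pole_degree u < n" using wt_nonpos[OF assms(2) False] by (simp add: pole_degree_def)
  thus ?thesis using pole_exists[OF assms(2) False] pole_lower by blast
qed

lemma star_index:
  assumes "l < r" "i < r"
  shows "star_index C l i < r"
    "[int (e (star_index C l i)) = int (e l) - int (e i)] (mod int r)"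
proof -
  \<comment> \<open>The difference may be negative, so a natural number in its class is chosen.\<close>
  define n where "n = nat ((int (e l) - int (e i)) mod int r)"
  have n: "[int n = int (e l) - int (e i)] (mod int r)"
    using r_pos by (simp add: n_def Cong.cong_def)
  obtain k where k: "k < r" "[n = e k] (mod r)" using std_basis_class by blast
  have "[int (e k) = int (e l) - int (e i)] (mod int r)"
    using k(2) n by (metis cong_int_iff cong_sym cong_trans)
  moreover have "k' = k" if "k' < r" "[int (e k') = int (e l) - int (e i)] (mod int r)" for k'
    using std_basis_distinct[OF that(1) k(1)] that(2) calculation by (metis cong_int_iff cong_sym cong_trans)
  ultimately have "\<exists>!k. k < r \<and> [int (e k) = int (e l) - int (e i)] (mod int r)" using k(1) by blast
  from theI'[OF this] show "star_index C l i < r"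
    "[int (e (star_index C l i)) = int (e l) - int (e i)] (mod int r)"
    by (auto simp: star_index_def)
qed

text \<open>The leading terms \<open>\<delta>\<^sub>i(x) y\<close> have orders congruent to \<open>e\<^sub>l - e\<^sub>i\<close> modulo \<open>r\<close>, hence pairwise
  incongruent ones, and both \<open>U\<^sub>i\<close> and its truncation differ from them by terms of smaller order.\<close>
lemma complementary_module_yhat:
  assumes l: "l < r" and dt: "is_leading_coeffs C d l Ups dt" and yh: "is_yhat C h l Ups dt yh"
  shows "complementary_module C = {fraction (RX C) w H | w. w \<in> lin_span (RX C) K yh {1..<r}}"
proof -
  have adm: "is_admissible C h l Ups dt yh" using yh by (simp add: is_yhat_def)
  have yhK: "yh i \<in> K" if "i < r" for i
    using adm that by (simp add: is_admissible_def is_truncation_def)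
  have span1: "lin_span (RX C) K Ups {1..<r} = lin_span (RX C) K yh {1..<r}"
    and span2: "lin_span (RX C) K yh {1..<r} = span_P yh"
    using adm lin_span_RP[of yh] yhK by (simp_all add: is_admissible_def)
  define n where "n i = r * delta C d l i + e (star_index C l i)" for i
  have yrK: "y_ring C l dt i \<in> K" for i
    unfolding y_ring_def RX_simps by (intro carrier_mult xpoly_carrier ybasis_carrier)
  have yr: "\<exists>a. a \<noteq> 0 \<and> pole (y_ring C l dt i) (n i) a" if i: "i < r" for i
  proof -
    have d1: "lead_coeff (dt i) = 1" "degree (dt i) = delta C d l i"
      using dt i unfolding is_leading_coeffs_def by blast+
    hence "dt i \<noteq> 0" by auto
    obtain b where b: "b \<noteq> 0" "pole (y (star_index C l i)) (e (star_index C l i)) b"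
      using pole_ybasis[OF star_index(1)[OF l i]] by blast
    have "pole (\<lambda>P. poly (dt i) (x P) * y (star_index C l i) P) (n i) (1 * b)"
      using pole_mult[OF pole_poly[OF \<open>dt i \<noteq> 0\<close>] b(2)] d1 by (simp add: n_def)
    hence "pole (y_ring C l dt i) (n i) (1 * b)"
      by (rule pole_cong) (simp add: y_ring_def xpoly_eq)
    thus ?thesis using b(1) by (intro exI[of _ "1 * b"]) simp
  qed
  have Ups_pole: "\<exists>a. a \<noteq> 0 \<and> pole (Ups i) (n i) a" if i: "i < r" for i
  proof -
    obtain a where a: "a \<noteq> 0" "pole (y_ring C l dt i) (n i) a" using yr[OF i] by blast
    have "smaller_weight C (\<lambda>P. Ups i P - y_ring C l dt i P) (y_ring C l dt i)"
      using dt i unfolding is_leading_coeffs_def RX_minus[OF Ups_carrier[OF i] yrK, symmetric] by blast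
    hence "pole (\<lambda>P. Ups i P - y_ring C l dt i P) (n i) 0"
      by (rule pole_of_smaller_weight[OF _ carrier_diff[OF Ups_carrier[OF i] yrK] yrK a(2,1)])
    from pole_add[OF this a(2)] show ?thesis using a(1) by auto
  qed
  have yh_pole: "\<exists>a. a \<noteq> 0 \<and> pole (yh i) (n i) a" if i: "i < r" for i
  proof -
    obtain a where a: "a \<noteq> 0" "pole (y_ring C l dt i) (n i) a" using yr[OF i] by blast
    obtain b where b: "b \<noteq> 0" "pole (Ups i) (n i) b" using Ups_pole[OF i] by blast
    have "smaller_weight C (\<lambda>P. Ups i P - yh i P) (y_ring C l dt i)"
      using adm i unfolding is_admissible_def is_truncation_def
        RX_minus[OF Ups_carrier[OF i] yhK[OF i], symmetric] by blast
    hence "pole (\<lambda>P. Ups i P - yh i P) (n i) 0"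
      by (rule pole_of_smaller_weight[OF _ carrier_diff[OF Ups_carrier[OF i] yhK[OF i]] yrK a(2,1)])
    from pole_diff[OF b(2) this] show ?thesis using b(1) by auto
  qed
  have distinct: "i = k" if ik: "i < r" "k < r" "[n i = n k] (mod r)" for i k
  proof -
    have "[n j = e (star_index C l j)] (mod r)" for j by (simp add: n_def Cong.cong_def)
    hence "[e (star_index C l i) = e (star_index C l k)] (mod r)"
      using ik(3) by (metis cong_sym cong_trans)
    hence "[int (e (star_index C l i)) = int (e (star_index C l k))] (mod int r)"
      by (simp add: cong_int_iff)
    hence "[int (e l) - int (e i) = int (e l) - int (e k)] (mod int r)"
      using star_index(2)[OF l ik(1)] star_index(2)[OF l ik(2)] by (metis cong_sym cong_trans)
    hence "[int (e l) - (int (e l) - int (e i)) = int (e l) - (int (e l) - int (e k))] (mod int r)"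
      by (rule cong_diff[OF cong_refl])
    hence "[int (e i) = int (e k)] (mod int r)"
      by (simp only: diff_diff_eq2 add_diff_cancel_left')
    hence "[e i = e k] (mod r)" by (simp add: cong_int_iff)
    thus ?thesis by (rule std_basis_distinct[OF ik(1,2)])
  qed
  have sub: "lin_span (RX C) K Ups {1..<r} \<subseteq> span_P Ups"
  proof
    fix w assume "w \<in> lin_span (RX C) K Ups {1..<r}"
    then obtain a where a: "a \<in> {1..<r} \<rightarrow> K" "w = (\<lambda>P. \<Sum>i\<in>{1..<r}. a i P * Ups i P)"
      using lin_span_RX[of K "{1..<r}" Ups] Ups_carrier by auto
    have "(\<lambda>P. \<Sum>i\<in>I. a i P * Ups i P) \<in> span_P Ups" if "I \<subseteq> {1..<r}" "finite I" for I
      using that(2,1)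
    proof (induction I)
      case empty
      thus ?case using carrier_zero unfolding span_P_def
        by (intro CollectI conjI exI[of _ "\<lambda>_. 0"]) auto
    next
      case (insert i I)
      have aU: "(\<lambda>P. a i P * Ups i P) \<in> span_P Ups"
        using insert.prems a(1) by (intro span_Ups_mult span_P_generator Ups_carrier) auto
      have "(\<lambda>P. (\<Sum>i\<in>I. a i P * Ups i P) - xpoly C (- 1) P * (a i P * Ups i P)) \<in> span_P Ups"
        using insert by (intro span_P_diff_multiple aU) auto
      moreover have "(\<Sum>i\<in>I. a i P * Ups i P) - xpoly C (- 1) P * (a i P * Ups i P) =
          (\<Sum>i\<in>insert i I. a i P * Ups i P)" for P
        using insert.hyps insert.prems carrier_inf[OF Ups_carrier[of i]] by (simp add: xpoly_def)
      ultimately show ?case by simp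
    qed
    from this[of "{1..<r}"] show "w \<in> span_P Ups" by (simp add: a(2))
  qed
  have "span_P yh = span_P Ups"
  proof (intro equalityI subsetI)
    fix w assume "w \<in> span_P yh"
    thus "w \<in> span_P Ups" using sub span1 span2 by blast
  next
    fix w assume w: "w \<in> span_P Ups"
    have "yh i \<in> span_P Ups" if "i < r" for i
      using span_P_generator[of i yh, OF that yhK[OF that]] sub span1 span2 by blast
    from span_P_sub_of_equal_poles[OF Ups_pole yh_pole distinct this yhK w] show "w \<in> span_P yh" .
  qed
  thus ?thesis using complementary_module_eq span2 by simp
qed

end

theorem theorem4p27:
  fixes C :: "'a::t2_space weierstrass_data"
    and f :: "nat \<Rightarrow> complex poly poly"
    and h :: "'a \<times> 'a \<Rightarrow> complex"
    and d l :: nat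
    and Ups yh :: "nat \<Rightarrow> 'a \<Rightarrow> complex"
    and dt :: "nat \<Rightarrow> complex poly"
  assumes "weierstrass_curve C"
    and "\<forall>j\<in>{2..w_num C}. is_min_poly C j (f j)"
    and "is_htilde C f h d"
    and "is_Upsilon C h Ups"
    and "l < w_r C" and "[d = std_basis C l] (mod w_r C)"
    and "is_leading_coeffs C d l Ups dt"
    and "is_yhat C h l Ups dt yh"
  shows "complementary_module C =
    {fraction (RX C) w (diag h) | w. w \<in> lin_span (RX C) (carrier (RX C)) yh {1..<w_r C}}"
proof -
  interpret weierstrass C by unfold_locales (rule assms(1))
  obtain pt where "uniformized_weierstrass C pt" by (rule uniformizer_exists)
  then interpret uniformized_weierstrass C pt .
  interpret weierstrass_htilde C pt f h d Ups
    by unfold_locales (rule assms(2) assms(3) assms(4))+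
  show ?thesis using assms(5,7,8) by (rule complementary_module_yhat)
qed

end
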